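(* Under the standing assumptions of the context, as $l\to\infty$, $$|\Delta^2_{\widehat{\psi_l^{\bot}}}-\Delta^2_{\widehat{\psi^M}}|=O\Big(\max\big\{\mu(l),\,l\,C_0^{-l+2\log_2\frac{1+\varepsilon(l)}{c}}\big\}\Big),\qquad |\Delta^2_{\psi_l^{\bot}}-\Delta^2_{\psi^M}|=O\Big(\max\big\{\mu(l),\,(4e^{2\omega_0})^{-l+2\log_2\frac{1+\varepsilon(l)}{c}}\big\}\Big),$$ where $C_0:=\frac{32\pi^2e^{2\omega_0}}{27}$.
   Context: Fourier transform: $\widehat f(\omega)=\int_{\mathbb{R}}f(t)e^{-it\omega}\,dt$. Let $\theta$ be odd, non-decreasing, $C^2$, with $\theta(\omega)=\pi/4$ for $\omega>\pi/3$; fix $\pi/3\le\omega_0<\pi/2$. Meyer scaling function: $\widehat{\varphi^M}(\omega)=1$ for $|\omega|\le2\omega_0$, $=\cos(\frac\pi4+\theta(\frac{\pi}{3(\pi-2\omega_0)}(|\omega|-\pi)))$ for $2\omega_0<|\omega|\le2\pi-2\omega_0$, $=0$ otherwise. Meyer mask: $2\pi$-periodic $m^M$ with $m^M(\omega)=\widehat{\varphi^M}(2\omega)$ on $[-\pi,\pi]$. Meyer wavelet: $\widehat{\psi^M}(\omega)=e^{-i\omega/2}\overline{m^M(\omega/2+\pi)}\widehat{\varphi^M}(\omega/2)$. $\|\cdot\|_C$: sup norm on $[-\pi,\pi]$. A linear method of summation $(\lambda_{n,k})$ maps $f$ with Fourier coefficients $a_k,b_k$ to $u_n(f,\omega)=\frac{a_0}2+\sum_{k=1}^n\lambda_{n,k}(a_k\cos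 k\omega+b_k\sin k\omega)$. $m^M_l:=m^M/(\cos\frac\omega2)^{2l}$. Standing assumptions: a method and a sequence $n(l)$ are fixed with $u_l:=u_{n(l)}(m^M_l,\cdot)$, $u_{1,l}:=u_{n(l)}((m^M_l)',\cdot)$ satisfying $\alpha(l):=\|u_l-m^M_l\|_C=o(l^{-1})$, $\gamma(l):=\|u_{1,l}-(m^M_l)'\|_C=o(1)$, $u_l(\pi)\ne0$; $l_0$ is fixed with $c:=\inf_{l\ge l_0}|u_l(0)|>0$ and $l\ge l_0$. $\varepsilon(l):=\alpha(l)/\|m^M_l\|_C$, $\mu(l):=l\alpha(l)+\gamma(l)$. $m_l(\omega):=(\cos\frac\omega2)^{2l}u_l(\omega)/u_l(0)$, $\widehat{\varphi_l}(\omega):=\prod_{j\ge1}m_l(\omega2^{-j})$, $\Phi_l(\omega):=\sum_{k}|\widehat{\varphi_l}(\omega+2\pi k)|^2$, $\widehat{\varphi_l^{\bot}}:=\widehat{\varphi_l}\Phi_l^{-1/2}$, $m_l^\bot(\omega):=m_l(\omega)\Phi_l(\omega)^{1/2}\Phi_l(2\omega)^{-1/2}$, $\widehat{\psi_l^\bot}(\omega):=e^{-i\omega/2}\overline{m_l^\bot(\omega/2+\pi)}\widehat{\varphi_l^\bot}(\omega/2)$. Time and frequency radii: $\Delta_f^2=\|f\|_{L^2}^{-2}\int(t-t_{0f})^2|f(t)|^2dt$, $t_{0f}=\|f\|_{L^2}^{-2}\int t|f(t)|^2dt$; $\Delta^2_{\widehat f}=\|\widehat f\|_{L^2}^{-2}\int(\omega-\omega_{0\widehat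 f})^2|\widehat f(\omega)|^2d\omega$, $\omega_{0\widehat f}=\|\widehat f\|_{L^2}^{-2}\int\omega|\widehat f(\omega)|^2d\omega$. *)

theory Defs
  imports "HOL-Analysis.Analysis" "HOL-Library.Landau_Symbols"
begin

definition C2_fun :: "(real \<Rightarrow> real) \<Rightarrow> bool" where
  "C2_fun f \<longleftrightarrow> (\<exists>f1 f2. (\<forall>x. (f has_real_derivative f1 x) (at x)) \<and>
      (\<forall>x. (f1 has_real_derivative f2 x) (at x)) \<and> continuous_on UNIV f2)"

definition meyer_phi_hat :: "(real \<Rightarrow> real) \<Rightarrow> real \<Rightarrow> real \<Rightarrow> real" where
  "meyer_phi_hat \<theta> \<omega>\<^sub>0 \<omega> =
     (if \<bar>\<omega>\<bar> \<le> 2 * \<omega>\<^sub>0 then 1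
      else if \<bar>\<omega>\<bar> \<le> 2 * pi - 2 * \<omega>\<^sub>0
        then cos (pi / 4 + \<theta> (pi / (3 * (pi - 2 * \<omega>\<^sub>0)) * (\<bar>\<omega>\<bar> - pi)))
      else 0)"

text \<open>2pi-periodic mask, equal to phi_hat(2 w) on [-pi,pi] (reduction of w to [-pi,pi))\<close>
definition meyer_mask :: "(real \<Rightarrow> real) \<Rightarrow> real \<Rightarrow> real \<Rightarrow> real" where
  "meyer_mask \<theta> \<omega>\<^sub>0 \<omega> =
     meyer_phi_hat \<theta> \<omega>\<^sub>0 (2 * (\<omega> - 2 * pi * of_int \<lfloor>(\<omega> + pi) / (2 * pi)\<rfloor>))"

definition meyer_psi_hat :: "(real \<Rightarrow> real) \<Rightarrow> real \<Rightarrow> real \<Rightarrow> complex" where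
  "meyer_psi_hat \<theta> \<omega>\<^sub>0 \<omega> =
     exp (- \<i> * of_real (\<omega> / 2)) * cnj (of_real (meyer_mask \<theta> \<omega>\<^sub>0 (\<omega> / 2 + pi)))
       * of_real (meyer_phi_hat \<theta> \<omega>\<^sub>0 (\<omega> / 2))"

text \<open>m^M_l = m^M / cos(w/2)^(2l)  (at the zeros of the cosine m^M vanishes; x/0 = 0)\<close>
definition mask_l :: "(real \<Rightarrow> real) \<Rightarrow> real \<Rightarrow> nat \<Rightarrow> real \<Rightarrow> real" where
  "mask_l \<theta> \<omega>\<^sub>0 l \<omega> = meyer_mask \<theta> \<omega>\<^sub>0 \<omega> / (cos (\<omega> / 2)) ^ (2 * l)"

definition fourier_a :: "(real \<Rightarrow> real) \<Rightarrow> nat \<Rightarrow> real" where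
  "fourier_a f k = integral {-pi..pi} (\<lambda>t. f t * cos (real k * t)) / pi"

definition fourier_b :: "(real \<Rightarrow> real) \<Rightarrow> nat \<Rightarrow> real" where
  "fourier_b f k = integral {-pi..pi} (\<lambda>t. f t * sin (real k * t)) / pi"

definition lin_sum :: "(nat \<Rightarrow> nat \<Rightarrow> real) \<Rightarrow> nat \<Rightarrow> (real \<Rightarrow> real) \<Rightarrow> real \<Rightarrow> real" where
  "lin_sum lam n f \<omega> = fourier_a f 0 / 2 +
     (\<Sum>k = 1..n. lam n k * (fourier_a f k * cos (real k * \<omega>) + fourier_b f k * sin (real k * \<omega>)))"

definition supnormC :: "(real \<Rightarrow> real) \<Rightarrow> real" where
  "supnormC f = (SUP \<omega>\<in>{-pi..pi}. \<bar>f \<omega>\<bar>)"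

definition u_l :: "(real \<Rightarrow> real) \<Rightarrow> real \<Rightarrow> (nat \<Rightarrow> nat \<Rightarrow> real) \<Rightarrow> (nat \<Rightarrow> nat) \<Rightarrow> nat \<Rightarrow> real \<Rightarrow> real" where
  "u_l \<theta> \<omega>\<^sub>0 lam nl l = lin_sum lam (nl l) (mask_l \<theta> \<omega>\<^sub>0 l)"

definition u1_l :: "(real \<Rightarrow> real) \<Rightarrow> real \<Rightarrow> (nat \<Rightarrow> nat \<Rightarrow> real) \<Rightarrow> (nat \<Rightarrow> nat) \<Rightarrow> nat \<Rightarrow> real \<Rightarrow> real" where
  "u1_l \<theta> \<omega>\<^sub>0 lam nl l = lin_sum lam (nl l) (deriv (mask_l \<theta> \<omega>\<^sub>0 l))"

definition alpha_l :: "(real \<Rightarrow> real) \<Rightarrow> real \<Rightarrow> (nat \<Rightarrow> nat \<Rightarrow> real) \<Rightarrow> (nat \<Rightarrow> nat) \<Rightarrow> nat \<Rightarrow> real" where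
  "alpha_l \<theta> \<omega>\<^sub>0 lam nl l = supnormC (\<lambda>\<omega>. u_l \<theta> \<omega>\<^sub>0 lam nl l \<omega> - mask_l \<theta> \<omega>\<^sub>0 l \<omega>)"

definition gamma_l :: "(real \<Rightarrow> real) \<Rightarrow> real \<Rightarrow> (nat \<Rightarrow> nat \<Rightarrow> real) \<Rightarrow> (nat \<Rightarrow> nat) \<Rightarrow> nat \<Rightarrow> real" where
  "gamma_l \<theta> \<omega>\<^sub>0 lam nl l = supnormC (\<lambda>\<omega>. u1_l \<theta> \<omega>\<^sub>0 lam nl l \<omega> - deriv (mask_l \<theta> \<omega>\<^sub>0 l) \<omega>)"

definition eps_l :: "(real \<Rightarrow> real) \<Rightarrow> real \<Rightarrow> (nat \<Rightarrow> nat \<Rightarrow> real) \<Rightarrow> (nat \<Rightarrow> nat) \<Rightarrow> nat \<Rightarrow> real" where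
  "eps_l \<theta> \<omega>\<^sub>0 lam nl l = alpha_l \<theta> \<omega>\<^sub>0 lam nl l / supnormC (mask_l \<theta> \<omega>\<^sub>0 l)"

definition mu_l :: "(real \<Rightarrow> real) \<Rightarrow> real \<Rightarrow> (nat \<Rightarrow> nat \<Rightarrow> real) \<Rightarrow> (nat \<Rightarrow> nat) \<Rightarrow> nat \<Rightarrow> real" where
  "mu_l \<theta> \<omega>\<^sub>0 lam nl l = real l * alpha_l \<theta> \<omega>\<^sub>0 lam nl l + gamma_l \<theta> \<omega>\<^sub>0 lam nl l"

definition c_const :: "(real \<Rightarrow> real) \<Rightarrow> real \<Rightarrow> (nat \<Rightarrow> nat \<Rightarrow> real) \<Rightarrow> (nat \<Rightarrow> nat) \<Rightarrow> nat \<Rightarrow> real" where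
  "c_const \<theta> \<omega>\<^sub>0 lam nl l0 = (INF l\<in>{l0..}. \<bar>u_l \<theta> \<omega>\<^sub>0 lam nl l 0\<bar>)"

definition m_l :: "(real \<Rightarrow> real) \<Rightarrow> real \<Rightarrow> (nat \<Rightarrow> nat \<Rightarrow> real) \<Rightarrow> (nat \<Rightarrow> nat) \<Rightarrow> nat \<Rightarrow> real \<Rightarrow> real" where
  "m_l \<theta> \<omega>\<^sub>0 lam nl l \<omega> =
     (cos (\<omega> / 2)) ^ (2 * l) * u_l \<theta> \<omega>\<^sub>0 lam nl l \<omega> / u_l \<theta> \<omega>\<^sub>0 lam nl l 0"

definition phi_hat_l :: "(real \<Rightarrow> real) \<Rightarrow> real \<Rightarrow> (nat \<Rightarrow> nat \<Rightarrow> real) \<Rightarrow> (nat \<Rightarrow> nat) \<Rightarrow> nat \<Rightarrow> real \<Rightarrow> real" where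
  "phi_hat_l \<theta> \<omega>\<^sub>0 lam nl l \<omega> = (\<Prod>j. m_l \<theta> \<omega>\<^sub>0 lam nl l (\<omega> / 2 ^ Suc j))"

definition Phi_l :: "(real \<Rightarrow> real) \<Rightarrow> real \<Rightarrow> (nat \<Rightarrow> nat \<Rightarrow> real) \<Rightarrow> (nat \<Rightarrow> nat) \<Rightarrow> nat \<Rightarrow> real \<Rightarrow> real" where
  "Phi_l \<theta> \<omega>\<^sub>0 lam nl l \<omega> =
     (\<Sum>\<^sub>\<infinity>k::int. \<bar>phi_hat_l \<theta> \<omega>\<^sub>0 lam nl l (\<omega> + 2 * pi * of_int k)\<bar> ^ 2)"

definition phi_perp_hat_l :: "(real \<Rightarrow> real) \<Rightarrow> real \<Rightarrow> (nat \<Rightarrow> nat \<Rightarrow> real) \<Rightarrow> (nat \<Rightarrow> nat) \<Rightarrow> nat \<Rightarrow> real \<Rightarrow> real" where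
  "phi_perp_hat_l \<theta> \<omega>\<^sub>0 lam nl l \<omega> =
     phi_hat_l \<theta> \<omega>\<^sub>0 lam nl l \<omega> / sqrt (Phi_l \<theta> \<omega>\<^sub>0 lam nl l \<omega>)"

definition m_perp_l :: "(real \<Rightarrow> real) \<Rightarrow> real \<Rightarrow> (nat \<Rightarrow> nat \<Rightarrow> real) \<Rightarrow> (nat \<Rightarrow> nat) \<Rightarrow> nat \<Rightarrow> real \<Rightarrow> real" where
  "m_perp_l \<theta> \<omega>\<^sub>0 lam nl l \<omega> =
     m_l \<theta> \<omega>\<^sub>0 lam nl l \<omega> * sqrt (Phi_l \<theta> \<omega>\<^sub>0 lam nl l \<omega>) / sqrt (Phi_l \<theta> \<omega>\<^sub>0 lam nl l (2 * \<omega>))"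

definition psi_perp_hat_l :: "(real \<Rightarrow> real) \<Rightarrow> real \<Rightarrow> (nat \<Rightarrow> nat \<Rightarrow> real) \<Rightarrow> (nat \<Rightarrow> nat) \<Rightarrow> nat \<Rightarrow> real \<Rightarrow> complex" where
  "psi_perp_hat_l \<theta> \<omega>\<^sub>0 lam nl l \<omega> =
     exp (- \<i> * of_real (\<omega> / 2)) * cnj (of_real (m_perp_l \<theta> \<omega>\<^sub>0 lam nl l (\<omega> / 2 + pi)))
       * of_real (phi_perp_hat_l \<theta> \<omega>\<^sub>0 lam nl l (\<omega> / 2))"

text \<open>inverse Fourier transform (convention hat f(w) = int f(t) e^{-itw} dt)\<close>
definition inv_fourier :: "(real \<Rightarrow> complex) \<Rightarrow> real \<Rightarrow> complex" where
  "inv_fourier g t = (LINT \<omega>|lborel. g \<omega> * exp (\<i> * of_real (t * \<omega>))) / of_real (2 * pi)"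

definition centre :: "(real \<Rightarrow> complex) \<Rightarrow> real" where
  "centre f = (LINT x|lborel. x * (cmod (f x))\<^sup>2) / (LINT x|lborel. (cmod (f x))\<^sup>2)"

definition radius2 :: "(real \<Rightarrow> complex) \<Rightarrow> real" where
  "radius2 f = (LINT x|lborel. (x - centre f)\<^sup>2 * (cmod (f x))\<^sup>2) / (LINT x|lborel. (cmod (f x))\<^sup>2)"

end

theory Submission
  imports Defs "HOL-Probability.Characteristic_Functions" "HOL-Probability.Sinc_Integral"
begin

text \<open>
  Both wavelets have Fourier transform \<open>exp (-i \<omega>/2) R(\<omega>)\<close> with real \<open>R\<close>. The phase is invisible in the frequency
  radius and only shifts the time centre to \<open>1/2\<close>, so by Plancherel both radii are quotients of the
  integrals of \<open>R\<^sup>2\<close>, \<open>\<omega> R\<^sup>2\<close>, \<open>\<omega>\<^sup>2 R\<^sup>2\<close> and \<open>R'\<^sup>2\<close>. It therefore suffices that \<open>R\<^sub>l - R\<close> and its derivative are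
  \<open>O(\<mu>(l) / (1 + \<omega>\<^sup>2))\<close>; the exponential terms of the maximum are not needed.

  The masks satisfy \<open>\<bar>m\<^sub>l - m\<bar>, \<bar>m\<^sub>l' - m'\<bar> = O(\<mu>)\<close>, and on the stop band \<open>\<pi> - \<omega>\<^sub>0 \<le> \<bar>\<omega>\<bar> \<le> \<pi>\<close> both \<open>m\<^sub>l\<close> and
  \<open>m\<^sub>l'\<close> are \<open>O(\<mu> (\<pi> - \<bar>\<omega>\<bar>)\<^sup>4)\<close>, because of the factor \<open>cos(\<omega>/2)^(2l)\<close>. As \<open>\<omega>\<^sub>0 \<ge> \<pi>/3\<close>, doubling an argument
  beyond the pass band leads to the stop band. This gives a \<open>2\<pi>\<close>-periodic weight \<open>D\<close> with
  \<open>\<bar>m\<^sub>l(x)\<bar> D(x) \<le> D(2x) / 4\<close>, whence \<open>\<bar>\<phi>\<^sub>l(x)\<bar> = O(\<mu> D(x) / x\<^sup>2)\<close> outside \<open>[-2\<pi>, 2\<pi>]\<close> by induction over the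
  dyadic shells, uniformly in \<open>l\<close>, and likewise for the derivative. Inside, \<open>\<phi>\<^sub>l\<close> is a product of three
  factors that are close to those of the Meyer scaling function.
\<close>

subsection \<open>Plancherel's identity for real functions\<close>

text \<open>The obstacle is decay that is uniform in \<open>l\<close>. Near every multiple of 2 pi
  the mask is close to 1, so a pointwise bound on the masks gives no decay there. What helps is that
  they vanish to high order at odd multiples of pi, which makes the scaling function vanish at the
  nonzero multiples of 2 pi. The weight D is essentially the fourth power of the distance to 2 pi Z,
  and near 2 pi Z it grows by 2^4 under doubling. Of this 16, a factor 4 pays for the growth of x^2
  and the rest for crude bounds on the masks and their derivatives. Since the Meyer scaling function
  is zero outside [-2 pi, 2 pi], a decay bound carrying the factor \<open>\<mu>\<close> is there a
  difference bound as well. The weight 1 / (1 + x^2) suits both ends: its square still beats the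
  factor x^2 in the second moment, and it survives products, dilations and periodisation, so the
  profile can be treated factor by factor.\<close>

lemma integral_swap_prob_lborel:
  fixes f :: "real \<Rightarrow> real \<Rightarrow> real" and g :: "real \<Rightarrow> real"
  assumes M: "prob_space M" and sM: "sets M = sets borel"
    and g: "integrable lborel g"
    and [measurable]: "(\<lambda>(s, x). f s x) \<in> borel_measurable (borel \<Otimes>\<^sub>M borel)"
    and bd: "\<And>s x. \<bar>f s x\<bar> \<le> K * \<bar>g x\<bar>"
  shows "(\<integral>s. (\<integral>x. f s x \<partial>lborel) \<partial>M) = (\<integral>x. (\<integral>s. f s x \<partial>M) \<partial>lborel)"
proof -
  interpret M: prob_space M by fact
  note sM [measurable_cong]
  interpret pair_sigma_finite lborel M ..
  have fm: "(\<lambda>(x, s). f s x) \<in> borel_measurable (lborel \<Otimes>\<^sub>M M)"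
    by measurable
  have "integrable (lborel \<Otimes>\<^sub>M M) (\<lambda>(x, s). f s x)"
  proof (rule Fubini_integrable)
    show "AE x in lborel. integrable M (\<lambda>s. case (x, s) of (x, s) \<Rightarrow> f s x)"
      using bd by (intro AE_I2 M.integrable_const_bound[of _ "K * \<bar>g _\<bar>"]) auto
    have "integrable lborel (\<lambda>x. K * \<bar>g x\<bar>)" using g by auto
    then show "integrable lborel (\<lambda>x. \<integral>s. norm (case (x, s) of (x, s) \<Rightarrow> f s x) \<partial>M)"
    proof (rule Bochner_Integration.integrable_bound)
      show "AE x in lborel. norm (\<integral>s. norm (case (x, s) of (x, s) \<Rightarrow> f s x) \<partial>M) \<le> norm (K * \<bar>g x\<bar>)"
      proof (intro AE_I2)
        fix x
        have "(\<integral>s. \<bar>f s x\<bar> \<partial>M) \<le> (\<integral>s. K * \<bar>g x\<bar> \<partial>M)"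
          using bd order_trans[OF abs_ge_zero bd]
          by (intro integral_mono M.integrable_const_bound[of _ "K * \<bar>g x\<bar>"]) auto
        then show "norm (\<integral>s. norm (case (x, s) of (x, s) \<Rightarrow> f s x) \<partial>M) \<le> norm (K * \<bar>g x\<bar>)"
          using order_trans[OF abs_ge_zero bd] by (simp add: M.prob_space)
      qed
    qed measurable
  qed measurable
  from Fubini_integral[OF this] show ?thesis .
qed

text \<open>For real \<open>g\<close> this is the squared modulus of the Fourier transform; cosine
  and sine transforms keep the argument within real integrals.\<close>

definition fourier_energy :: "(real \<Rightarrow> real) \<Rightarrow> real \<Rightarrow> real" where
  "fourier_energy g t = (\<integral>x. g x * cos (t * x) \<partial>lborel)\<^sup>2 + (\<integral>x. g x * sin (t * x) \<partial>lborel)\<^sup>2"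

lemma integrable_mult_bounded:
  fixes g :: "real \<Rightarrow> real"
  assumes "integrable lborel g" "f \<in> borel_measurable borel" "\<And>x. \<bar>f x\<bar> \<le> K"
  shows "integrable lborel (\<lambda>x. g x * f x)"
proof (rule Bochner_Integration.integrable_bound[of _ "\<lambda>x. K * g x"])
  show "AE x in lborel. norm (g x * f x) \<le> norm (K * g x)"
    using assms(3) by (intro AE_I2) (auto simp: abs_mult mult.commute intro!: mult_right_mono order_trans[OF assms(3)])
qed (use assms in auto)

text \<open>The real part of the characteristic function of the normal law. It turns a Gaussian
  average over frequencies into a Gaussian kernel in space.\<close>

lemma std_normal_integral_cos: "(\<integral>s. cos (u * s) \<partial>std_normal_distribution) = exp (- u\<^sup>2 / 2)"
proof -
  interpret real_distribution std_normal_distribution by (rule real_dist_normal_dist)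
  have "Re (char std_normal_distribution u) = exp (- u\<^sup>2 / 2)"
    by (simp add: char_std_normal_distribution)
  moreover have "Re (char std_normal_distribution u) = (\<integral>s. Re (iexp (u * s)) \<partial>std_normal_distribution)"
    unfolding char_def
    by (intro integral_Re[symmetric] integrable_iexp) auto
  ultimately show ?thesis by (simp add: Re_exp)
qed

lemma fourier_energy_measurable [measurable]:
  assumes [measurable]: "g \<in> borel_measurable borel"
  shows "fourier_energy g \<in> borel_measurable borel"
  unfolding fourier_energy_def by measurable

text \<open>The addition formula for the cosine merges the two squares into one kernel depending on
  x - y only, the form in which an average over \<open>t\<close> can be carried under the
  integrals.\<close>

lemma fourier_energy_double_integral:
  assumes g: "integrable lborel g"
  shows "fourier_energy g t = (\<integral>x. \<integral>y. g x * g y * cos (t * (x - y)) \<partial>lborel \<partial>lborel)"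
proof -
  have gm[measurable]: "g \<in> borel_measurable borel" using g by auto
  have i1: "integrable lborel (\<lambda>x. g x * cos (t * x))" "integrable lborel (\<lambda>x. g x * sin (t * x))"
    by (auto intro!: integrable_mult_bounded[OF g, of _ 1])
  have "(\<integral>y. g x * g y * cos (t * (x - y)) \<partial>lborel) =
     (g x * cos (t * x)) * (\<integral>y. g y * cos (t * y) \<partial>lborel) + (g x * sin (t * x)) * (\<integral>y. g y * sin (t * y) \<partial>lborel)" for x
  proof -
    have "(\<integral>y. g x * g y * cos (t * (x - y)) \<partial>lborel) = 
      (\<integral>y. (g x * cos (t * x)) * (g y * cos (t * y)) + (g x * sin (t * x)) * (g y * sin (t * y)) \<partial>lborel)"
      by (intro Bochner_Integration.integral_cong) (auto simp: right_diff_distrib cos_diff algebra_simps)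
    also have "\<dots> = (g x * cos (t * x)) * (\<integral>y. g y * cos (t * y) \<partial>lborel) + (g x * sin (t * x)) * (\<integral>y. g y * sin (t * y) \<partial>lborel)"
      using i1 by simp
    finally show ?thesis .
  qed
  then show ?thesis
    using i1 by (simp add: fourier_energy_def power2_eq_square)
qed

lemma abs_integral_le:
  fixes g :: "real \<Rightarrow> real"
  assumes "integrable lborel g" "f \<in> borel_measurable borel" "\<And>x. \<bar>f x\<bar> \<le> \<bar>g x\<bar>"
  shows "\<bar>\<integral>x. f x \<partial>lborel\<bar> \<le> (\<integral>x. \<bar>g x\<bar> \<partial>lborel)"
proof -
  have "integrable lborel f"
    using assms by (intro Bochner_Integration.integrable_bound[OF assms(1)]) auto
  then have "\<bar>\<integral>x. f x \<partial>lborel\<bar> \<le> (\<integral>x. \<bar>f x\<bar> \<partial>lborel)"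
    by (simp add: integral_abs_bound)
  also have "\<dots> \<le> (\<integral>x. \<bar>g x\<bar> \<partial>lborel)"
    using assms \<open>integrable lborel f\<close> by (intro integral_mono) auto
  finally show ?thesis .
qed

lemma fourier_energy_nonneg: "0 \<le> fourier_energy g t"
  by (simp add: fourier_energy_def)

lemma fourier_energy_le:
  assumes g: "integrable lborel g"
  shows "fourier_energy g t \<le> 2 * (\<integral>x. \<bar>g x\<bar> \<partial>lborel)\<^sup>2"
proof -
  have gm[measurable]: "g \<in> borel_measurable borel" using g by auto
  have "\<bar>\<integral>x. g x * cos (t * x) \<partial>lborel\<bar> \<le> (\<integral>x. \<bar>g x\<bar> \<partial>lborel)"
       "\<bar>\<integral>x. g x * sin (t * x) \<partial>lborel\<bar> \<le> (\<integral>x. \<bar>g x\<bar> \<partial>lborel)"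
    by (intro abs_integral_le[OF g]; auto simp: abs_mult intro!: mult_left_le)+
  from this[THEN power_mono[of _ _ 2]] show ?thesis by (simp add: fourier_energy_def)
qed

text \<open>Averaging over the frequencies s / d replaces the cosine by its Gaussian mean. The
  average moves inside one integral at a time, dominated first by the L1 norm of \<open>g\<close>
  times |g x| and then by |g x| |g y|.\<close>

lemma gauss_fourier_energy:
  assumes g: "integrable lborel g" and d: "d > 0"
  shows "(\<integral>s. fourier_energy g (s / d) \<partial>std_normal_distribution)
     = (\<integral>x. \<integral>y. g x * g y * exp (- ((x - y) / d)\<^sup>2 / 2) \<partial>lborel \<partial>lborel)"
proof -
  interpret real_distribution std_normal_distribution by (rule real_dist_normal_dist)
  have gm[measurable]: "g \<in> borel_measurable borel" using g by auto
  have P: "prob_space std_normal_distribution" by (rule prob_space_axioms)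
  define I where "I = (\<integral>x. \<bar>g x\<bar> \<partial>lborel)"
  have le: "\<bar>g x * g y * cos z\<bar> \<le> \<bar>g x\<bar> * \<bar>g y\<bar>" for x y z
    by (simp add: abs_mult mult_left_le)
  have "(\<integral>s. fourier_energy g (s / d) \<partial>std_normal_distribution)
     = (\<integral>s. \<integral>x. \<integral>y. g x * g y * cos (s / d * (x - y)) \<partial>lborel \<partial>lborel \<partial>std_normal_distribution)"
    by (simp add: fourier_energy_double_integral[OF g])
  also have "\<dots> = (\<integral>x. \<integral>s. \<integral>y. g x * g y * cos (s / d * (x - y)) \<partial>lborel \<partial>std_normal_distribution \<partial>lborel)"
  proof (rule integral_swap_prob_lborel[OF P _ g, where K = I])
    fix s x
    have "\<bar>\<integral>y. g x * g y * cos (s / d * (x - y)) \<partial>lborel\<bar> \<le> (\<integral>y. \<bar>g x * g y\<bar> \<partial>lborel)"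
      using g by (intro abs_integral_le) (auto simp: abs_mult mult_left_le)
    then show "\<bar>\<integral>y. g x * g y * cos (s / d * (x - y)) \<partial>lborel\<bar> \<le> I * \<bar>g x\<bar>"
      by (simp add: I_def abs_mult mult.commute)
  qed auto
  also have "\<dots> = (\<integral>x. \<integral>y. \<integral>s. g x * g y * cos (s / d * (x - y)) \<partial>std_normal_distribution \<partial>lborel \<partial>lborel)"
  proof (rule Bochner_Integration.integral_cong[OF refl])
    fix x
    show "(\<integral>s. \<integral>y. g x * g y * cos (s / d * (x - y)) \<partial>lborel \<partial>std_normal_distribution)
       = (\<integral>y. \<integral>s. g x * g y * cos (s / d * (x - y)) \<partial>std_normal_distribution \<partial>lborel)"
      using le by (intro integral_swap_prob_lborel[OF P _ g, where K = "\<bar>g x\<bar>"]) auto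
  qed
  also have "\<dots> = (\<integral>x. \<integral>y. g x * g y * exp (- ((x - y) / d)\<^sup>2 / 2) \<partial>lborel \<partial>lborel)"
  proof (intro Bochner_Integration.integral_cong refl)
    fix x y
    have "(\<integral>s. g x * g y * cos (s / d * (x - y)) \<partial>std_normal_distribution) = 
       g x * g y * (\<integral>s. cos ((x - y) / d * s) \<partial>std_normal_distribution)"
      by (simp add: mult_ac)
    then show "(\<integral>s. g x * g y * cos (s / d * (x - y)) \<partial>std_normal_distribution) = g x * g y * exp (- ((x - y) / d)\<^sup>2 / 2)"
      by (simp only: std_normal_integral_cos)
  qed
  finally show ?thesis .
qed

text \<open>The substitutions are s = d t on the frequency side and y = x + d z on the space side.
  Each yields a factor d, and the root of 2 pi from the normal density enters once as a divisor and
  once as a multiplier, which leaves 2 pi.\<close>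

lemma gauss_regularised_plancherel:
  assumes g: "integrable lborel g" and d: "d > 0"
  shows "(\<integral>t. fourier_energy g t * exp (- (d * t)\<^sup>2 / 2) \<partial>lborel)
     = 2 * pi * (\<integral>x. g x * (\<integral>z. g (x + d * z) \<partial>std_normal_distribution) \<partial>lborel)"
proof -
  have gm[measurable]: "g \<in> borel_measurable borel" using g by auto
  have "(\<integral>s. fourier_energy g (s / d) \<partial>std_normal_distribution) = 
    (\<integral>s. std_normal_density s * fourier_energy g (s / d) \<partial>lborel)"
    by (subst integral_density) auto
  also have "\<dots> = d * (\<integral>t. std_normal_density (d * t) * fourier_energy g t \<partial>lborel)"
    using d by (subst lborel_integral_real_affine[where c = d and t = 0]) auto
  also have "(\<integral>t. std_normal_density (d * t) * fourier_energy g t \<partial>lborel)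
     = (1 / sqrt (2 * pi)) * (\<integral>t. fourier_energy g t * exp (- (d * t)\<^sup>2 / 2) \<partial>lborel)"
    by (subst integral_mult_right_zero[symmetric], intro Bochner_Integration.integral_cong)
       (auto simp: std_normal_density_def)
  finally have 1: "(\<integral>s. fourier_energy g (s / d) \<partial>std_normal_distribution) = 
    d / sqrt (2 * pi) * (\<integral>t. fourier_energy g t * exp (- (d * t)\<^sup>2 / 2) \<partial>lborel)" by simp
  have "(\<integral>y. g x * g y * exp (- ((x - y) / d)\<^sup>2 / 2) \<partial>lborel) = 
    d * sqrt (2 * pi) * (g x * (\<integral>z. g (x + d * z) \<partial>std_normal_distribution))" for x
  proof -
    have "(\<integral>y. g x * g y * exp (- ((x - y) / d)\<^sup>2 / 2) \<partial>lborel) = 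
       d * (\<integral>z. g x * g (x + d * z) * exp (- z\<^sup>2 / 2) \<partial>lborel)"
      using d by (subst lborel_integral_real_affine[where c = d and t = x]) auto
    also have "(\<integral>z. g x * g (x + d * z) * exp (- z\<^sup>2 / 2) \<partial>lborel) = 
       (\<integral>z. (sqrt (2 * pi) * g x) * (std_normal_density z * g (x + d * z)) \<partial>lborel)"
      by (intro Bochner_Integration.integral_cong) (auto simp: std_normal_density_def)
    also have "\<dots> = sqrt (2 * pi) * g x * (\<integral>z. g (x + d * z) \<partial>std_normal_distribution)"
      by (subst integral_density) auto
    finally show ?thesis by simp
  qed
  then have 2: "(\<integral>s. fourier_energy g (s / d) \<partial>std_normal_distribution) = 
     d * sqrt (2 * pi) * (\<integral>x. g x * (\<integral>z. g (x + d * z) \<partial>std_normal_distribution) \<partial>lborel)"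
    by (simp add: gauss_fourier_energy[OF g d])
  define r where "r = sqrt (2 * pi)"
  have "r > 0" "r * r = 2 * pi" by (simp_all add: r_def)
  then show ?thesis
    using 1 2 d unfolding r_def[symmetric] by (simp add: field_simps flip: mult.assoc)
qed

text \<open>Let the Gaussian factor increase to 1. The space side converges by dominated
  convergence, with the pointwise limit from continuity and the majorant from boundedness; the
  frequency side increases. Monotone convergence then yields integrability of the energy together
  with its integral.\<close>

theorem plancherel_real:
  fixes g :: "real \<Rightarrow> real"
  assumes g: "integrable lborel g" and cont: "continuous_on UNIV g" and bd: "\<And>x. \<bar>g x\<bar> \<le> K"
  shows "has_bochner_integral lborel (fourier_energy g) (2 * pi * (\<integral>x. (g x)\<^sup>2 \<partial>lborel))"
proof -
  interpret real_distribution std_normal_distribution by (rule real_dist_normal_dist)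
  have gm[measurable]: "g \<in> borel_measurable borel" using g by auto
  have K: "0 \<le> K" using order_trans[OF abs_ge_zero bd] .
  define d :: "nat \<Rightarrow> real" where "d n = 1 / real (Suc n)" for n
  have d: "d n > 0" for n by (simp add: d_def)
  have dlim: "d \<longlonglongrightarrow> 0" unfolding d_def by (rule LIMSEQ_Suc[OF lim_1_over_n])
  define f where "f n t = fourier_energy g t * exp (- (d n * t)\<^sup>2 / 2)" for n t
  have inner: "(\<lambda>n. \<integral>z. g (x + d n * z) \<partial>std_normal_distribution) \<longlonglongrightarrow> g x" for x
  proof -
    have "(\<lambda>n. \<integral>z. g (x + d n * z) \<partial>std_normal_distribution) \<longlonglongrightarrow> (\<integral>z. g x \<partial>std_normal_distribution)"
    proof (rule integral_dominated_convergence[where w = "\<lambda>_. K"])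
      have "(\<lambda>n. g (x + d n * z)) \<longlonglongrightarrow> g x" for z
      proof (rule isCont_tendsto_compose[of x g])
        show "isCont g x" using cont by (simp add: continuous_on_eq_continuous_at)
        show "(\<lambda>n. x + d n * z) \<longlonglongrightarrow> x" using tendsto_add[OF tendsto_const[of x] tendsto_mult_right[OF dlim, of z]] by simp
      qed
      then show "AE z in std_normal_distribution. (\<lambda>n. g (x + d n * z)) \<longlonglongrightarrow> g x" by simp
    qed (use bd K in auto)
    then show ?thesis using prob_space by simp
  qed
  have "(\<lambda>n. \<integral>x. g x * (\<integral>z. g (x + d n * z) \<partial>std_normal_distribution) \<partial>lborel) \<longlonglongrightarrow> (\<integral>x. g x * g x \<partial>lborel)"
  proof (rule integral_dominated_convergence[where w = "\<lambda>x. \<bar>g x\<bar> * K"])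
    show "AE x in lborel. (\<lambda>n. g x * (\<integral>z. g (x + d n * z) \<partial>std_normal_distribution)) \<longlonglongrightarrow> g x * g x"
      by (intro AE_I2 tendsto_intros inner)
    show "AE x in lborel. norm (g x * (\<integral>z. g (x + d n * z) \<partial>std_normal_distribution)) \<le> \<bar>g x\<bar> * K" for n
    proof (intro AE_I2)
      fix x
      have "\<bar>\<integral>z. g (x + d n * z) \<partial>std_normal_distribution\<bar> \<le> (\<integral>z. \<bar>g (x + d n * z)\<bar> \<partial>std_normal_distribution)"
        by (rule integral_abs_bound)
      also have "\<dots> \<le> (\<integral>z. K \<partial>std_normal_distribution)"
        using bd K by (intro integral_mono integrable_const_bound[of _ K]) auto
      finally show "norm (g x * (\<integral>z. g (x + d n * z) \<partial>std_normal_distribution)) \<le> \<bar>g x\<bar> * K"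
        using prob_space by (auto simp: abs_mult intro!: mult_left_mono)
    qed
  qed (use g in auto)
  then have "(\<lambda>n. 2 * pi * (\<integral>x. g x * (\<integral>z. g (x + d n * z) \<partial>std_normal_distribution) \<partial>lborel)) \<longlonglongrightarrow> 2 * pi * (\<integral>x. (g x)\<^sup>2 \<partial>lborel)"
    unfolding power2_eq_square by (intro tendsto_intros)
  then have lim: "(\<lambda>n. \<integral>t. f n t \<partial>lborel) \<longlonglongrightarrow> 2 * pi * (\<integral>x. (g x)\<^sup>2 \<partial>lborel)"
    by (simp only: f_def gauss_regularised_plancherel[OF g d])
  have int: "integrable lborel (f n)" for n
  proof -
    have "integrable lborel (\<lambda>t. std_normal_density (0 + d n * t))"
      using d[of n] by (intro lborel_integrable_real_affine integrable_normal_density) auto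
    from integrable_mult_bounded[OF integrable_mult_right[OF this, of "sqrt (2 * pi)"], of "fourier_energy g"]
    have "integrable lborel (\<lambda>t. (sqrt (2 * pi) * std_normal_density (0 + d n * t)) * fourier_energy g t)"
      using fourier_energy_le[OF g] fourier_energy_nonneg[of g] by (auto simp: abs_of_nonneg)
    moreover have "sqrt (2 * pi) * std_normal_density (0 + d n * t) = exp (- (d n * t)\<^sup>2 / 2)" for t
      by (simp add: std_normal_density_def)
    ultimately show ?thesis by (simp add: f_def[abs_def] mult.commute)
  qed
  have mono: "mono (\<lambda>n. f n t)" for t
  proof (intro monoI)
    fix m n :: nat assume "m \<le> n"
    then have "d n \<le> d m" by (simp add: d_def frac_le)
    then have "(d n)\<^sup>2 \<le> (d m)\<^sup>2" using d[of n] by (intro power_mono) auto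
    then have "(d n)\<^sup>2 * t\<^sup>2 \<le> (d m)\<^sup>2 * t\<^sup>2" by (intro mult_right_mono) auto
    then show "f m t \<le> f n t"
      unfolding f_def by (intro mult_left_mono fourier_energy_nonneg) (auto simp: power_mult_distrib)
  qed
  have ptw: "(\<lambda>n. f n t) \<longlonglongrightarrow> fourier_energy g t" for t
  proof -
    have "(\<lambda>n. f n t) \<longlonglongrightarrow> fourier_energy g t * exp (- (0 * t)\<^sup>2 / 2)"
      unfolding f_def by (intro tendsto_intros dlim) auto
    then show ?thesis by simp
  qed
  show ?thesis
    unfolding has_bochner_integral_iff
    using integral_monotone_convergence_nonneg[of lborel f "fourier_energy g", OF int _ _ _ lim] mono ptw
    by (auto simp: f_def fourier_energy_nonneg)
qed

section \<open>Quadratic decay weights and Plancherel's identity for derivatives\<close>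

lemma peetre_inequality: "1 + (a::real)\<^sup>2 \<le> 2 * (1 + b\<^sup>2) * (1 + (a - b)\<^sup>2)"
proof -
  have "a\<^sup>2 \<le> 2 * b\<^sup>2 + 2 * (a - b)\<^sup>2"
    \<comment> \<open>The difference of the two sides is the square of a - 2 b.\<close>
    using sum_squares_ge_zero[of "a - 2 * b" 0] by (simp add: power2_eq_square algebra_simps)
  moreover have "2 * (1 + b\<^sup>2) * (1 + (a - b)\<^sup>2) = 2 + 2 * b\<^sup>2 + 2 * (a - b)\<^sup>2 + 2 * (b\<^sup>2 * (a - b)\<^sup>2)"
    unfolding power2_eq_square by (simp add: algebra_simps)
  moreover have "0 \<le> b\<^sup>2 * (a - b)\<^sup>2" by simp
  ultimately show ?thesis by linarith
qed

lemma divide_1_plus_square_le: "0 \<le> (C::real) \<Longrightarrow> C / (1 + x\<^sup>2) \<le> C"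
  by (simp add: divide_le_eq add_pos_nonneg distrib_left)

lemma integrable_inverse_1_plus_square_lborel: "integrable lborel (\<lambda>x::real. 1 / (1 + x\<^sup>2))"
  using integrable_inverse_1_plus_square
  by (simp add: einterval_eq set_integrable_def inverse_eq_divide)

lemma integrable_decay:
  fixes f :: "real \<Rightarrow> real"
  assumes "f \<in> borel_measurable borel" "\<And>x. \<bar>f x\<bar> \<le> C / (1 + x\<^sup>2)"
  shows "integrable lborel f"
proof (rule Bochner_Integration.integrable_bound[OF integrable_mult_right[OF integrable_inverse_1_plus_square_lborel, of C]])
  have "C \<ge> 0" using order_trans[OF abs_ge_zero assms(2)[of 0]] by simp
  then show "AE x in lborel. norm (f x) \<le> norm (C * (1 / (1 + x\<^sup>2)))"
    using assms(2) by (auto simp: abs_of_nonneg add_nonneg_nonneg)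
qed (use assms in auto)

text \<open>Translation by h multiplies the Fourier transform by a unimodular factor, whose distance
  from 1 is 2 |sin (t h / 2)|.\<close>

lemma fourier_energy_diff:
  assumes g: "integrable lborel g"
  shows "fourier_energy (\<lambda>x. g (x + h) - g x) t = (2 * sin (t * h / 2))\<^sup>2 * fourier_energy g t"
proof -
  have gm[measurable]: "g \<in> borel_measurable borel" using g by auto
  define A where "A = (\<integral>x. g x * cos (t * x) \<partial>lborel)"
  define B where "B = (\<integral>x. g x * sin (t * x) \<partial>lborel)"
  have i1: "integrable lborel (\<lambda>x. g x * cos (t * x))" "integrable lborel (\<lambda>x. g x * sin (t * x))"
    by (auto intro!: integrable_mult_bounded[OF g, of _ 1])
  have gh: "integrable lborel (\<lambda>x. g (x + h))"
    using lborel_integrable_real_affine[OF g, of 1 h] by (simp add: add.commute)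
  have i2: "integrable lborel (\<lambda>x. g (x + h) * cos (t * x))" "integrable lborel (\<lambda>x. g (x + h) * sin (t * x))"
    by (auto intro!: integrable_mult_bounded[OF gh, of _ 1])
  have "(\<integral>x. g (x + h) * cos (t * x) \<partial>lborel) = (\<integral>x. g x * cos (t * x - t * h) \<partial>lborel)"
    by (subst lborel_integral_real_affine[where c = 1 and t = "- h"]) (auto simp: algebra_simps)
  also have "\<dots> = (\<integral>x. cos (t * h) * (g x * cos (t * x)) + sin (t * h) * (g x * sin (t * x)) \<partial>lborel)"
    by (intro Bochner_Integration.integral_cong) (auto simp: cos_diff algebra_simps)
  also have "\<dots> = cos (t * h) * A + sin (t * h) * B"
    using i1 by (simp add: A_def B_def)
  finally have c: "(\<integral>x. g (x + h) * cos (t * x) \<partial>lborel) = cos (t * h) * A + sin (t * h) * B" .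
  have "(\<integral>x. g (x + h) * sin (t * x) \<partial>lborel) = (\<integral>x. g x * sin (t * x - t * h) \<partial>lborel)"
    by (subst lborel_integral_real_affine[where c = 1 and t = "- h"]) (auto simp: algebra_simps)
  also have "\<dots> = (\<integral>x. cos (t * h) * (g x * sin (t * x)) - sin (t * h) * (g x * cos (t * x)) \<partial>lborel)"
    by (intro Bochner_Integration.integral_cong) (auto simp: sin_diff algebra_simps)
  also have "\<dots> = cos (t * h) * B - sin (t * h) * A"
    using i1 by (simp add: A_def B_def)
  finally have s: "(\<integral>x. g (x + h) * sin (t * x) \<partial>lborel) = cos (t * h) * B - sin (t * h) * A" .
  have "fourier_energy (\<lambda>x. g (x + h) - g x) t = 
     (cos (t * h) * A + sin (t * h) * B - A)\<^sup>2 + (cos (t * h) * B - sin (t * h) * A - B)\<^sup>2"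
    unfolding fourier_energy_def left_diff_distrib using i1 i2 by (simp add: c s A_def B_def)
  also have "\<dots> = (2 - 2 * cos (t * h)) * (A\<^sup>2 + B\<^sup>2)"
  proof -
    have "(sin (t * h))\<^sup>2 + (cos (t * h))\<^sup>2 = 1" by simp
    then show ?thesis by algebra
  qed
  also have "2 - 2 * cos (t * h) = (2 * sin (t * h / 2))\<^sup>2"
    using cos_double_sin[of "t * h / 2"] by (simp add: power_mult_distrib)
  finally show ?thesis by (simp add: fourier_energy_def A_def B_def)
qed

lemma fourier_energy_cmult: "fourier_energy (\<lambda>x. c * g x) t = c\<^sup>2 * fourier_energy g t"
  by (simp add: fourier_energy_def mult.assoc power_mult_distrib algebra_simps)

text \<open>Applied to dyadic difference quotients, Plancherel's identity increases to its analogue for the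
  derivative because \<open>\<bar>2 sin (t h / 2) / h\<bar>\<close> grows when \<open>h\<close> is halved.\<close>
lemma plancherel_deriv:
  fixes g g' :: "real \<Rightarrow> real"
  assumes d: "\<And>x. (g has_real_derivative g' x) (at x)"
    and gb: "\<And>x. \<bar>g x\<bar> \<le> C / (1 + x\<^sup>2)" and gb': "\<And>x. \<bar>g' x\<bar> \<le> C / (1 + x\<^sup>2)"
  shows "has_bochner_integral lborel (\<lambda>t. t\<^sup>2 * fourier_energy g t) (2 * pi * (\<integral>x. (g' x)\<^sup>2 \<partial>lborel))"
proof -
  have cont: "continuous_on UNIV g"
    using d DERIV_isCont by (auto simp: continuous_on_eq_continuous_at)
  then have gm[measurable]: "g \<in> borel_measurable borel" by (rule borel_measurable_continuous_onI)
  have g: "integrable lborel g" by (rule integrable_decay[OF gm gb])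
  have C: "0 \<le> C" using order_trans[OF abs_ge_zero gb[of 0]] by simp
  define h :: "nat \<Rightarrow> real" where "h n = 1 / 2 ^ n" for n
  have h: "0 < h n" "h n \<le> 1" for n by (auto simp: h_def)
  have hlim: "h \<longlonglongrightarrow> 0"
    unfolding h_def using LIMSEQ_power_zero[of "1/2::real"] by (simp add: power_divide)
  define q where "q n x = (1 / h n) * (g (x + h n) - g x)" for n x
  have qm[measurable]: "q n \<in> borel_measurable borel" for n unfolding q_def by measurable
  have qb: "\<bar>q n x\<bar> \<le> 4 * C / (1 + x\<^sup>2)" for n x
  proof -
    \<comment> \<open>The mean value point lies within distance 1 of x because the increment is at
      most 1; Peetre's inequality then exchanges the weight there for four times the weight at
      x.\<close>
    obtain \<xi> where \<xi>: "x < \<xi>" "\<xi> < x + h n" "g (x + h n) - g x = h n * g' \<xi>"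
      using MVT2[of x "x + h n" g g'] d h(1)[of n] by auto
    have "(x - \<xi>)\<^sup>2 \<le> 1" using \<xi> h(2)[of n] by (subst abs_square_le_1) auto
    then have "2 * (1 + \<xi>\<^sup>2) * (1 + (x - \<xi>)\<^sup>2) \<le> 2 * (1 + \<xi>\<^sup>2) * 2"
      by (intro mult_left_mono) auto
    then have "1 + x\<^sup>2 \<le> 4 * (1 + \<xi>\<^sup>2)" using peetre_inequality[of x \<xi>] by linarith
    moreover have p: "0 < 1 + x\<^sup>2" "0 < 1 + \<xi>\<^sup>2" by (simp_all add: add_pos_nonneg)
    ultimately have "C / (1 + \<xi>\<^sup>2) \<le> 4 * C / (1 + x\<^sup>2)"
      using C mult_left_mono[of "1 + x\<^sup>2" "4 * (1 + \<xi>\<^sup>2)" C] by (simp add: field_simps)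
    moreover have "q n x = g' \<xi>" using h(1)[of n] \<xi>(3) by (simp add: q_def)
    ultimately show ?thesis using gb'[of \<xi>] by linarith
  qed
  have qlim: "(\<lambda>n. q n x) \<longlonglongrightarrow> g' x" for x
  proof -
    have "((\<lambda>h. (g (x + h) - g x) / h) \<longlongrightarrow> g' x) (at 0)" using d[of x] by (simp add: DERIV_def)
    then have "(\<lambda>n. (g (x + h n) - g x) / h n) \<longlonglongrightarrow> g' x"
      by (rule filterlim_compose) (use h hlim in \<open>auto simp: filterlim_at less_imp_neq intro!: always_eventually, metis less_irrefl\<close>)
    then show ?thesis by (simp add: q_def)
  qed
  have g'm[measurable]: "g' \<in> borel_measurable borel"
    by (rule borel_measurable_LIMSEQ_real[OF qlim]) auto
  define F where "F n t = (2 * sin (t * h n / 2) / h n)\<^sup>2 * fourier_energy g t" for n t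
  have qe: "fourier_energy (q n) t = F n t" for n t
    unfolding q_def fourier_energy_cmult fourier_energy_diff[OF g] F_def
    by (simp add: power_divide)
  have qi: "integrable lborel (q n)" for n by (rule integrable_decay[OF qm qb])
  have pl: "has_bochner_integral lborel (F n) (2 * pi * (\<integral>x. (q n x)\<^sup>2 \<partial>lborel))" for n
  proof -
    have "continuous_on UNIV (q n)"
      unfolding q_def by (intro continuous_intros continuous_on_compose2[OF cont]) auto
    moreover have "\<bar>q n x\<bar> \<le> 4 * C" for x
      using qb[of n x] divide_1_plus_square_le[of "4 * C" x] C by linarith
    ultimately have "has_bochner_integral lborel (fourier_energy (q n)) (2 * pi * (\<integral>x. (q n x)\<^sup>2 \<partial>lborel))"
      by (rule plancherel_real[OF qi])
    then show ?thesis by (simp add: qe[abs_def])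
  qed
  have "(\<lambda>n. \<integral>x. (q n x)\<^sup>2 \<partial>lborel) \<longlonglongrightarrow> (\<integral>x. (g' x)\<^sup>2 \<partial>lborel)"
  proof (rule integral_dominated_convergence[where w = "\<lambda>x. (4 * C) * (4 * C / (1 + x\<^sup>2))"])
    show "AE x in lborel. norm ((q n x)\<^sup>2) \<le> (4 * C) * (4 * C / (1 + x\<^sup>2))" for n
    proof (intro AE_I2)
      fix x
      have "4 * C / (1 + x\<^sup>2) \<le> 4 * C"
        using C by (intro divide_1_plus_square_le) simp
      then have "\<bar>q n x\<bar> * \<bar>q n x\<bar> \<le> (4 * C) * (4 * C / (1 + x\<^sup>2))"
        using qb[of n x] C by (intro mult_mono) auto
      then show "norm ((q n x)\<^sup>2) \<le> (4 * C) * (4 * C / (1 + x\<^sup>2))"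
        by (simp add: power2_eq_square abs_mult)
    qed
    show "AE x in lborel. (\<lambda>n. (q n x)\<^sup>2) \<longlonglongrightarrow> (g' x)\<^sup>2" by (intro AE_I2 tendsto_intros qlim)
    show "integrable lborel (\<lambda>x. 4 * C * (4 * C / (1 + x\<^sup>2)))"
      using integrable_mult_right[OF integrable_inverse_1_plus_square_lborel, of "4 * C * (4 * C)"] by simp
  qed auto
  then have lim: "(\<lambda>n. \<integral>t. F n t \<partial>lborel) \<longlonglongrightarrow> 2 * pi * (\<integral>x. (g' x)\<^sup>2 \<partial>lborel)"
    using pl by (simp add: has_bochner_integral_iff tendsto_mult_left)
  have mono: "mono (\<lambda>n. F n t)" for t
  proof (rule incseq_SucI)
    fix n
    define s where "s = t * h (Suc n) / 2"
    have "\<bar>sin (2 * s)\<bar> \<le> 2 * \<bar>sin s\<bar>"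
      by (simp add: sin_double abs_mult mult_left_le)
    then have "(sin (2 * s))\<^sup>2 \<le> (2 * sin s)\<^sup>2"
      by (subst abs_le_square_iff[symmetric]) (simp add: abs_mult)
    moreover have "h n = 2 * h (Suc n)" by (simp add: h_def)
    ultimately have "(2 * sin (t * h n / 2) / h n)\<^sup>2 \<le> (2 * sin (t * h (Suc n) / 2) / h (Suc n))\<^sup>2"
      using h(1)[of "Suc n"] by (simp add: s_def power_divide power_mult_distrib field_simps)
    then show "F n t \<le> F (Suc n) t"
      unfolding F_def by (intro mult_right_mono fourier_energy_nonneg)
  qed
  have ptw: "(\<lambda>n. F n t) \<longlonglongrightarrow> t\<^sup>2 * fourier_energy g t" for t
  proof -
    have "((\<lambda>x. 2 * sin (t * x / 2)) has_real_derivative t) (at 0)"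
      by (auto intro!: derivative_eq_intros)
    then have "((\<lambda>h. (2 * sin (t * h / 2)) / h) \<longlongrightarrow> t) (at 0)" by (simp add: DERIV_def)
    then have "(\<lambda>n. 2 * sin (t * h n / 2) / h n) \<longlonglongrightarrow> t"
      by (rule filterlim_compose) (use h hlim in \<open>auto simp: filterlim_at less_imp_neq intro!: always_eventually, metis less_irrefl\<close>)
    then show ?thesis unfolding F_def by (intro tendsto_intros)
  qed
  have "AE t in lborel. 0 \<le> F n t" for n by (simp add: F_def fourier_energy_nonneg)
  then show ?thesis
    unfolding has_bochner_integral_iff
    using integral_monotone_convergence_nonneg[of lborel F "\<lambda>t. t\<^sup>2 * fourier_energy g t", OF _ _ _ _ lim] mono ptw pl
    by (auto simp: has_bochner_integral_iff)
qed

section \<open>The time radius of a real profile with a phase\<close>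

lemma fourier_energy_minus: "fourier_energy g (- t) = fourier_energy g t"
  by (simp add: fourier_energy_def)

text \<open>The phase merges with the kernel of the inverse transform into a kernel at t - 1/2; 4
  pi^2 is the square of the normalisation.\<close>

lemma cmod_inv_fourier_phase:
  assumes g: "integrable lborel g"
  shows "(cmod (inv_fourier (\<lambda>\<omega>. exp (- \<i> * of_real (\<omega> / 2)) * of_real (g \<omega>)) t))\<^sup>2
    = fourier_energy g (t - 1/2) / (4 * pi\<^sup>2)"
proof -
  have gm[measurable]: "g \<in> borel_measurable borel" using g by auto
  let ?s = "t - 1 / 2"
  have i1: "integrable lborel (\<lambda>x. g x * cos (?s * x))" "integrable lborel (\<lambda>x. g x * sin (?s * x))"
    by (auto intro!: integrable_mult_bounded[OF g, of _ 1])
  have "exp (- \<i> * of_real (x / 2)) * of_real (g x) * exp (\<i> * of_real (t * x))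
      = of_real (g x * cos (?s * x)) + \<i> * of_real (g x * sin (?s * x))" for x
  proof -
    have "exp (- \<i> * of_real (x / 2)) * exp (\<i> * of_real (t * x)) = exp (\<i> * of_real (?s * x))"
      by (simp add: exp_add[symmetric] algebra_simps)
    also have "\<dots> = of_real (cos (?s * x)) + \<i> * of_real (sin (?s * x))"
      by (simp only: exp_Euler cos_of_real sin_of_real)
    finally have "of_real (g x) * (exp (- \<i> * of_real (x / 2)) * exp (\<i> * of_real (t * x))) = 
      of_real (g x) * (of_real (cos (?s * x)) + \<i> * of_real (sin (?s * x)))" by (rule arg_cong)
    then show ?thesis by (simp only: of_real_mult mult_ac distrib_left)
  qed
  then have "(LINT x|lborel. exp (- \<i> * of_real (x / 2)) * of_real (g x) * exp (\<i> * of_real (t * x)))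
     = of_real (\<integral>x. g x * cos (?s * x) \<partial>lborel) + \<i> * of_real (\<integral>x. g x * sin (?s * x) \<partial>lborel)"
    using i1 by (simp del: of_real_mult)
  then show ?thesis
    by (simp add: inv_fourier_def norm_divide power_divide cmod_power2 fourier_energy_def power_mult_distrib)
qed

text \<open>A real profile has an energy even in t, so after the shift by 1/2 the first moment
  vanishes. The remaining second moment is Plancherel's integral of the derivative, and the common
  factor 2 pi / (4 pi^2) cancels.\<close>

theorem radius2_inv_fourier_phase:
  fixes g g' :: "real \<Rightarrow> real"
  assumes d: "\<And>x. (g has_real_derivative g' x) (at x)"
    and gb: "\<And>x. \<bar>g x\<bar> \<le> C / (1 + x\<^sup>2)" and gb': "\<And>x. \<bar>g' x\<bar> \<le> C / (1 + x\<^sup>2)"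
    and nz: "(\<integral>x. (g x)\<^sup>2 \<partial>lborel) \<noteq> 0"
  shows "radius2 (inv_fourier (\<lambda>\<omega>. exp (- \<i> * of_real (\<omega> / 2)) * of_real (g \<omega>)))
    = (\<integral>x. (g' x)\<^sup>2 \<partial>lborel) / (\<integral>x. (g x)\<^sup>2 \<partial>lborel)"
proof -
  have cont: "continuous_on UNIV g"
    using d DERIV_isCont by (auto simp: continuous_on_eq_continuous_at)
  then have gm[measurable]: "g \<in> borel_measurable borel" by (rule borel_measurable_continuous_onI)
  have g: "integrable lborel g" by (rule integrable_decay[OF gm gb])
  have C: "0 \<le> C" using order_trans[OF abs_ge_zero gb[of 0]] by simp
  have gbd: "\<bar>g x\<bar> \<le> C" for x
    using gb[of x] divide_1_plus_square_le[OF C, of x] by linarith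
  define E where "E = fourier_energy g"
  define f where "f = inv_fourier (\<lambda>\<omega>. exp (- \<i> * of_real (\<omega> / 2)) * of_real (g \<omega>))"
  have f: "(cmod (f t))\<^sup>2 = E (t - 1/2) / (4 * pi\<^sup>2)" for t
    unfolding f_def E_def by (rule cmod_inv_fourier_phase[OF g])
  have E0: "has_bochner_integral lborel E (2 * pi * (\<integral>x. (g x)\<^sup>2 \<partial>lborel))"
    unfolding E_def by (rule plancherel_real[OF g cont gbd])
  have E2: "has_bochner_integral lborel (\<lambda>t. t\<^sup>2 * E t) (2 * pi * (\<integral>x. (g' x)\<^sup>2 \<partial>lborel))"
    unfolding E_def by (rule plancherel_deriv[OF d gb gb'])
  note i = E0[unfolded has_bochner_integral_iff, THEN conjunct1] E2[unfolded has_bochner_integral_iff, THEN conjunct1]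
  note v = E0[unfolded has_bochner_integral_iff, THEN conjunct2] E2[unfolded has_bochner_integral_iff, THEN conjunct2]
  have Em[measurable]: "E \<in> borel_measurable borel" using i by auto
  have Enn: "0 \<le> E t" for t by (simp add: E_def fourier_energy_nonneg)
  have i1: "integrable lborel (\<lambda>t. t * E t)"
  proof (rule Bochner_Integration.integrable_bound[of _ "\<lambda>t. E t + t\<^sup>2 * E t"])
    show "AE t in lborel. norm (t * E t) \<le> norm (E t + t\<^sup>2 * E t)"
    proof (intro AE_I2)
      fix t :: real
      have "\<bar>t\<bar> \<le> 1 + t\<^sup>2"
        using sum_squares_ge_zero[of "\<bar>t\<bar> - 1/2" 0] by (simp add: power2_eq_square algebra_simps)
      then have "\<bar>t\<bar> * E t \<le> (1 + t\<^sup>2) * E t" by (intro mult_right_mono Enn)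
      then show "norm (t * E t) \<le> norm (E t + t\<^sup>2 * E t)"
        using Enn[of t] by (simp add: abs_mult algebra_simps)
    qed
  qed (use i in auto)
  have "(\<integral>t. t * E t \<partial>lborel) = - (\<integral>t. t * E t \<partial>lborel)"
    by (subst lborel_integral_real_affine[where c = "-1" and t = 0]) (auto simp: E_def fourier_energy_minus)
  then have v1: "(\<integral>t. t * E t \<partial>lborel) = 0" by simp
  have shift: "(\<integral>t. k t * (cmod (f t))\<^sup>2 \<partial>lborel) = (\<integral>s. k (s + 1/2) * E s \<partial>lborel) / (4 * pi\<^sup>2)" for k
    by (subst lborel_integral_real_affine[where c = 1 and t = "1/2"]) (auto simp: f add.commute)
  have N: "(\<integral>t. (cmod (f t))\<^sup>2 \<partial>lborel) = 2 * pi * (\<integral>x. (g x)\<^sup>2 \<partial>lborel) / (4 * pi\<^sup>2)"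
    using shift[of "\<lambda>_. 1"] v(1) by simp
  have "(\<integral>t. t * (cmod (f t))\<^sup>2 \<partial>lborel) = (\<integral>s. s * E s + 1/2 * E s \<partial>lborel) / (4 * pi\<^sup>2)"
    by (simp add: shift distrib_right)
  also have "(\<integral>s. s * E s + 1/2 * E s \<partial>lborel) = 1/2 * (2 * pi * (\<integral>x. (g x)\<^sup>2 \<partial>lborel))"
    using i i1 v v1 by (subst Bochner_Integration.integral_add) auto
  finally have c: "centre f = 1/2"
    unfolding centre_def N using nz by simp
  have "(\<integral>t. (t - 1/2)\<^sup>2 * (cmod (f t))\<^sup>2 \<partial>lborel) = (\<integral>s. s\<^sup>2 * E s \<partial>lborel) / (4 * pi\<^sup>2)"
    by (simp add: shift)
  then show ?thesis
    unfolding f_def[symmetric] radius2_def c N v by simp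
qed

subsection \<open>Uniform closeness together with first derivatives\<close>

text \<open>Closeness at rate \<open>\<mu>\<close> against a weight, with one constant for all
  arguments and all large indices. The bound on the limit by the same weight is included because
  products need it.\<close>

definition c1_close :: "(nat \<Rightarrow> real) \<Rightarrow> (real \<Rightarrow> real) \<Rightarrow> (nat \<Rightarrow> real \<Rightarrow> real) \<Rightarrow> (real \<Rightarrow> real) \<Rightarrow> bool" where
  "c1_close \<mu> w f g \<longleftrightarrow>
     (\<forall>x. g field_differentiable at x) \<and> (\<exists>C. \<forall>x. \<bar>g x\<bar> \<le> C * w x \<and> \<bar>deriv g x\<bar> \<le> C * w x) \<and>
     (\<exists>C. \<forall>\<^sub>F i in sequentially. \<forall>x. f i field_differentiable at x \<and>
        \<bar>f i x - g x\<bar> \<le> C * (\<mu> i * w x) \<and> \<bar>deriv (f i) x - deriv g x\<bar> \<le> C * (\<mu> i * w x))"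

lemma c1_closeI:
  assumes "\<And>x. (g has_real_derivative g' x) (at x)"
    and "\<And>x. \<bar>g x\<bar> \<le> C * w x" "\<And>x. \<bar>g' x\<bar> \<le> C * w x"
    and "\<forall>\<^sub>F i in sequentially. \<forall>x. (f i has_real_derivative f' i x) (at x) \<and>
        \<bar>f i x - g x\<bar> \<le> K * (\<mu> i * w x) \<and> \<bar>f' i x - g' x\<bar> \<le> K * (\<mu> i * w x)"
  shows "c1_close \<mu> w f g"
  unfolding c1_close_def
proof (intro conjI allI)
  have g': "deriv g x = g' x" for x using assms(1) by (rule DERIV_imp_deriv)
  show "g field_differentiable at x" for x using assms(1) by (auto simp: field_differentiable_def)
  show "\<exists>C. \<forall>x. \<bar>g x\<bar> \<le> C * w x \<and> \<bar>deriv g x\<bar> \<le> C * w x" using assms(2,3) by (auto simp: g')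
  have "\<forall>\<^sub>F i in sequentially. \<forall>x. f i field_differentiable at x \<and>
        \<bar>f i x - g x\<bar> \<le> K * (\<mu> i * w x) \<and> \<bar>deriv (f i) x - deriv g x\<bar> \<le> K * (\<mu> i * w x)"
    using assms(4)
  proof eventually_elim
    case (elim i)
    then have "deriv (f i) x = f' i x" for x using DERIV_imp_deriv by blast
    with elim show ?case by (auto simp: g' field_differentiable_def)
  qed
  then show "\<exists>C. \<forall>\<^sub>F i in sequentially. \<forall>x. f i field_differentiable at x \<and>
        \<bar>f i x - g x\<bar> \<le> C * (\<mu> i * w x) \<and> \<bar>deriv (f i) x - deriv g x\<bar> \<le> C * (\<mu> i * w x)" by blast
qed

lemma c1_closeE:
  assumes "c1_close \<mu> w f g" and \<mu>: "\<And>i. 0 \<le> \<mu> i" and w: "\<And>x. 0 \<le> w x"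
  obtains C where "C \<ge> 0" "\<And>x. (g has_real_derivative deriv g x) (at x)"
    "\<And>x. \<bar>g x\<bar> \<le> C * w x" "\<And>x. \<bar>deriv g x\<bar> \<le> C * w x"
    "\<forall>\<^sub>F i in sequentially. \<forall>x. (f i has_real_derivative deriv (f i) x) (at x) \<and>
        \<bar>f i x - g x\<bar> \<le> C * (\<mu> i * w x) \<and> \<bar>deriv (f i) x - deriv g x\<bar> \<le> C * (\<mu> i * w x)"
proof -
  from assms(1) obtain A B where
    A: "\<And>x. \<bar>g x\<bar> \<le> A * w x" "\<And>x. \<bar>deriv g x\<bar> \<le> A * w x" and
    B: "\<forall>\<^sub>F i in sequentially. \<forall>x. f i field_differentiable at x \<and>
        \<bar>f i x - g x\<bar> \<le> B * (\<mu> i * w x) \<and> \<bar>deriv (f i) x - deriv g x\<bar> \<le> B * (\<mu> i * w x)"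
    unfolding c1_close_def by blast
  define C where "C = max 0 (max A B)"
  have le: "A * w x \<le> C * w x" "B * (\<mu> i * w x) \<le> C * (\<mu> i * w x)" for x i
    using mult_right_mono[of A C "w x"] mult_right_mono[of B C "\<mu> i * w x"] \<mu>[of i] w[of x]
    by (auto simp: C_def)
  show thesis
  proof (rule that[of C])
    show "C \<ge> 0" by (simp add: C_def)
    show "(g has_real_derivative deriv g x) (at x)" for x
      using assms(1) by (simp add: c1_close_def DERIV_deriv_iff_field_differentiable)
    show "\<bar>g x\<bar> \<le> C * w x" "\<bar>deriv g x\<bar> \<le> C * w x" for x
      using A[of x] le(1)[of x] by linarith+
    show "\<forall>\<^sub>F i in sequentially. \<forall>x. (f i has_real_derivative deriv (f i) x) (at x) \<and>
        \<bar>f i x - g x\<bar> \<le> C * (\<mu> i * w x) \<and> \<bar>deriv (f i) x - deriv g x\<bar> \<le> C * (\<mu> i * w x)"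
      using B by eventually_elim (use le(2) in \<open>auto simp: DERIV_deriv_iff_field_differentiable intro: order_trans\<close>)
  qed
qed

text \<open>Expand a c - b d as (a - b)(c - d) + (a - b) d + b (c - d). Each of the three terms is
  at most A B m w v; for the quadratic one this uses m <= 1.\<close>

lemma abs_mult_diff_le:
  fixes a b c d :: real
  assumes "\<bar>a - b\<bar> \<le> A * (m * w)" "\<bar>c - d\<bar> \<le> B * (m * v)" "\<bar>b\<bar> \<le> A * w" "\<bar>d\<bar> \<le> B * v"
    and m: "0 \<le> m" "m \<le> 1" and nn: "0 \<le> A" "0 \<le> B" "0 \<le> w" "0 \<le> v"
  shows "\<bar>a * c - b * d\<bar> \<le> 3 * A * B * (m * (w * v))"
proof -
  have "\<bar>a - b\<bar> * \<bar>c - d\<bar> \<le> (A * (m * w)) * (B * (m * v))"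
    using assms by (intro mult_mono) auto
  also have "\<dots> = m * (A * B * (m * (w * v)))" by (simp add: algebra_simps)
  also have "\<dots> \<le> 1 * (A * B * (m * (w * v)))"
    using m nn by (intro mult_right_mono) auto
  finally have 1: "\<bar>(a - b) * (c - d)\<bar> \<le> A * B * (m * (w * v))" by (simp add: abs_mult)
  have "\<bar>a - b\<bar> * \<bar>d\<bar> \<le> (A * (m * w)) * (B * v)" using assms by (intro mult_mono) auto
  then have 2: "\<bar>(a - b) * d\<bar> \<le> A * B * (m * (w * v))" by (simp add: abs_mult mult_ac)
  have "\<bar>b\<bar> * \<bar>c - d\<bar> \<le> (A * w) * (B * (m * v))" using assms by (intro mult_mono) auto
  then have 3: "\<bar>b * (c - d)\<bar> \<le> A * B * (m * (w * v))" by (simp add: abs_mult mult_ac)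
  have "a * c - b * d = (a - b) * (c - d) + (a - b) * d + b * (c - d)" by (simp add: algebra_simps)
  with 1 2 3 show ?thesis by linarith
qed

text \<open>The previous bound is applied to the product and to both Leibniz terms, whence 3 + 3 = 6
  for the derivative. Convergence of \<open>\<mu>\<close> gives \<open>\<mu> i < 1\<close>
  eventually, which absorbs the quadratic terms.\<close>

lemma c1_close_mult:
  assumes f: "c1_close \<mu> w f g" and p: "c1_close \<mu> v p q"
    and \<mu>: "\<And>i. 0 \<le> \<mu> i" and lim: "\<mu> \<longlonglongrightarrow> 0" and w: "\<And>x. 0 \<le> w x" and v: "\<And>x. 0 \<le> v x"
  shows "c1_close \<mu> (\<lambda>x. w x * v x) (\<lambda>i x. f i x * p i x) (\<lambda>x. g x * q x)"
proof -
  obtain A where A: "A \<ge> 0" "\<And>x. (g has_real_derivative deriv g x) (at x)"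
    "\<And>x. \<bar>g x\<bar> \<le> A * w x" "\<And>x. \<bar>deriv g x\<bar> \<le> A * w x"
    "\<forall>\<^sub>F i in sequentially. \<forall>x. (f i has_real_derivative deriv (f i) x) (at x) \<and>
        \<bar>f i x - g x\<bar> \<le> A * (\<mu> i * w x) \<and> \<bar>deriv (f i) x - deriv g x\<bar> \<le> A * (\<mu> i * w x)"
    using f \<mu> w by (rule c1_closeE) blast
  obtain B where B: "B \<ge> 0" "\<And>x. (q has_real_derivative deriv q x) (at x)"
    "\<And>x. \<bar>q x\<bar> \<le> B * v x" "\<And>x. \<bar>deriv q x\<bar> \<le> B * v x"
    "\<forall>\<^sub>F i in sequentially. \<forall>x. (p i has_real_derivative deriv (p i) x) (at x) \<and>
        \<bar>p i x - q x\<bar> \<le> B * (\<mu> i * v x) \<and> \<bar>deriv (p i) x - deriv q x\<bar> \<le> B * (\<mu> i * v x)"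
    using p \<mu> v by (rule c1_closeE) blast
  have \<mu>1: "\<forall>\<^sub>F i in sequentially. \<mu> i < 1" using lim by (rule order_tendstoD) simp
  have gq: "\<bar>g x * q x\<bar> \<le> A * B * (w x * v x)" "\<bar>deriv g x * q x\<bar> \<le> A * B * (w x * v x)"
     "\<bar>g x * deriv q x\<bar> \<le> A * B * (w x * v x)" for x
  proof -
    have "\<bar>a\<bar> * \<bar>b\<bar> \<le> A * B * (w x * v x)" if "\<bar>a\<bar> \<le> A * w x" "\<bar>b\<bar> \<le> B * v x" for a b
    proof -
      have "\<bar>a\<bar> * \<bar>b\<bar> \<le> (A * w x) * (B * v x)" using that A(1) w by (intro mult_mono) auto
      then show ?thesis by (simp add: mult_ac)
    qed
    with A B show "\<bar>g x * q x\<bar> \<le> A * B * (w x * v x)" "\<bar>deriv g x * q x\<bar> \<le> A * B * (w x * v x)"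
     "\<bar>g x * deriv q x\<bar> \<le> A * B * (w x * v x)" by (auto simp: abs_mult)
  qed
  have AB: "0 \<le> A * B * (w x * v x)" for x using A(1) B(1) w v by simp
  show ?thesis
  proof (rule c1_closeI[where g' = "\<lambda>x. deriv g x * q x + g x * deriv q x" and C = "2 * (A * B)"
      and K = "6 * A * B" and f' = "\<lambda>i x. deriv (f i) x * p i x + f i x * deriv (p i) x"])
    show "((\<lambda>x. g x * q x) has_real_derivative deriv g x * q x + g x * deriv q x) (at x)" for x
      using DERIV_mult[OF A(2)[of x] B(2)[of x]] by (simp add: mult_ac add_ac)
    show "\<bar>g x * q x\<bar> \<le> 2 * (A * B) * (w x * v x)" for x using gq(1)[of x] AB[of x] by linarith
    show "\<bar>deriv g x * q x + g x * deriv q x\<bar> \<le> 2 * (A * B) * (w x * v x)" for x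
      using gq(2,3)[of x] by linarith
    show "\<forall>\<^sub>F i in sequentially. \<forall>x. ((\<lambda>x. f i x * p i x) has_real_derivative deriv (f i) x * p i x + f i x * deriv (p i) x) (at x) \<and>
         \<bar>f i x * p i x - g x * q x\<bar> \<le> 6 * A * B * (\<mu> i * (w x * v x)) \<and>
         \<bar>deriv (f i) x * p i x + f i x * deriv (p i) x - (deriv g x * q x + g x * deriv q x)\<bar> \<le> 6 * A * B * (\<mu> i * (w x * v x))"
      using A(5) B(5) \<mu>1
    proof eventually_elim
      case (elim i)
      have \<mu>i: "0 \<le> \<mu> i" "\<mu> i \<le> 1" using \<mu>[of i] elim by auto
      show ?case
      proof (intro allI)
        fix x
        have "\<bar>f i x * p i x - g x * q x\<bar> \<le> 3 * A * B * (\<mu> i * (w x * v x))"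
          "\<bar>deriv (f i) x * p i x - deriv g x * q x\<bar> \<le> 3 * A * B * (\<mu> i * (w x * v x))"
          "\<bar>f i x * deriv (p i) x - g x * deriv q x\<bar> \<le> 3 * A * B * (\<mu> i * (w x * v x))"
          using elim A B \<mu>i w v by (auto intro!: abs_mult_diff_le)
        moreover have "0 \<le> A * B * (\<mu> i * (w x * v x))" using A(1) B(1) w v \<mu> by simp
        ultimately show "((\<lambda>x. f i x * p i x) has_real_derivative deriv (f i) x * p i x + f i x * deriv (p i) x) (at x) \<and>
         \<bar>f i x * p i x - g x * q x\<bar> \<le> 6 * A * B * (\<mu> i * (w x * v x)) \<and>
         \<bar>deriv (f i) x * p i x + f i x * deriv (p i) x - (deriv g x * q x + g x * deriv q x)\<bar> \<le> 6 * A * B * (\<mu> i * (w x * v x))"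
          using DERIV_mult[of "f i" "deriv (f i) x" x UNIV "p i" "deriv (p i) x"] elim
          by (auto simp: mult_ac add_ac)
      qed
    qed
  qed
qed

lemma c1_close_weight_mono:
  assumes f: "c1_close \<mu> w f g" and \<mu>: "\<And>i. 0 \<le> \<mu> i" and w: "\<And>x. 0 \<le> w x"
    and le: "\<And>x. w x \<le> K * v x" and v: "\<And>x. 0 \<le> v x"
  shows "c1_close \<mu> v f g"
proof -
  obtain A where A: "A \<ge> 0" "\<And>x. (g has_real_derivative deriv g x) (at x)"
    "\<And>x. \<bar>g x\<bar> \<le> A * w x" "\<And>x. \<bar>deriv g x\<bar> \<le> A * w x"
    "\<forall>\<^sub>F i in sequentially. \<forall>x. (f i has_real_derivative deriv (f i) x) (at x) \<and>
        \<bar>f i x - g x\<bar> \<le> A * (\<mu> i * w x) \<and> \<bar>deriv (f i) x - deriv g x\<bar> \<le> A * (\<mu> i * w x)"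
    using f \<mu> w by (rule c1_closeE) blast
  have le1: "A * w x \<le> A * K * v x" for x
    using mult_left_mono[OF le A(1)] by (simp add: mult_ac)
  have le2: "A * (\<mu> i * w x) \<le> A * K * (\<mu> i * v x)" for x i
    using mult_left_mono[OF mult_left_mono[OF le \<mu>] A(1), of i x] by (simp add: mult_ac)
  show ?thesis
  proof (rule c1_closeI[OF A(2), where C = "A * K" and K = "A * K"])
    show "\<bar>g x\<bar> \<le> A * K * v x" "\<bar>deriv g x\<bar> \<le> A * K * v x" for x
      using A(3,4) le1[of x] order_trans by blast+
    show "\<forall>\<^sub>F i in sequentially. \<forall>x. (f i has_real_derivative deriv (f i) x) (at x) \<and>
        \<bar>f i x - g x\<bar> \<le> A * K * (\<mu> i * v x) \<and> \<bar>deriv (f i) x - deriv g x\<bar> \<le> A * K * (\<mu> i * v x)"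
      using A(5) by eventually_elim (use le2 in \<open>auto intro: order_trans\<close>)
  qed
qed

lemma c1_close_affine:
  assumes f: "c1_close \<mu> w f g" and \<mu>: "\<And>i. 0 \<le> \<mu> i" and w: "\<And>x. 0 \<le> w x"
  shows "c1_close \<mu> (\<lambda>x. w (a * x + b)) (\<lambda>i x. f i (a * x + b)) (\<lambda>x. g (a * x + b))"
proof -
  obtain A where A: "A \<ge> 0" "\<And>x. (g has_real_derivative deriv g x) (at x)"
    "\<And>x. \<bar>g x\<bar> \<le> A * w x" "\<And>x. \<bar>deriv g x\<bar> \<le> A * w x"
    "\<forall>\<^sub>F i in sequentially. \<forall>x. (f i has_real_derivative deriv (f i) x) (at x) \<and>
        \<bar>f i x - g x\<bar> \<le> A * (\<mu> i * w x) \<and> \<bar>deriv (f i) x - deriv g x\<bar> \<le> A * (\<mu> i * w x)"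
    using f \<mu> w by (rule c1_closeE) blast
  define K where "K = 1 + \<bar>a\<bar>"
  have K: "K \<ge> 1" "\<bar>a\<bar> \<le> K" by (auto simp: K_def)
  have sc: "\<bar>y\<bar> \<le> K * B" "\<bar>a * y\<bar> \<le> K * B" if "\<bar>y\<bar> \<le> B" for y B
  proof -
    show "\<bar>a * y\<bar> \<le> K * B" using that K unfolding abs_mult by (intro mult_mono) auto
    have "1 * \<bar>y\<bar> \<le> K * B" using that K by (intro mult_mono) auto
    then show "\<bar>y\<bar> \<le> K * B" by simp
  qed
  have der: "((\<lambda>x. h (a * x + b)) has_real_derivative a * h' (a * x + b)) (at x)"
    if "\<And>x. (h has_real_derivative h' x) (at x)" for h h' x
  proof -
    have "((\<lambda>x. a * x + b) has_real_derivative a) (at x)" by (auto intro!: derivative_eq_intros)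
    from DERIV_chain2[OF that this] show ?thesis by (simp add: mult.commute)
  qed
  show ?thesis
  proof (rule c1_closeI[OF der[OF A(2)], where C = "K * A" and K = "K * A" and f' = "\<lambda>i x. a * deriv (f i) (a * x + b)"])
    show "\<bar>g (a * x + b)\<bar> \<le> K * A * w (a * x + b)" "\<bar>a * deriv g (a * x + b)\<bar> \<le> K * A * w (a * x + b)" for x
      using sc(1)[OF A(3)[of "a * x + b"]] sc(2)[OF A(4)[of "a * x + b"]] by (simp_all add: mult_ac)
    show "\<forall>\<^sub>F i in sequentially. \<forall>x. ((\<lambda>x. f i (a * x + b)) has_real_derivative a * deriv (f i) (a * x + b)) (at x) \<and>
        \<bar>f i (a * x + b) - g (a * x + b)\<bar> \<le> K * A * (\<mu> i * w (a * x + b)) \<and>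
        \<bar>a * deriv (f i) (a * x + b) - a * deriv g (a * x + b)\<bar> \<le> K * A * (\<mu> i * w (a * x + b))"
      using A(5)
    proof eventually_elim
      case (elim i)
      show ?case
      proof (intro allI conjI)
        fix x
        show "((\<lambda>x. f i (a * x + b)) has_real_derivative a * deriv (f i) (a * x + b)) (at x)"
          using elim by (intro der) auto
        show "\<bar>f i (a * x + b) - g (a * x + b)\<bar> \<le> K * A * (\<mu> i * w (a * x + b))"
          using sc(1)[of "f i (a * x + b) - g (a * x + b)"] elim by (simp add: mult.assoc)
        show "\<bar>a * deriv (f i) (a * x + b) - a * deriv g (a * x + b)\<bar> \<le> K * A * (\<mu> i * w (a * x + b))"
          using sc(2)[of "deriv (f i) (a * x + b) - deriv g (a * x + b)"] elim
          by (simp add: mult.assoc right_diff_distrib)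
      qed
    qed
  qed
qed

text \<open>The values of \<open>f i\<close> are uniformly near 1, hence eventually above 1/2, where
  \<open>F\<close> is Lipschitz. As the limit has derivative 0, a bound on \<open>F'\<close> alone
  controls the derivative of the composition.\<close>

lemma c1_close_compose_at_1:
  assumes f: "c1_close \<mu> (\<lambda>_. 1) f (\<lambda>_. 1)" and \<mu>: "\<And>i. 0 \<le> \<mu> i" and lim: "\<mu> \<longlonglongrightarrow> 0"
    and F: "\<And>y. 1/2 < y \<Longrightarrow> (F has_real_derivative F' y) (at y)" "\<And>y. 1/2 < y \<Longrightarrow> \<bar>F' y\<bar> \<le> L" "F 1 = 1"
  shows "c1_close \<mu> (\<lambda>_. 1) (\<lambda>i x. F (f i x)) (\<lambda>_. 1)"
proof -
  obtain A where A:
    "\<forall>\<^sub>F i in sequentially. \<forall>x. (f i has_real_derivative deriv (f i) x) (at x) \<and>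
        \<bar>f i x - 1\<bar> \<le> A * (\<mu> i * 1) \<and> \<bar>deriv (f i) x - deriv (\<lambda>_. 1) x\<bar> \<le> A * (\<mu> i * 1)"
    using f \<mu> by (rule c1_closeE) auto
  have "(\<lambda>i. A * \<mu> i) \<longlonglongrightarrow> 0" using tendsto_mult_left[OF lim, of A] by simp
  then have small: "\<forall>\<^sub>F i in sequentially. A * \<mu> i < 1/2" by (rule order_tendstoD) simp
  have L: "0 \<le> L" using F(2)[of 1] by linarith
  have lip: "\<bar>F y - 1\<bar> \<le> L * \<bar>y - 1\<bar>" if "1/2 < y" for y
  proof -
    have "norm (F y - F 1) \<le> L * norm (y - 1)"
      by (rule field_differentiable_bound[of "{1/2<..}" F F'])
         (use F that in \<open>auto intro: has_field_derivative_at_within\<close>)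
    then show ?thesis using F(3) by simp
  qed
  show ?thesis
  proof (rule c1_closeI[where g' = "\<lambda>_. 0" and C = 1 and K = "L * A" and f' = "\<lambda>i x. F' (f i x) * deriv (f i) x"])
    show "\<forall>\<^sub>F i in sequentially. \<forall>x. ((\<lambda>x. F (f i x)) has_real_derivative F' (f i x) * deriv (f i) x) (at x) \<and>
        \<bar>F (f i x) - 1\<bar> \<le> L * A * (\<mu> i * 1) \<and> \<bar>F' (f i x) * deriv (f i) x - 0\<bar> \<le> L * A * (\<mu> i * 1)"
      using A small
    proof eventually_elim
      case (elim i)
      show ?case
      proof (intro allI conjI)
        fix x
        have e: "(f i has_real_derivative deriv (f i) x) (at x)" "\<bar>f i x - 1\<bar> \<le> A * \<mu> i" "\<bar>deriv (f i) x\<bar> \<le> A * \<mu> i"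
          using elim(1) by auto
        have fi: "1/2 < f i x" using e(2) elim(2) by linarith
        show "((\<lambda>x. F (f i x)) has_real_derivative F' (f i x) * deriv (f i) x) (at x)"
          by (rule DERIV_chain2[OF F(1)[OF fi] e(1)])
        show "\<bar>F (f i x) - 1\<bar> \<le> L * A * (\<mu> i * 1)"
          using lip[OF fi] mult_left_mono[OF e(2) L] by simp
        show "\<bar>F' (f i x) * deriv (f i) x - 0\<bar> \<le> L * A * (\<mu> i * 1)"
          using mult_mono[OF F(2)[OF fi] e(3) L] by (simp add: abs_mult)
      qed
    qed
  qed auto
qed

text \<open>Above 1/2 the inverse of the root is at most 2, so the derivatives are at most 1 for the
  root and 2^3 / 2 = 4 for its reciprocal.\<close>

lemma c1_close_sqrt:
  assumes "c1_close \<mu> (\<lambda>_. 1) f (\<lambda>_. 1)" "\<And>i. 0 \<le> \<mu> i" "\<mu> \<longlonglongrightarrow> 0"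
  shows "c1_close \<mu> (\<lambda>_. 1) (\<lambda>i x. sqrt (f i x)) (\<lambda>_. 1)"
    and "c1_close \<mu> (\<lambda>_. 1) (\<lambda>i x. 1 / sqrt (f i x)) (\<lambda>_. 1)"
proof -
  have half: "1/2 < sqrt y" if "1/2 < y" for y :: real
    using that real_less_rsqrt[of "1/2" y] by (simp add: power2_eq_square)
  have i: "inverse (sqrt y) \<le> 2" if "1/2 < y" for y :: real
    using half[OF that] le_imp_inverse_le[of "1/2" "sqrt y"] by simp
  show "c1_close \<mu> (\<lambda>_. 1) (\<lambda>i x. sqrt (f i x)) (\<lambda>_. 1)"
  proof (rule c1_close_compose_at_1[OF assms, where F' = "\<lambda>y. inverse (sqrt y) / 2" and L = 1])
    fix y :: real assume y: "1/2 < y"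
    show "(sqrt has_real_derivative inverse (sqrt y) / 2) (at y)" using y by (intro DERIV_real_sqrt) simp
    show "\<bar>inverse (sqrt y) / 2\<bar> \<le> 1" using i[OF y] y by simp
  qed auto
  show "c1_close \<mu> (\<lambda>_. 1) (\<lambda>i x. 1 / sqrt (f i x)) (\<lambda>_. 1)"
  proof (rule c1_close_compose_at_1[OF assms, where F = "\<lambda>y. 1 / sqrt y" and L = 4
      and F' = "\<lambda>y. - (inverse (sqrt y) / 2) * (inverse (sqrt y))\<^sup>2"])
    fix y :: real assume y: "1/2 < y"
    show "((\<lambda>y. 1 / sqrt y) has_real_derivative - (inverse (sqrt y) / 2) * (inverse (sqrt y))\<^sup>2) (at y)"
      using y by (auto intro!: derivative_eq_intros simp: power2_eq_square field_simps)
    have "inverse (sqrt y) ^ 3 \<le> 2 ^ 3" using i[OF y] y by (intro power_mono) auto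
    then show "\<bar>- (inverse (sqrt y) / 2) * (inverse (sqrt y))\<^sup>2\<bar> \<le> 4"
      using y by (simp add: abs_mult power3_eq_cube power2_eq_square)
  qed auto
qed

text \<open>The derivative is a pointwise limit of difference quotients, each of which is
  continuous; it need not be continuous itself.\<close>

lemma borel_measurable_derivative:
  fixes g :: "real \<Rightarrow> real"
  assumes "\<And>x. (g has_real_derivative g' x) (at x)"
  shows "g' \<in> borel_measurable borel"
proof -
  have cont: "continuous_on UNIV g"
    using assms DERIV_isCont by (auto simp: continuous_on_eq_continuous_at)
  then have [measurable]: "g \<in> borel_measurable borel" by (rule borel_measurable_continuous_onI)
  define h :: "nat \<Rightarrow> real" where "h n = inverse (real (Suc n))" for n
  have hlim: "filterlim h (at 0) sequentially"
    using LIMSEQ_inverse_real_of_nat unfolding h_def by (auto simp: filterlim_at intro!: always_eventually)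
  show ?thesis
  proof (rule borel_measurable_LIMSEQ_real)
    show "(\<lambda>n. (g (x + h n) - g x) / h n) \<longlonglongrightarrow> g' x" for x
      using assms[of x] by (intro filterlim_compose[OF _ hlim]) (simp add: DERIV_def)
  qed auto
qed

section \<open>Moments and radii of close profiles\<close>

abbreviation wt :: "real \<Rightarrow> real" where "wt x \<equiv> 1 / (1 + x\<^sup>2)"

lemma wt_pos: "0 < wt x" by (simp add: add_pos_nonneg)

lemma integral_diff_bigo:
  fixes F :: "nat \<Rightarrow> real \<Rightarrow> real"
  assumes F: "\<forall>\<^sub>F i in sequentially. F i \<in> borel_measurable borel \<and> (\<forall>x. \<bar>F i x - G x\<bar> \<le> C * (\<mu> i * wt x))"
    and G: "G \<in> borel_measurable borel" "\<And>x. \<bar>G x\<bar> \<le> C * wt x" and \<mu>: "\<And>i. 0 \<le> \<mu> i"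
  shows "(\<lambda>i. (\<integral>x. F i x \<partial>lborel) - (\<integral>x. G x \<partial>lborel)) \<in> O(\<mu>)"
proof (rule bigoI)
  have iG: "integrable lborel G" using G by (intro integrable_decay[of _ C]) auto
  show "\<forall>\<^sub>F i in sequentially. norm ((\<integral>x. F i x \<partial>lborel) - (\<integral>x. G x \<partial>lborel)) \<le> C * (\<integral>x. wt x \<partial>lborel) * norm (\<mu> i)"
    using F
  proof eventually_elim
    case (elim i)
    then have [measurable]: "F i \<in> borel_measurable borel" and le: "\<And>x. \<bar>F i x - G x\<bar> \<le> C * (\<mu> i * wt x)" by auto
    note G(1)[measurable]
    have iD: "integrable lborel (\<lambda>x. F i x - G x)"
      using le by (intro integrable_decay[of _ "C * \<mu> i"]) auto
    from Bochner_Integration.integrable_add[OF this iG] have iF: "integrable lborel (F i)" by simp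
    have iw: "integrable lborel (\<lambda>x. C * (\<mu> i * wt x))"
      by (intro integrable_mult_right integrable_inverse_1_plus_square_lborel)
    have "\<bar>\<integral>x. F i x - G x \<partial>lborel\<bar> \<le> (\<integral>x. \<bar>F i x - G x\<bar> \<partial>lborel)" by (rule integral_abs_bound)
    also have "\<dots> \<le> (\<integral>x. C * (\<mu> i * wt x) \<partial>lborel)"
      using le iD iw by (intro integral_mono) auto
    also have "\<dots> = C * (\<integral>x. wt x \<partial>lborel) * \<mu> i"
      by (simp only: integral_mult_right_zero mult_ac)
    finally show ?case using iF iG \<mu>[of i] by simp
  qed
qed

text \<open>The difference of squares carries the weight twice, and one copy absorbs the growth of
  \<open>k\<close>. The 3 bounds |a + b| in units of C * wt x.\<close>

lemma weighted_square_diff_le: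
  fixes a b k :: real
  assumes d: "\<bar>a - b\<bar> \<le> C * (m * wt x)" and b: "\<bar>b\<bar> \<le> C * wt x" and k: "\<bar>k\<bar> \<le> 1 + x\<^sup>2"
    and m: "0 \<le> m" "m \<le> 1" and C: "0 \<le> C"
  shows "\<bar>k * a\<^sup>2 - k * b\<^sup>2\<bar> \<le> 3 * C\<^sup>2 * (m * wt x)"
proof -
  have w: "0 < wt x" by (rule wt_pos)
  have "m * wt x \<le> 1 * wt x" using m w by (intro mult_right_mono) auto
  then have "C * (m * wt x) \<le> C * wt x" using C by (intro mult_left_mono) auto
  then have "\<bar>a + b\<bar> \<le> 3 * (C * wt x)" using d b by linarith
  then have "\<bar>a - b\<bar> * \<bar>a + b\<bar> \<le> (C * (m * wt x)) * (3 * (C * wt x))"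
    using d m C w by (intro mult_mono) auto
  then have "\<bar>k\<bar> * (\<bar>a - b\<bar> * \<bar>a + b\<bar>) \<le> (1 + x\<^sup>2) * ((C * (m * wt x)) * (3 * (C * wt x)))"
    by (intro mult_mono[OF k]) auto
  also have "\<dots> = 3 * C\<^sup>2 * (m * wt x) * ((1 + x\<^sup>2) * wt x)" by (simp only: power2_eq_square mult_ac)
  also have "(1 + x\<^sup>2) * wt x = 1" using w by simp
  also have "\<bar>k\<bar> * (\<bar>a - b\<bar> * \<bar>a + b\<bar>) = \<bar>k * a\<^sup>2 - k * b\<^sup>2\<bar>"
    by (simp add: abs_mult[symmetric] power2_eq_square algebra_simps)
  finally show ?thesis by simp
qed

text \<open>The growth bound on \<open>k\<close> admits 1, x and x^2, hence all moments in the
  frequency radius; the second claim with k = 1 handles the numerator of the time radius.\<close>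

lemma c1_close_moment:
  assumes c: "c1_close \<mu> wt R S" and \<mu>: "\<And>i. 0 \<le> \<mu> i" and lim: "\<mu> \<longlonglongrightarrow> 0"
    and k: "k \<in> borel_measurable borel" "\<And>x. \<bar>k x\<bar> \<le> 1 + x\<^sup>2"
  shows "(\<lambda>i. (\<integral>x. k x * (R i x)\<^sup>2 \<partial>lborel) - (\<integral>x. k x * (S x)\<^sup>2 \<partial>lborel)) \<in> O(\<mu>)"
    and "(\<lambda>i. (\<integral>x. k x * (deriv (R i) x)\<^sup>2 \<partial>lborel) - (\<integral>x. k x * (deriv S x)\<^sup>2 \<partial>lborel)) \<in> O(\<mu>)"
    and "integrable lborel (\<lambda>x. k x * (S x)\<^sup>2)"
    and "\<forall>\<^sub>F i in sequentially. integrable lborel (\<lambda>x. k x * (R i x)\<^sup>2)"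
proof -
  obtain A where A: "A \<ge> 0" "\<And>x. (S has_real_derivative deriv S x) (at x)"
    "\<And>x. \<bar>S x\<bar> \<le> A * wt x" "\<And>x. \<bar>deriv S x\<bar> \<le> A * wt x"
    "\<forall>\<^sub>F i in sequentially. \<forall>x. (R i has_real_derivative deriv (R i) x) (at x) \<and>
        \<bar>R i x - S x\<bar> \<le> A * (\<mu> i * wt x) \<and> \<bar>deriv (R i) x - deriv S x\<bar> \<le> A * (\<mu> i * wt x)"
    using c \<mu> less_imp_le[OF wt_pos] by (rule c1_closeE) blast
  have \<mu>1: "\<forall>\<^sub>F i in sequentially. \<mu> i < 1" using lim by (rule order_tendstoD) simp
  note k(1)[measurable]
  have m: "f \<in> borel_measurable borel \<and> deriv f \<in> borel_measurable borel"
    if "\<And>x. (f has_real_derivative deriv f x) (at x)" for f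
    using DERIV_isCont[OF that] borel_measurable_derivative[OF that]
    by (auto intro!: borel_measurable_continuous_onI simp: continuous_on_eq_continuous_at)
  have Sm[measurable]: "S \<in> borel_measurable borel" "deriv S \<in> borel_measurable borel" using m[OF A(2)] by auto
  have le: "\<bar>k x * b\<^sup>2\<bar> \<le> 3 * A\<^sup>2 * wt x" if "\<bar>b\<bar> \<le> A * wt x" for b x
    using weighted_square_diff_le[of 0 b A 1 x "k x"] that k(2)[of x] A(1) by simp
  have ev: "\<forall>\<^sub>F i in sequentially. \<forall>x. R i \<in> borel_measurable borel \<and> deriv (R i) \<in> borel_measurable borel \<and>
     \<bar>k x * (R i x)\<^sup>2 - k x * (S x)\<^sup>2\<bar> \<le> 3 * A\<^sup>2 * (\<mu> i * wt x) \<and>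
     \<bar>k x * (deriv (R i) x)\<^sup>2 - k x * (deriv S x)\<^sup>2\<bar> \<le> 3 * A\<^sup>2 * (\<mu> i * wt x)"
    using A(5) \<mu>1
  proof eventually_elim
    case (elim i)
    have \<mu>i: "0 \<le> \<mu> i" "\<mu> i \<le> 1" using \<mu>[of i] elim by auto
    have "R i \<in> borel_measurable borel \<and> deriv (R i) \<in> borel_measurable borel" using elim(1) by (intro m) auto
    then show ?case
      using elim(1) A \<mu>i k(2) by (intro allI conjI weighted_square_diff_le) auto
  qed
  show "(\<lambda>i. (\<integral>x. k x * (R i x)\<^sup>2 \<partial>lborel) - (\<integral>x. k x * (S x)\<^sup>2 \<partial>lborel)) \<in> O(\<mu>)"
    by (rule integral_diff_bigo[where C = "3 * A\<^sup>2"])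
       (use ev le A \<mu> in \<open>auto elim!: eventually_mono\<close>)
  show "(\<lambda>i. (\<integral>x. k x * (deriv (R i) x)\<^sup>2 \<partial>lborel) - (\<integral>x. k x * (deriv S x)\<^sup>2 \<partial>lborel)) \<in> O(\<mu>)"
    by (rule integral_diff_bigo[where C = "3 * A\<^sup>2"])
       (use ev le A \<mu> in \<open>auto elim!: eventually_mono\<close>)
  show iS: "integrable lborel (\<lambda>x. k x * (S x)\<^sup>2)"
    using le A(3) by (intro integrable_decay[of _ "3 * A\<^sup>2"]) auto
  show "\<forall>\<^sub>F i in sequentially. integrable lborel (\<lambda>x. k x * (R i x)\<^sup>2)"
    using ev
  proof eventually_elim
    case (elim i)
    then have [measurable]: "R i \<in> borel_measurable borel" by auto
    have "integrable lborel (\<lambda>x. k x * (R i x)\<^sup>2 - k x * (S x)\<^sup>2)"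
      using elim by (intro integrable_decay[of _ "3 * A\<^sup>2 * \<mu> i"]) auto
    from Bochner_Integration.integrable_add[OF this iS] show ?case by simp
  qed
qed

lemma radius2_eq_moments:
  fixes f :: "real \<Rightarrow> complex"
  defines "M k \<equiv> (\<integral>x. x ^ k * (cmod (f x))\<^sup>2 \<partial>lborel)"
  assumes i: "\<And>k. k \<le> 2 \<Longrightarrow> integrable lborel (\<lambda>x. x ^ k * (cmod (f x))\<^sup>2)" and nz: "M 0 \<noteq> 0"
  shows "radius2 f = M 2 / M 0 - (M 1 / M 0)\<^sup>2"
proof -
  have c: "centre f = M 1 / M 0" by (simp add: centre_def M_def)
  have "(\<integral>x. (x - centre f)\<^sup>2 * (cmod (f x))\<^sup>2 \<partial>lborel) =
    (\<integral>x. (x ^ 2 * (cmod (f x))\<^sup>2 - 2 * centre f * (x ^ 1 * (cmod (f x))\<^sup>2)) + (centre f)\<^sup>2 * (x ^ 0 * (cmod (f x))\<^sup>2) \<partial>lborel)"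
    by (intro Bochner_Integration.integral_cong) (auto simp: power2_diff algebra_simps)
  also have "\<dots> = (M 2 - 2 * centre f * M 1) + (centre f)\<^sup>2 * M 0"
    unfolding M_def using i[of 0] i[of 1] i[of 2]
    by (subst Bochner_Integration.integral_add Bochner_Integration.integral_diff; simp)+
  finally have "radius2 f = (M 2 - 2 * centre f * M 1 + (centre f)\<^sup>2 * M 0) / M 0"
    by (simp add: radius2_def M_def)
  then show ?thesis using nz by (simp add: c power2_eq_square field_simps)
qed

lemma bigo_eventually_eq:
  fixes f g :: "nat \<Rightarrow> real"
  assumes "f \<in> O(h)" "\<forall>\<^sub>F i in sequentially. g i = f i"
  shows "g \<in> O(h)"
  using landau_o.big.in_cong[OF assms(2)] assms(1) by simp

lemma diff_mult_bigo:
  fixes x y :: "nat \<Rightarrow> real"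
  assumes "(\<lambda>i. x i - a) \<in> O(\<mu>)" "(\<lambda>i. y i - b) \<in> O(\<mu>)" "\<mu> \<in> O(\<lambda>_. 1)"
  shows "(\<lambda>i. x i * y i - a * b) \<in> O(\<mu>)"
proof -
  have "(\<lambda>i. (x i - a) * (y i - b)) \<in> O(\<lambda>i. 1 * \<mu> i)"
    using landau_o.big_trans[OF assms(1,3)] assms(2) by (rule landau_o.big.mult)
  moreover have "(\<lambda>i. (x i - a) * b) \<in> O(\<mu>)" "(\<lambda>i. a * (y i - b)) \<in> O(\<mu>)"
    using assms(1,2) by (auto simp: landau_o.big.cmult_in_iff' landau_o.big.cmult_in_iff intro: landau_o.big.cmult_in_iff)
  ultimately have "(\<lambda>i. (x i - a) * (y i - b) + ((x i - a) * b + a * (y i - b))) \<in> O(\<mu>)"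
    by (intro sum_in_bigo) auto
  then show ?thesis by (simp add: algebra_simps)
qed

lemma diff_inverse_bigo:
  fixes y :: "nat \<Rightarrow> real"
  assumes y: "(\<lambda>i. y i - b) \<in> O(\<mu>)" and lim: "\<mu> \<longlonglongrightarrow> 0" and b: "b \<noteq> 0"
  shows "(\<lambda>i. inverse (y i) - inverse b) \<in> O(\<mu>)" and "\<forall>\<^sub>F i in sequentially. y i \<noteq> 0"
proof -
  have "\<mu> \<in> o(\<lambda>_. 1)" using lim by (intro smalloI_tendsto) auto
  with y have "(\<lambda>i. y i - b) \<in> o(\<lambda>_. 1)" by (rule landau_o.big_small_trans)
  then have "(\<lambda>i. y i - b) \<longlonglongrightarrow> 0" by (auto dest: smalloD_tendsto)
  then have yl: "y \<longlonglongrightarrow> b" by (simp add: LIM_zero_iff)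
  then show nz: "\<forall>\<^sub>F i in sequentially. y i \<noteq> 0" using b by (rule tendsto_imp_eventually_ne)
  have "(\<lambda>i. inverse (y i)) \<longlonglongrightarrow> inverse b" using yl b by (rule tendsto_inverse)
  then have 1: "(\<lambda>i. inverse (y i)) \<in> O(\<lambda>_. 1)"
    by (intro bigoI_tendsto[where c = "inverse b"]) auto
  have "(\<lambda>i. inverse (y i) * (y i - b)) \<in> O(\<lambda>i. 1 * \<mu> i)"
    using 1 y by (rule landau_o.big.mult)
  then have "(\<lambda>i. - inverse b * (inverse (y i) * (y i - b))) \<in> O(\<mu>)"
    using b by simp
  moreover have "\<forall>\<^sub>F i in sequentially. inverse (y i) - inverse b = - inverse b * (inverse (y i) * (y i - b))"
    using nz by eventually_elim (use b in \<open>simp add: field_simps\<close>)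
  ultimately show "(\<lambda>i. inverse (y i) - inverse b) \<in> O(\<mu>)"
    by (rule bigo_eventually_eq)
qed

text \<open>Both radii are rational in the moments, with powers of the zeroth moment as
  denominators. That moment is nonzero in the limit, so the rate survives products and
  quotients.\<close>

theorem radius2_diff_bigo:
  assumes c: "c1_close \<mu> wt R S" and \<mu>: "\<And>i. 0 \<le> \<mu> i" and lim: "\<mu> \<longlonglongrightarrow> 0"
    and nz: "(\<integral>x. (S x)\<^sup>2 \<partial>lborel) \<noteq> 0"
    and f: "\<And>i. f i = (\<lambda>\<omega>. exp (- \<i> * of_real (\<omega> / 2)) * of_real (R i \<omega>))"
    and f0: "f0 = (\<lambda>\<omega>. exp (- \<i> * of_real (\<omega> / 2)) * of_real (S \<omega>))"
  shows "(\<lambda>i. radius2 (f i) - radius2 f0) \<in> O(\<mu>)"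
    and "(\<lambda>i. radius2 (inv_fourier (f i)) - radius2 (inv_fourier f0)) \<in> O(\<mu>)"
proof -
  define M where "M g k = (\<integral>x. x ^ k * (g x)\<^sup>2 \<partial>lborel)" for g :: "real \<Rightarrow> real" and k :: nat
  define D where "D g = (\<integral>x. (deriv g x)\<^sup>2 \<partial>lborel)" for g :: "real \<Rightarrow> real"
  have k: "\<bar>x ^ k\<bar> \<le> 1 + x\<^sup>2" if "k \<le> 2" for x :: real and k
  proof -
    have "\<bar>x\<bar> \<le> 1 + x\<^sup>2"
      using sum_squares_ge_zero[of "\<bar>x\<bar> - 1/2" 0] by (simp add: power2_eq_square algebra_simps)
    moreover have "k = 0 \<or> k = 1 \<or> k = 2" using that by auto
    ultimately show ?thesis by auto
  qed
  have \<mu>1: "\<mu> \<in> O(\<lambda>_. 1)" using lim by (intro bigoI_tendsto[where c = 0]) auto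
  have M: "(\<lambda>i. M (R i) k - M S k) \<in> O(\<mu>)" if "k \<le> 2" for k
    unfolding M_def using k[OF that] by (intro c1_close_moment[OF c \<mu> lim]) auto
  have D: "(\<lambda>i. D (R i) - D S) \<in> O(\<mu>)"
    unfolding D_def using c1_close_moment(2)[OF c \<mu> lim, of "\<lambda>_. 1"] by simp
  have iS: "integrable lborel (\<lambda>x. x ^ k * (S x)\<^sup>2)" if "k \<le> 2" for k
    using k[OF that] by (intro c1_close_moment[OF c \<mu> lim]) auto
  have iR: "\<forall>\<^sub>F i in sequentially. integrable lborel (\<lambda>x. x ^ k * (R i x)\<^sup>2)" if "k \<le> 2" for k
    using k[OF that] by (intro c1_close_moment[OF c \<mu> lim]) auto
  have S0: "M S 0 \<noteq> 0" using nz by (simp add: M_def)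
  note inv = diff_inverse_bigo[OF M[of 0] lim S0, simplified]
  have quot: "(\<lambda>i. x i / M (R i) 0 - a / M S 0) \<in> O(\<mu>)" if "(\<lambda>i. x i - a) \<in> O(\<mu>)" for x a
    using diff_mult_bigo[OF that inv(1) \<mu>1] by (simp add: divide_inverse)
  have cm: "cmod (exp (- \<i> * of_real (\<omega> / 2)) * of_real r) = \<bar>r\<bar>" for \<omega> r
    by (simp add: norm_mult)
  have rad: "radius2 (\<lambda>\<omega>. exp (- \<i> * of_real (\<omega> / 2)) * of_real (g \<omega>)) = M g 2 / M g 0 - (M g 1 / M g 0)\<^sup>2"
    if "\<And>k. k \<le> 2 \<Longrightarrow> integrable lborel (\<lambda>x. x ^ k * (g x)\<^sup>2)" "M g 0 \<noteq> 0" for g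
    using radius2_eq_moments[of "\<lambda>\<omega>. exp (- \<i> * of_real (\<omega> / 2)) * of_real (g \<omega>)"] that
    unfolding cm by (simp add: M_def)
  have e0: "\<forall>\<^sub>F i in sequentially. radius2 (f i) = M (R i) 2 / M (R i) 0 - (M (R i) 1 / M (R i) 0)\<^sup>2"
    using iR[of 0, simplified] iR[of 1, simplified] iR[of 2, simplified] inv(2)
  proof eventually_elim
    case (elim i)
    have "integrable lborel (\<lambda>x. x ^ k * (R i x)\<^sup>2)" if "k \<le> 2" for k
    proof -
      have "k = 0 \<or> k = 1 \<or> k = 2" using that by auto
      then show ?thesis using elim by auto
    qed
    then show ?case unfolding f using elim by (intro rad) auto
  qed
  have f0r: "radius2 f0 = M S 2 / M S 0 - (M S 1 / M S 0)\<^sup>2" unfolding f0 using iS S0 by (intro rad) auto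
  have q1: "(\<lambda>i. M (R i) 1 / M (R i) 0 - M S 1 / M S 0) \<in> O(\<mu>)"
    and q2: "(\<lambda>i. M (R i) 2 / M (R i) 0 - M S 2 / M S 0) \<in> O(\<mu>)"
    by (auto intro!: quot M)
  have "(\<lambda>i. (M (R i) 2 / M (R i) 0 - M S 2 / M S 0) - (M (R i) 1 / M (R i) 0 * (M (R i) 1 / M (R i) 0) - M S 1 / M S 0 * (M S 1 / M S 0))) \<in> O(\<mu>)"
    by (rule sum_in_bigo(2)[OF q2 diff_mult_bigo[OF q1 q1 \<mu>1]])
  moreover have "\<forall>\<^sub>F i in sequentially. radius2 (f i) - radius2 f0 =
    (M (R i) 2 / M (R i) 0 - M S 2 / M S 0) - (M (R i) 1 / M (R i) 0 * (M (R i) 1 / M (R i) 0) - M S 1 / M S 0 * (M S 1 / M S 0))"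
    using e0 by eventually_elim (simp add: f0r power2_eq_square)
  ultimately show "(\<lambda>i. radius2 (f i) - radius2 f0) \<in> O(\<mu>)"
    by (rule bigo_eventually_eq)
  obtain A where A: "A \<ge> 0" "\<And>x. (S has_real_derivative deriv S x) (at x)"
    "\<And>x. \<bar>S x\<bar> \<le> A * wt x" "\<And>x. \<bar>deriv S x\<bar> \<le> A * wt x"
    "\<forall>\<^sub>F i in sequentially. \<forall>x. (R i has_real_derivative deriv (R i) x) (at x) \<and>
        \<bar>R i x - S x\<bar> \<le> A * (\<mu> i * wt x) \<and> \<bar>deriv (R i) x - deriv S x\<bar> \<le> A * (\<mu> i * wt x)"
    using c \<mu> less_imp_le[OF wt_pos] by (rule c1_closeE) blast
  have \<mu>1': "\<forall>\<^sub>F i in sequentially. \<mu> i < 1" using lim by (rule order_tendstoD) simp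
  have t0: "radius2 (inv_fourier f0) = D S / M S 0"
    unfolding f0 using radius2_inv_fourier_phase[of S "deriv S" A] A nz by (simp add: D_def M_def)
  have t: "\<forall>\<^sub>F i in sequentially. radius2 (inv_fourier (f i)) = D (R i) / M (R i) 0"
    using A(5) \<mu>1' inv(2)
  proof eventually_elim
    case (elim i)
    have "A * (\<mu> i * wt x) \<le> A * (1 * wt x)" for x
      using A(1) elim(2) less_imp_le[OF wt_pos[of x]] by (intro mult_left_mono mult_right_mono) auto
    then have le: "A * (\<mu> i * wt x) \<le> A * wt x" for x by simp
    have *: "\<bar>a\<bar> \<le> 2 * A * wt x" if "\<bar>a - b\<bar> \<le> A * (\<mu> i * wt x)" "\<bar>b\<bar> \<le> A * wt x" for a b x
      using that le[of x] by linarith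
    have "\<bar>R i x\<bar> \<le> 2 * A * wt x" "\<bar>deriv (R i) x\<bar> \<le> 2 * A * wt x" for x
      using *[of "R i x" "S x" x] *[of "deriv (R i) x" "deriv S x" x] elim(1) A(3)[of x] A(4)[of x] by blast+
    then show ?case
      unfolding f using radius2_inv_fourier_phase[of "R i" "deriv (R i)" "2 * A"] elim by (simp add: D_def M_def)
  qed
  have "(\<lambda>i. D (R i) / M (R i) 0 - D S / M S 0) \<in> O(\<mu>)" by (rule quot[OF D])
  moreover have "\<forall>\<^sub>F i in sequentially. radius2 (inv_fourier (f i)) - radius2 (inv_fourier f0) = D (R i) / M (R i) 0 - D S / M S 0"
    using t by eventually_elim (simp add: t0)
  ultimately show "(\<lambda>i. radius2 (inv_fourier (f i)) - radius2 (inv_fourier f0)) \<in> O(\<mu>)"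
    by (rule bigo_eventually_eq)
qed

subsection \<open>Perturbing the Meyer refinement mask\<close>

text \<open>The reduction performed inside \<open>meyer_mask\<close>; its absolute value is the
  distance to the nearest multiple of 2 pi.\<close>

definition wrap :: "real \<Rightarrow> real" where "wrap x = x - 2 * pi * of_int \<lfloor>(x + pi) / (2 * pi)\<rfloor>"

lemma wrap_bounds: "- pi \<le> wrap x" "wrap x < pi"
proof -
  have "of_int \<lfloor>(x + pi) / (2 * pi)\<rfloor> * (2 * pi) \<le> x + pi"
    by (rule floor_divide_lower) simp
  then show "- pi \<le> wrap x" by (simp add: wrap_def algebra_simps)
  have "x + pi < (of_int \<lfloor>(x + pi) / (2 * pi)\<rfloor> + 1) * (2 * pi)"
    by (rule floor_divide_upper) simp
  then show "wrap x < pi" by (simp add: wrap_def algebra_simps)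
qed

lemma abs_wrap_le: "\<bar>wrap x\<bar> \<le> pi"
  using wrap_bounds[of x] by linarith

lemma wrap_unique:
  assumes "x = y + 2 * pi * of_int k" "- pi \<le> y" "y < pi"
  shows "wrap x = y"
proof -
  have "(x + pi) / (2 * pi) = of_int k + (y + pi) / (2 * pi)" using assms(1) by (simp add: field_simps)
  moreover have "\<lfloor>(y + pi) / (2 * pi)\<rfloor> = 0" using assms(2,3) by (simp add: floor_eq_iff)
  ultimately have "\<lfloor>(x + pi) / (2 * pi)\<rfloor> = k" by (metis add.right_neutral floor_add_int add.commute)
  then show ?thesis using assms(1) by (simp add: wrap_def)
qed

lemma wrap_eq: "x = wrap x + 2 * pi * of_int \<lfloor>(x + pi) / (2 * pi)\<rfloor>"
  by (simp add: wrap_def)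

text \<open>On the distance to 2 pi Z, doubling acts as a tent map. Every statement about where
  doubling moves the bands rests on this.\<close>

lemma abs_wrap_double: "\<bar>wrap (2 * x)\<bar> = (if \<bar>wrap x\<bar> \<le> pi / 2 then 2 * \<bar>wrap x\<bar> else 2 * pi - 2 * \<bar>wrap x\<bar>)"
proof -
  define k where "k = \<lfloor>(x + pi) / (2 * pi)\<rfloor>"
  have x: "x = wrap x + 2 * pi * of_int k" unfolding k_def by (rule wrap_eq)
  note b = wrap_bounds[of x]
  consider "- pi \<le> 2 * wrap x" "2 * wrap x < pi" | "pi \<le> 2 * wrap x" | "2 * wrap x < - pi" by linarith
  then show ?thesis
  proof cases
    case 1
    then have "wrap (2 * x) = 2 * wrap x"
      by (intro wrap_unique[where k = "2 * k"]) (use x in \<open>simp_all add: algebra_simps\<close>)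
    then show ?thesis using 1 by (auto simp: abs_if)
  next
    case 2
    then have "wrap (2 * x) = 2 * wrap x - 2 * pi"
      using b by (intro wrap_unique[where k = "2 * k + 1"]) (use x in \<open>simp_all add: algebra_simps\<close>)
    then show ?thesis using 2 b by (auto simp: abs_if)
  next
    case 3
    then have "wrap (2 * x) = 2 * wrap x + 2 * pi"
      using b by (intro wrap_unique[where k = "2 * k - 1"]) (use x in \<open>simp_all add: algebra_simps\<close>)
    then show ?thesis using 3 b by (auto simp: abs_if)
  qed
qed

lemma periodic_wrap:
  fixes f :: "real \<Rightarrow> 'a"
  assumes "\<And>x. f (x + 2 * pi) = f x"
  shows "f (x + 2 * pi * of_int k) = f x" "f (wrap x) = f x"
proof -
  have n: "f (x + 2 * pi * real n) = f x" for x n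
  proof (induction n)
    case (Suc n)
    have "x + 2 * pi * real (Suc n) = (x + 2 * pi * real n) + 2 * pi" by (simp add: algebra_simps)
    then show ?case by (simp only: assms Suc)
  qed simp
  show *: "f (x + 2 * pi * of_int k) = f x" for x k
  proof (cases "k \<ge> 0")
    case True
    then show ?thesis using n[of x "nat k"] by simp
  next
    case False
    then show ?thesis using n[of "x + 2 * pi * of_int k" "nat (- k)"] by (simp add: algebra_simps)
  qed
  show "f (wrap x) = f x"
    using *[of "wrap x" "\<lfloor>(x + pi) / (2 * pi)\<rfloor>"] wrap_eq[of x] by simp
qed

lemma abs_exp_minus_1_le:
  assumes "\<bar>q\<bar> \<le> (1/2::real)"
  shows "\<bar>exp q - 1\<bar> \<le> 2 * \<bar>q\<bar>"
proof -
  have "1 + q \<le> exp q" by (rule exp_ge_add_one_self)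
  moreover have "exp q \<le> 1 + 2 * \<bar>q\<bar>"
  proof (cases "q \<le> 0")
    case False
    have "1 - q \<le> exp (- q)" using exp_ge_add_one_self[of "- q"] by simp
    then have "exp q * (1 - q) \<le> exp q * exp (- q)" by (intro mult_left_mono) auto
    then have "exp q * (1 - q) \<le> 1" by (simp flip: exp_add)
    \<comment> \<open>The product is 1 + q (1 - 2 q), and 0 < q <= 1/2.\<close>
    moreover have "1 \<le> (1 + 2 * q) * (1 - q)" using False assms by (simp add: algebra_simps mult_left_le)
    ultimately have "exp q * (1 - q) \<le> (1 + 2 * q) * (1 - q)" by linarith
    then show ?thesis using False assms by (subst (asm) mult_le_cancel_right_pos) auto
  next
    case True
    then have "exp q \<le> 1" by simp
    then show ?thesis by linarith
  qed
  ultimately show ?thesis by linarith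
qed

text \<open>An interface separating the scaling function estimates from the origin of the masks:
  \<open>h\<close> and \<open>phi0\<close> stand for the Meyer mask and scaling function,
  \<open>m i\<close> for the approximating masks. \<open>\<mu>\<close> is scaled so that all
  constants are 1. The exponent 4 matches the growth 2^4 of a fourth power under doubling, and
  1/1024 turns the factor 256 arising on the stop band into 1/4.\<close>

locale meyer_family =
  fixes w0 :: real and h h' phi0 phi0' :: "real \<Rightarrow> real" and B :: real
    and m m' :: "nat \<Rightarrow> real \<Rightarrow> real" and \<mu> :: "nat \<Rightarrow> real"
  assumes w0: "pi / 3 \<le> w0" "w0 < pi / 2"
    and h_per: "h (x + 2 * pi) = h x"
    and h_deriv: "(h has_real_derivative h' x) (at x)"
    and h_bound: "\<bar>h x\<bar> \<le> 1" "\<bar>h' x\<bar> \<le> B"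
    and h_pass: "\<bar>x\<bar> \<le> w0 \<Longrightarrow> h x = 1 \<and> h' x = 0"
    and h_stop: "pi - w0 \<le> \<bar>x\<bar> \<Longrightarrow> \<bar>x\<bar> \<le> pi \<Longrightarrow> h x = 0 \<and> h' x = 0"
    and qmf: "(h x)\<^sup>2 + (h (x + pi))\<^sup>2 = 1"
    and phi0_deriv: "(phi0 has_real_derivative phi0' x) (at x)"
    and phi0_inner: "\<bar>x\<bar> \<le> 2 * pi \<Longrightarrow> phi0 x = h (x / 2) \<and> phi0' x = h' (x / 2) / 2"
    and phi0_outer: "2 * pi \<le> \<bar>x\<bar> \<Longrightarrow> phi0 x = 0 \<and> phi0' x = 0"
    and m_per: "m i (x + 2 * pi) = m i x" "m' i (x + 2 * pi) = m' i x"
    and m_deriv: "(m i has_real_derivative m' i x) (at x)"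
    and m_close: "\<bar>m i x - h x\<bar> \<le> \<mu> i" "\<bar>m' i x - h' x\<bar> \<le> \<mu> i"
    and m_0: "m i 0 = 1"
    and m_stop: "pi - w0 \<le> \<bar>x\<bar> \<Longrightarrow> \<bar>x\<bar> \<le> pi \<Longrightarrow>
      \<bar>m i x\<bar> \<le> \<mu> i * (pi - \<bar>x\<bar>) ^ 4 \<and> \<bar>m' i x\<bar> \<le> \<mu> i * (pi - \<bar>x\<bar>) ^ 4"
    and \<mu>_small: "\<mu> i \<le> 1 / 1024"
    and \<mu>_lim: "\<mu> \<longlonglongrightarrow> 0"
begin

definition phi :: "nat \<Rightarrow> real \<Rightarrow> real" where "phi i x = (\<Prod>j. m i (x / 2 ^ Suc j))"

text \<open>One more than the bound on \<open>h'\<close>, so that it also bounds \<open>m' i\<close>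
  and is at least 1.\<close>

definition A :: real where "A = B + 1"

lemma A_bounds: "1 \<le> A" "\<bar>m' i x\<bar> \<le> A" "\<bar>m i x\<bar> \<le> 2" and h'_A: "\<bar>h' x\<bar> \<le> A"
  and \<mu>_nonneg: "0 \<le> \<mu> i"
  using h_bound[of x] m_close[where i=i and x=x] \<mu>_small[of i] by (auto simp: A_def)

lemma m_wrap: "m i (wrap x) = m i x" "m' i (wrap x) = m' i x"
  using periodic_wrap(2)[of "m i"] periodic_wrap(2)[of "m' i"] m_per by auto

text \<open>All x / 2^(j+1) lie in the pass band, where the masks are within \<open>\<mu> i\<close>
  of 1. Convergence of the product comes from \<open>m i 0 = 1\<close>: the logarithms vanish at 0
  and have derivatives at most \<open>\<mu> i\<close> 2^(-j), so their series can be differentiated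
  termwise and is small by the mean value inequality.\<close>

lemma phi_near:
  assumes "\<bar>x\<bar> < 2 * w0"
  shows "convergent_prod (\<lambda>j. m i (x / 2 ^ Suc j))" "\<bar>phi i x - 1\<bar> \<le> 16 * \<mu> i"
    "\<exists>D. (phi i has_real_derivative D) (at x) \<and> \<bar>D\<bar> \<le> 4 * \<mu> i"
proof -
  define S where "S = {- 2 * w0 <..< 2 * w0}"
  have S: "x \<in> S" "0 \<in> S" "convex S" "open S" using assms by (auto simp: S_def abs_less_iff)
  define g where "g j x = ln (m i (x / 2 ^ Suc j))" for j x
  define g' where "g' j x = m' i (x / 2 ^ Suc j) / m i (x / 2 ^ Suc j) / 2 ^ Suc j" for j x
  have y: "\<bar>m i (x / 2 ^ Suc j) - 1\<bar> \<le> \<mu> i" "\<bar>m' i (x / 2 ^ Suc j)\<bar> \<le> \<mu> i"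
    "1/2 < m i (x / 2 ^ Suc j)" if "x \<in> S" for x j
  proof -
    have "\<bar>x\<bar> \<le> 2 * w0" using that by (auto simp: S_def abs_le_iff)
    also have "\<dots> \<le> w0 * 2 ^ Suc j" using w0 pi_gt_zero by simp
    finally have "\<bar>x / 2 ^ Suc j\<bar> \<le> w0" by (simp add: abs_divide divide_le_eq)
    from h_pass[OF this] m_close[where i=i and x="x / 2 ^ Suc j"]
    show "\<bar>m i (x / 2 ^ Suc j) - 1\<bar> \<le> \<mu> i" "\<bar>m' i (x / 2 ^ Suc j)\<bar> \<le> \<mu> i" by auto
    then show "1/2 < m i (x / 2 ^ Suc j)" using \<mu>_small[of i] by linarith
  qed
  have g_deriv: "(g j has_real_derivative g' j x) (at x)" if "x \<in> S" for x j
  proof -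
    have "((\<lambda>x. x / 2 ^ Suc j) has_real_derivative 1 / 2 ^ Suc j) (at x)"
      by (rule DERIV_cdivide[OF DERIV_ident])
    from DERIV_chain2[OF m_deriv this, of i] have d: "((\<lambda>x. m i (x / 2 ^ Suc j)) has_real_derivative m' i (x / 2 ^ Suc j) * (1 / 2 ^ Suc j)) (at x)" .
    from DERIV_chain2[OF DERIV_ln_divide d] y(3)[OF that, of j]
    show ?thesis unfolding g_def g'_def by simp
  qed
  have g'_le: "\<bar>g' j x\<bar> \<le> \<mu> i * (1/2) ^ j" if "x \<in> S" for x j
  proof -
    have "\<bar>m' i (x / 2 ^ Suc j) / m i (x / 2 ^ Suc j)\<bar> \<le> 2 * \<mu> i"
    proof -
      have "\<mu> i * 1 \<le> \<mu> i * (2 * m i (x / 2 ^ Suc j))"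
        using y(3)[OF that, of j] \<mu>_nonneg[of i] by (intro mult_left_mono) auto
      then show ?thesis using y(2,3)[OF that, of j] by (simp add: abs_divide pos_divide_le_eq)
    qed
    then have "\<bar>m' i (x / 2 ^ Suc j) / m i (x / 2 ^ Suc j)\<bar> / 2 ^ Suc j \<le> 2 * \<mu> i / 2 ^ Suc j"
      by (intro divide_right_mono) auto
    then show ?thesis by (simp add: g'_def abs_divide abs_mult power_divide)
  qed
  have sumgeo: "summable (\<lambda>j. \<mu> i * (1/2) ^ j)" by (intro summable_mult summable_geometric) simp
  have g0: "g j 0 = 0" for j by (simp add: g_def m_0)
  have unif: "uniformly_convergent_on S (\<lambda>n x. \<Sum>j<n. g' j x)"
    by (rule Weierstrass_m_test'[OF _ sumgeo]) (use g'_le in auto)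
  define Q where "Q x = (\<Sum>j. g j x)" for x
  have ser: "summable (\<lambda>j. g j x)" "(Q has_real_derivative (\<Sum>j. g' j x)) (at x)" if "x \<in> S" for x
    using has_field_derivative_series'[OF S(3) has_field_derivative_at_within[OF g_deriv] unif S(2), of x] that S(4)
    by (auto simp: g0 interior_open Q_def[abs_def])
  have Q'_le: "\<bar>\<Sum>j. g' j x\<bar> \<le> 2 * \<mu> i" if "x \<in> S" for x
  proof -
    have "norm (\<Sum>j. g' j x) \<le> (\<Sum>j. \<mu> i * (1/2) ^ j)"
      by (rule norm_suminf_le[OF _ sumgeo]) (use g'_le[OF that] in simp)
    also have "\<dots> = \<mu> i * 2" by (subst suminf_mult) (auto simp: suminf_geometric summable_geometric)
    finally show ?thesis by simp
  qed
  have Q0: "Q 0 = 0" by (simp add: Q_def g0)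
  have Q_le: "\<bar>Q x\<bar> \<le> 8 * \<mu> i" if "x \<in> S" for x
  proof -
    have "norm (Q x - Q 0) \<le> (2 * \<mu> i) * norm (x - 0)"
      by (rule field_differentiable_bound[of S Q "\<lambda>x. \<Sum>j. g' j x"])
         (use S that ser(2) Q'_le in \<open>auto intro: has_field_derivative_at_within\<close>)
    \<comment> \<open>Here |x| < 2 w0 < pi < 4.\<close>
    also have "\<dots> \<le> 2 * \<mu> i * 4"
      using that w0 pi_less_4 \<mu>_nonneg[of i] by (intro mult_left_mono) (auto simp: S_def abs_le_iff)
    finally show ?thesis by (simp add: Q0)
  qed
  have prod: "(\<lambda>j. m i (x / 2 ^ Suc j)) has_prod exp (Q x)" if "x \<in> S" for x
  proof -
    have "(\<lambda>j. g j x) sums Q x" unfolding Q_def using ser(1)[OF that] by (rule summable_sums)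
    then have "(\<lambda>j. exp (g j x)) has_prod exp (Q x)"
      by (simp add: has_prod_def sums_imp_has_prod_exp)
    moreover have "exp (g j x) = m i (x / 2 ^ Suc j)" for j
      using y(3)[OF that, of j] by (simp add: g_def)
    ultimately show ?thesis by simp
  qed
  have phi_exp: "phi i x = exp (Q x)" if "x \<in> S" for x
    using has_prod_unique[OF prod[OF that]] by (simp add: phi_def)
  show "convergent_prod (\<lambda>j. m i (x / 2 ^ Suc j))"
    using prod[OF S(1)] has_prod_iff by blast
  have Q_small: "\<bar>Q x\<bar> \<le> 1/2" using Q_le[OF S(1)] \<mu>_small[of i] by linarith
  note e = abs_exp_minus_1_le[OF Q_small]
  show "\<bar>phi i x - 1\<bar> \<le> 16 * \<mu> i"
    using e Q_le[OF S(1)] by (simp add: phi_exp[OF S(1)])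
  have "((\<lambda>x. exp (Q x)) has_real_derivative exp (Q x) * (\<Sum>j. g' j x)) (at x)"
    using DERIV_chain2[OF DERIV_exp ser(2)[OF S(1)]] .
  then have "(phi i has_real_derivative exp (Q x) * (\<Sum>j. g' j x)) (at x)"
    by (rule has_field_derivative_transform_within_open[OF _ S(4) S(1)]) (use phi_exp in auto)
  \<comment> \<open>The estimate \<open>e\<close> with |Q x| <= 1/2 gives exp (Q x) <= 2.\<close>
  moreover have "\<bar>exp (Q x) * (\<Sum>j. g' j x)\<bar> \<le> 2 * (2 * \<mu> i)"
    unfolding abs_mult using e Q_small Q'_le[OF S(1)] by (intro mult_mono) auto
  ultimately show "\<exists>D. (phi i has_real_derivative D) (at x) \<and> \<bar>D\<bar> \<le> 4 * \<mu> i" by auto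
qed

lemma w0_pos: "0 < w0" using w0 pi_gt_zero by linarith

lemma ex_scale: "\<exists>n. \<bar>x\<bar> < 2 ^ n * (2 * w0)"
proof -
  obtain n where "\<bar>x\<bar> / (2 * w0) < 2 ^ n" using real_arch_pow[of 2] by auto
  then show ?thesis using w0_pos by (auto simp: pos_divide_less_eq)
qed

text \<open>Dropping finitely many factors replaces x by some x / 2^n in the range of
  \<open>phi_near\<close>.\<close>

lemma phi_convergent: "convergent_prod (\<lambda>j. m i (x / 2 ^ Suc j))"
proof -
  obtain n where "\<bar>x\<bar> < 2 ^ n * (2 * w0)" using ex_scale by blast
  then have "\<bar>x / 2 ^ n\<bar> < 2 * w0" by (simp add: abs_divide pos_divide_less_eq mult.commute)
  from phi_near(1)[OF this, of i] have "convergent_prod (\<lambda>j. m i (x / 2 ^ Suc (j + n)))"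
    by (simp add: power_add mult_ac)
  then show ?thesis by (rule convergent_prod_offset)
qed

text \<open>The refinement equation: split off the first factor of the partial products and pass to
  the limit.\<close>

lemma phi_double: "phi i (2 * x) = m i x * phi i x"
proof -
  have "(\<lambda>n. \<Prod>j\<le>n. m i (2 * x / 2 ^ Suc j)) \<longlonglongrightarrow> phi i (2 * x)"
    unfolding phi_def by (rule convergent_prod_LIMSEQ[OF phi_convergent])
  then have "(\<lambda>n. \<Prod>j\<le>Suc n. m i (2 * x / 2 ^ Suc j)) \<longlonglongrightarrow> phi i (2 * x)" by (rule LIMSEQ_Suc)
  moreover have "(\<Prod>j\<le>Suc n. m i (2 * x / 2 ^ Suc j)) = m i x * (\<Prod>j\<le>n. m i (x / 2 ^ Suc j))" for n
    by (subst prod.atMost_Suc_shift) simp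
  moreover have "(\<lambda>n. m i x * (\<Prod>j\<le>n. m i (x / 2 ^ Suc j))) \<longlonglongrightarrow> m i x * phi i x"
    unfolding phi_def by (intro tendsto_intros convergent_prod_LIMSEQ[OF phi_convergent])
  ultimately show ?thesis by (simp add: LIMSEQ_unique)
qed

abbreviation phi' :: "nat \<Rightarrow> real \<Rightarrow> real" where "phi' i \<equiv> deriv (phi i)"

lemma phi_half: "phi i = (\<lambda>x. m i (x / 2) * phi i (x / 2))"
proof (rule ext)
  show "phi i x = m i (x / 2) * phi i (x / 2)" for x using phi_double[of i "x / 2"] by simp
qed

lemma phi_half_deriv:
  assumes "(phi i has_real_derivative D) (at (x / 2))"
  shows "(phi i has_real_derivative (m' i (x / 2) * phi i (x / 2) + m i (x / 2) * D) / 2) (at x)"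
proof -
  have h: "((\<lambda>x. x / 2) has_real_derivative 1 / 2) (at x)" by (rule DERIV_cdivide[OF DERIV_ident])
  from DERIV_mult[OF DERIV_chain2[OF m_deriv h] DERIV_chain2[OF assms h], of i]
  show ?thesis by (subst phi_half) (simp add: mult_ac add_ac add_divide_distrib)
qed

text \<open>The refinement equation spreads differentiability from an interval around 0 to twice
  that interval, and induction reaches every point.\<close>

lemma phi_deriv: "(phi i has_real_derivative phi' i x) (at x)"
proof -
  have "\<exists>D. (phi i has_real_derivative D) (at x)" if "\<bar>x\<bar> < 2 ^ n * (2 * w0)" for n
    using that
  proof (induction n arbitrary: x)
    case 0
    then show ?case using phi_near(3)[of x i] by auto
  next
    case (Suc n)
    then have "\<bar>x / 2\<bar> < 2 ^ n * (2 * w0)" by simp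
    from Suc.IH[OF this] show ?case using phi_half_deriv by blast
  qed
  then show ?thesis using ex_scale[of x] DERIV_imp_deriv by metis
qed

lemma phi'_double: "phi' i (2 * x) = (m' i x * phi i x + m i x * phi' i x) / 2"
  using phi_half_deriv[OF phi_deriv, of i "2 * x"] DERIV_imp_deriv by fastforce

lemma phi'_near: "\<bar>x\<bar> < 2 * w0 \<Longrightarrow> \<bar>phi' i x\<bar> \<le> 4 * \<mu> i"
  using phi_near(3)[of x i] DERIV_imp_deriv by auto

end

section \<open>Uniform decay of the scaling functions\<close>

context meyer_family
begin

text \<open>The factor \<open>16\<close> on the stop band pays for the transition band, which doubling maps into the
  stop band.\<close>
definition dec :: "real \<Rightarrow> real" where
  "dec x = (wrap x) ^ 4 * (if pi - w0 \<le> \<bar>wrap x\<bar> then 16 else 1)"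

lemma dec_abs: "dec x = \<bar>wrap x\<bar> ^ 4 * (if pi - w0 \<le> \<bar>wrap x\<bar> then 16 else 1)"
  by (simp add: dec_def)

lemma dec_nonneg: "0 \<le> dec x"
  by (simp add: dec_def)

lemma pi_pow4_le: "pi ^ 4 \<le> 256"
  using power_mono[of pi 4 4] pi_less_4 by simp

lemma dec_le: "dec x \<le> 4096"
proof -
  have "\<bar>wrap x\<bar> ^ 4 \<le> pi ^ 4" by (intro power_mono abs_wrap_le) auto
  then show ?thesis using pi_pow4_le by (auto simp: dec_def)
qed

text \<open>Up to pi/2, doubling x doubles the distance to 2 pi Z. Between pi/2 and pi - w0, the
  doubled point is in the stop band, because 2 w0 >= pi - w0, and is at least as far from 2 pi Z;
  the gain is then the factor 16 inside \<open>dec\<close>.\<close>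

lemma dec_double_pass:
  assumes "\<bar>wrap x\<bar> < pi - w0"
  shows "16 * dec x \<le> dec (2 * x)"
proof (cases "\<bar>wrap x\<bar> \<le> pi / 2")
  case True
  then have "\<bar>wrap (2 * x)\<bar> = 2 * \<bar>wrap x\<bar>" by (simp add: abs_wrap_double)
  then show ?thesis using assms by (auto simp: dec_abs power_mult_distrib)
next
  case False
  then have e: "\<bar>wrap (2 * x)\<bar> = 2 * pi - 2 * \<bar>wrap x\<bar>" by (simp add: abs_wrap_double)
  then have "pi - w0 \<le> \<bar>wrap (2 * x)\<bar>" "\<bar>wrap x\<bar> \<le> \<bar>wrap (2 * x)\<bar>" using assms w0 by linarith+
  moreover from this(2) have "\<bar>wrap x\<bar> ^ 4 \<le> \<bar>wrap (2 * x)\<bar> ^ 4" by (intro power_mono) auto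
  ultimately show ?thesis using assms by (auto simp: dec_abs)
qed

text \<open>Here 2 x has distance 2 (pi - |wrap x|) from 2 pi Z, so the fourth-order zero of the
  masks at pi is measured by \<open>dec\<close> at the doubled point.\<close>

lemma dec_double_stop:
  assumes "pi - w0 \<le> \<bar>wrap x\<bar>"
  shows "16 * (pi - \<bar>wrap x\<bar>) ^ 4 \<le> dec (2 * x)"
proof -
  have e: "\<bar>wrap (2 * x)\<bar> = 2 * (pi - \<bar>wrap x\<bar>)"
    using assms w0 by (simp add: abs_wrap_double)
  then have "16 * (pi - \<bar>wrap x\<bar>) ^ 4 = \<bar>wrap (2 * x)\<bar> ^ 4"
    unfolding e power_mult_distrib by simp
  then show ?thesis by (auto simp: dec_abs)
qed

text \<open>256 is the global bound 4096 on \<open>dec\<close> divided by the 16 of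
  \<open>dec_double_stop\<close>.\<close>

lemma m_dec_stop:
  assumes "pi - w0 \<le> \<bar>wrap x\<bar>"
  shows "\<bar>m i x\<bar> * dec x \<le> 256 * \<mu> i * dec (2 * x)" "\<bar>m' i x\<bar> * dec x \<le> 256 * \<mu> i * dec (2 * x)"
proof -
  have "y * dec x \<le> 256 * \<mu> i * dec (2 * x)" if "y \<le> \<mu> i * (pi - \<bar>wrap x\<bar>) ^ 4" for y
  proof -
    have "y * dec x \<le> (\<mu> i * (pi - \<bar>wrap x\<bar>) ^ 4) * 4096"
      using that dec_le[of x] dec_nonneg[of x] \<mu>_nonneg[of i] abs_wrap_le[of x] by (intro mult_mono) auto
    also have "\<dots> = 256 * \<mu> i * (16 * (pi - \<bar>wrap x\<bar>) ^ 4)" by simp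
    also have "\<dots> \<le> 256 * \<mu> i * dec (2 * x)"
      using \<mu>_nonneg[of i] by (intro mult_left_mono dec_double_stop assms) auto
    finally show ?thesis .
  qed
  then show "\<bar>m i x\<bar> * dec x \<le> 256 * \<mu> i * dec (2 * x)" "\<bar>m' i x\<bar> * dec x \<le> 256 * \<mu> i * dec (2 * x)"
    using m_stop[OF assms abs_wrap_le, of i] by (auto simp: m_wrap)
qed

text \<open>The quarter is what the induction over dyadic shells consumes, since x^2 grows by 4
  under doubling. Off the stop band the masks are bounded by 2, their derivatives by
  \<open>A\<close>, and the weight gains 16; on it \<open>256 * \<mu> i\<close> is at most
  1/4.\<close>

lemma m_dec: "\<bar>m i x\<bar> * dec x \<le> dec (2 * x) / 4" "\<bar>m' i x\<bar> * dec x \<le> A * (dec (2 * x) / 4)"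
proof -
  have "\<bar>m i x\<bar> * dec x \<le> dec (2 * x) / 4 \<and> \<bar>m' i x\<bar> * dec x \<le> A * (dec (2 * x) / 4)"
  proof (cases "\<bar>wrap x\<bar> < pi - w0")
    case True
    note d = dec_double_pass[OF True]
    have "\<bar>m i x\<bar> * dec x \<le> 2 * dec x" "\<bar>m' i x\<bar> * dec x \<le> A * dec x"
      using A_bounds(2,3)[of i x] dec_nonneg[of x] by (intro mult_right_mono; simp)+
    moreover have "A * dec x \<le> A * (dec (2 * x) / 4)"
      using d dec_nonneg[of x] A_bounds(1) by (intro mult_left_mono) auto
    ultimately show ?thesis using d dec_nonneg[of x] by linarith
  next
    case False
    then have s: "pi - w0 \<le> \<bar>wrap x\<bar>" by simp
    have "256 * \<mu> i * dec (2 * x) \<le> 1 / 4 * dec (2 * x)"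
      using \<mu>_small[of i] dec_nonneg[of "2 * x"] by (intro mult_right_mono) auto
    moreover have "1 * (dec (2 * x) / 4) \<le> A * (dec (2 * x) / 4)"
      using A_bounds(1) dec_nonneg[of "2 * x"] by (intro mult_right_mono) auto
    ultimately show ?thesis using m_dec_stop[OF s, of i] by linarith
  qed
  then show "\<bar>m i x\<bar> * dec x \<le> dec (2 * x) / 4" "\<bar>m' i x\<bar> * dec x \<le> A * (dec (2 * x) / 4)" by auto
qed

lemma phi_bound:
  assumes "\<bar>x\<bar> < 4 * w0"
  shows "\<bar>phi i x\<bar> \<le> 4 * A" "\<bar>phi' i x\<bar> \<le> 4 * A"
proof -
  have y: "\<bar>x / 2\<bar> < 2 * w0" using assms by simp
  have p: "\<bar>phi i (x / 2)\<bar> \<le> 2" "\<bar>phi' i (x / 2)\<bar> \<le> 1"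
    using phi_near(2)[OF y, of i] phi'_near[OF y, of i] \<mu>_small[of i] by linarith+
  note a = A_bounds(2,3)[of i "x / 2"]
  have "\<bar>m i (x / 2)\<bar> * \<bar>phi i (x / 2)\<bar> \<le> 2 * 2" using a p by (intro mult_mono) auto
  then show "\<bar>phi i x\<bar> \<le> 4 * A" using phi_double[of i "x / 2"] A_bounds(1) by (simp add: abs_mult)
  have "\<bar>m' i (x / 2)\<bar> * \<bar>phi i (x / 2)\<bar> \<le> A * 2" "\<bar>m i (x / 2)\<bar> * \<bar>phi' i (x / 2)\<bar> \<le> 2 * 1"
    using a p A_bounds(1) by (intro mult_mono; auto)+
  then have "\<bar>m' i (x / 2) * phi i (x / 2)\<bar> \<le> A * 2" "\<bar>m i (x / 2) * phi' i (x / 2)\<bar> \<le> 2" by (simp_all add: abs_mult)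
  moreover have "2 * phi' i x = m' i (x / 2) * phi i (x / 2) + m i (x / 2) * phi' i (x / 2)"
    using phi'_double[of i "x / 2"] by simp
  ultimately show "\<bar>phi' i x\<bar> \<le> 4 * A" using A_bounds(1) by linarith
qed

text \<open>Since w0 >= pi/3, at least one of y and 2 y lies in the stop band. That one supplies the
  factor \<open>\<mu> i\<close>, the other merely transports the weight. Letting p and q be masks or
  their derivatives covers all Leibniz terms at once.\<close>

lemma shell_product:
  assumes y: "pi / 2 \<le> \<bar>y\<bar>" "\<bar>y\<bar> < pi"
    and p: "p \<in> {m i, m' i}" and q: "q \<in> {m i, m' i}"
  shows "\<bar>p (2 * y) * q y\<bar> \<le> 64 * A * \<mu> i * dec (2 * (2 * y))"
proof -
  have "wrap y = y" using y by (intro wrap_unique[where k = 0]) auto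
  then have w: "\<bar>wrap y\<bar> = \<bar>y\<bar>" "\<bar>wrap (2 * y)\<bar> = 2 * pi - 2 * \<bar>y\<bar>"
    using y by (auto simp: abs_wrap_double)
  have gen: "\<bar>r x\<bar> * dec x \<le> A * (dec (2 * x) / 4)" if "r \<in> {m i, m' i}" for r x
  proof -
    have "1 * (dec (2 * x) / 4) \<le> A * (dec (2 * x) / 4)"
      using A_bounds(1) dec_nonneg[of "2 * x"] by (intro mult_right_mono) auto
    with that m_dec[of i x] show ?thesis by auto
  qed
  have st: "\<bar>r x\<bar> * dec x \<le> 256 * \<mu> i * dec (2 * x)" if "r \<in> {m i, m' i}" "pi - w0 \<le> \<bar>wrap x\<bar>" for r x
    using that m_dec_stop[of x i] by auto
  \<comment> \<open>The chain of weights starts at dec y >= 1, which holds because |y| >= pi/2 >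
    1.\<close>
  have "1 ^ 4 \<le> \<bar>y\<bar> ^ 4" using y pi_gt3 by (intro power_mono) auto
  then have "1 \<le> dec y" by (auto simp: dec_abs w)
  then have "\<bar>q y\<bar> * 1 \<le> \<bar>q y\<bar> * dec y" by (intro mult_left_mono) auto
  then have q1: "\<bar>q y\<bar> \<le> \<bar>q y\<bar> * dec y" by simp
  have "\<bar>p (2 * y)\<bar> * \<bar>q y\<bar> \<le> 64 * A * \<mu> i * dec (2 * (2 * y))"
  proof (cases "pi - w0 \<le> \<bar>wrap y\<bar>")
    case True
    have "\<bar>p (2 * y)\<bar> * \<bar>q y\<bar> \<le> \<bar>p (2 * y)\<bar> * (256 * \<mu> i * dec (2 * y))"
      using q1 st[OF q True] by (intro mult_left_mono) auto
    also have "\<dots> = 256 * \<mu> i * (\<bar>p (2 * y)\<bar> * dec (2 * y))" by simp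
    also have "\<dots> \<le> 256 * \<mu> i * (A * (dec (2 * (2 * y)) / 4))"
      using gen[OF p, of "2 * y"] \<mu>_nonneg[of i] by (intro mult_left_mono) auto
    finally show ?thesis by simp
  next
    case False
    then have "pi - w0 \<le> \<bar>wrap (2 * y)\<bar>" using w w0 by linarith
    note s = st[OF p this]
    have "\<bar>p (2 * y)\<bar> * \<bar>q y\<bar> \<le> \<bar>p (2 * y)\<bar> * (A * (dec (2 * y) / 4))"
      using q1 gen[OF q, of y] by (intro mult_left_mono) auto
    also have "\<dots> = A / 4 * (\<bar>p (2 * y)\<bar> * dec (2 * y))" by simp
    also have "\<dots> \<le> A / 4 * (256 * \<mu> i * dec (2 * (2 * y)))"
      using s A_bounds(1) by (intro mult_left_mono) auto
    finally show ?thesis by simp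
  qed
  then show ?thesis by (simp add: abs_mult)
qed

text \<open>65536 = 256 * 64 * 4: the bound on x^2 in the first shell, the constant of
  \<open>shell_product\<close> and that of \<open>phi_bound\<close>. The last two each carry a
  factor \<open>A\<close>.\<close>

definition K :: real where "K = 65536 * A\<^sup>2"

text \<open>Here phi(x) = m(x/2) m(x/4) phi(x/4). The point x/4 is in the range of
  \<open>shell_product\<close> and below 4 w0, so \<open>phi_bound\<close> covers the last
  factor.\<close>

lemma phi_shell:
  assumes x: "2 * pi \<le> \<bar>x\<bar>" "\<bar>x\<bar> < 4 * pi"
  shows "x\<^sup>2 * \<bar>phi i x\<bar> \<le> K * (\<mu> i * dec x)" "x\<^sup>2 * \<bar>phi' i x\<bar> \<le> K * (\<mu> i * dec x)"
proof -
  define y where "y = x / 4"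
  have xy: "x = 2 * (2 * y)" by (simp add: y_def)
  have y: "pi / 2 \<le> \<bar>y\<bar>" "\<bar>y\<bar> < pi" "\<bar>y\<bar> < 4 * w0" using x w0 by (auto simp: y_def)
  define E where "E = 64 * A * \<mu> i * dec x"
  have E: "0 \<le> E" using A_bounds(1) \<mu>_nonneg[of i] dec_nonneg[of x] by (simp add: E_def)
  note pb = phi_bound[OF y(3), of i]
  have *: "\<bar>p (2 * y) * q y * r\<bar> \<le> E * (4 * A)" if "p \<in> {m i, m' i}" "q \<in> {m i, m' i}" "\<bar>r\<bar> \<le> 4 * A" for p q r
    using shell_product[OF y(1,2) that(1,2)] that(3) E unfolding xy[symmetric] E_def[symmetric]
    by (subst abs_mult) (intro mult_mono, auto)
  have x2: "x\<^sup>2 \<le> 256"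
  proof -
    have "\<bar>x\<bar> ^ 2 \<le> 16 ^ 2" using x pi_less_4 by (intro power_mono) auto
    then show ?thesis by simp
  qed
  have fin: "x\<^sup>2 * \<bar>z\<bar> \<le> K * (\<mu> i * dec x)" if "\<bar>z\<bar> \<le> E * (4 * A)" for z
  proof -
    have "x\<^sup>2 * \<bar>z\<bar> \<le> 256 * (E * (4 * A))" using that x2 by (intro mult_mono) auto
    then show ?thesis by (simp add: E_def K_def power2_eq_square mult_ac)
  qed
  have "phi i x = m i (2 * y) * m i y * phi i y"
    unfolding xy phi_double by simp
  with *[of "m i" "m i", OF _ _ pb(1)] show "x\<^sup>2 * \<bar>phi i x\<bar> \<le> K * (\<mu> i * dec x)" by (intro fin) auto
  \<comment> \<open>Leibniz for three factors: the chain rule costs 1/2 for m(x/2) and 1/4 for each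
    of the other two.\<close>
  have "4 * phi' i x = 2 * (m' i (2 * y) * m i y * phi i y) + m i (2 * y) * m' i y * phi i y + m i (2 * y) * m i y * phi' i y"
    unfolding xy phi'_double phi_double by (simp add: algebra_simps)
  moreover note *[of "m' i" "m i", OF _ _ pb(1)] *[of "m i" "m' i", OF _ _ pb(1)] *[of "m i" "m i", OF _ _ pb(2)]
  ultimately have "\<bar>phi' i x\<bar> \<le> E * (4 * A)" by simp
  then show "x\<^sup>2 * \<bar>phi' i x\<bar> \<le> K * (\<mu> i * dec x)" by (rule fin)
qed

text \<open>Doubling the argument multiplies the weight \<open>dec\<close> by enough to absorb the mask, so the bound on
  the first dyadic shell propagates to all of them.\<close>
lemma phi_decay:
  assumes "2 * pi \<le> \<bar>x\<bar>"
  shows "x\<^sup>2 * \<bar>phi i x\<bar> \<le> K * (\<mu> i * dec x)" "x\<^sup>2 * \<bar>phi' i x\<bar> \<le> A * (K * (\<mu> i * dec x))"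
proof -
  have "x\<^sup>2 * \<bar>phi i x\<bar> \<le> K * (\<mu> i * dec x) \<and> x\<^sup>2 * \<bar>phi' i x\<bar> \<le> A * (K * (\<mu> i * dec x))"
    if "2 * pi \<le> \<bar>x\<bar>" "\<bar>x\<bar> < 2 ^ n * (2 * pi)" for n x
    using that
  proof (induction n arbitrary: x)
    case (Suc n)
    show ?case
    proof (cases "\<bar>x\<bar> < 4 * pi")
      case True
      have "1 * (K * (\<mu> i * dec x)) \<le> A * (K * (\<mu> i * dec x))"
        using A_bounds(1) \<mu>_nonneg[of i] dec_nonneg[of x] by (intro mult_right_mono) (auto simp: K_def)
      then show ?thesis using phi_shell[OF Suc.prems(1) True, of i] by linarith
    next
      case False
      define y where "y = x / 2"
      have xy: "x = 2 * y" by (simp add: y_def)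
      define L where "L = K * \<mu> i"
      have L: "0 \<le> L" using A_bounds(1) \<mu>_nonneg[of i] by (simp add: L_def K_def)
      have IH: "y\<^sup>2 * \<bar>phi i y\<bar> \<le> L * dec y" "y\<^sup>2 * \<bar>phi' i y\<bar> \<le> A * (L * dec y)"
        using Suc.IH[of y] Suc.prems False by (auto simp: y_def L_def mult.assoc)
      have "x\<^sup>2 * \<bar>phi i x\<bar> = 4 * \<bar>m i y\<bar> * (y\<^sup>2 * \<bar>phi i y\<bar>)"
        unfolding xy phi_double by (simp add: abs_mult power_mult_distrib)
      also have "\<dots> \<le> 4 * \<bar>m i y\<bar> * (L * dec y)" using IH by (intro mult_left_mono) auto
      also have "\<dots> = 4 * L * (\<bar>m i y\<bar> * dec y)" by simp
      also have "\<dots> \<le> 4 * L * (dec (2 * y) / 4)" using L by (intro mult_left_mono m_dec) auto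
      finally have 1: "x\<^sup>2 * \<bar>phi i x\<bar> \<le> L * dec x" by (simp add: xy)
      have "x\<^sup>2 * \<bar>phi' i x\<bar> = 2 * y\<^sup>2 * \<bar>m' i y * phi i y + m i y * phi' i y\<bar>"
        unfolding xy phi'_double by (simp add: abs_divide power_mult_distrib)
      also have "\<dots> \<le> 2 * y\<^sup>2 * (\<bar>m' i y\<bar> * \<bar>phi i y\<bar> + \<bar>m i y\<bar> * \<bar>phi' i y\<bar>)"
        by (intro mult_left_mono order_trans[OF abs_triangle_ineq]) (auto simp: abs_mult)
      also have "\<dots> = 2 * (\<bar>m' i y\<bar> * (y\<^sup>2 * \<bar>phi i y\<bar>) + \<bar>m i y\<bar> * (y\<^sup>2 * \<bar>phi' i y\<bar>))"
        by (simp add: algebra_simps)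
      also have "\<dots> \<le> 2 * (\<bar>m' i y\<bar> * (L * dec y) + \<bar>m i y\<bar> * (A * (L * dec y)))"
        using IH by (intro mult_left_mono add_mono) auto
      also have "\<dots> = 2 * L * (\<bar>m' i y\<bar> * dec y) + 2 * A * L * (\<bar>m i y\<bar> * dec y)"
        by (simp add: algebra_simps)
      \<comment> \<open>Each Leibniz term contributes half of A * (L * dec x), because the chain
        rule halves the derivative. Hence the constant does not grow from shell to shell.\<close>
      also have "\<dots> \<le> 2 * L * (A * (dec (2 * y) / 4)) + 2 * A * L * (dec (2 * y) / 4)"
        using L A_bounds(1) by (intro add_mono mult_left_mono m_dec) auto
      also have "\<dots> = A * (L * dec x)" by (simp add: xy)
      finally show ?thesis using 1 by (simp add: L_def mult.assoc)
    qed
  qed auto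
  moreover obtain n where "\<bar>x\<bar> / (2 * pi) < 2 ^ n" using real_arch_pow[of 2] by auto
  then have "\<bar>x\<bar> < 2 ^ n * (2 * pi)" by (simp add: pos_divide_less_eq)
  ultimately show "x\<^sup>2 * \<bar>phi i x\<bar> \<le> K * (\<mu> i * dec x)" "x\<^sup>2 * \<bar>phi' i x\<bar> \<le> A * (K * (\<mu> i * dec x))"
    using assms by blast+
qed

text \<open>8192 = 2 * 4096, from 1 + x^2 <= 2 x^2 and the bound on \<open>dec\<close>.\<close>

lemma phi_decay_wt:
  assumes "2 * pi \<le> \<bar>x\<bar>"
  shows "\<bar>phi i x\<bar> \<le> 8192 * A * K * (\<mu> i * wt x)" "\<bar>phi' i x\<bar> \<le> 8192 * A * K * (\<mu> i * wt x)"
proof -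
  have "1 * 1 \<le> \<bar>x\<bar> * \<bar>x\<bar>" using assms pi_gt3 by (intro mult_mono) auto
  then have x: "1 \<le> x\<^sup>2" by (simp add: power2_eq_square)
  define L where "L = K * \<mu> i"
  have L: "0 \<le> L" using A_bounds(1) \<mu>_nonneg[of i] by (simp add: L_def K_def)
  have *: "\<bar>z\<bar> \<le> 8192 * A * K * (\<mu> i * wt x)" if "x\<^sup>2 * \<bar>z\<bar> \<le> A * (L * 4096)" for z
  proof -
    have "(1 + x\<^sup>2) * \<bar>z\<bar> \<le> (2 * x\<^sup>2) * \<bar>z\<bar>" using x by (intro mult_right_mono) auto
    then have "(1 + x\<^sup>2) * \<bar>z\<bar> \<le> 8192 * A * L" using that by simp
    then have "\<bar>z\<bar> \<le> 8192 * A * L / (1 + x\<^sup>2)" using wt_pos[of x] by (simp add: pos_le_divide_eq mult.commute)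
    then show ?thesis by (simp add: L_def mult_ac)
  qed
  have d: "L * dec x \<le> L * 4096" using L dec_le by (intro mult_left_mono) auto
  have Ad: "A * (L * dec x) \<le> A * (L * 4096)" by (rule mult_left_mono[OF d]) (use A_bounds(1) in simp)
  have "1 * (L * 4096) \<le> A * (L * 4096)" using A_bounds(1) L by (intro mult_right_mono) auto
  note Ad = Ad this
  have e: "K * (\<mu> i * dec x) = L * dec x" by (simp add: L_def)
  have f: "x\<^sup>2 * \<bar>phi i x\<bar> \<le> A * (L * 4096)" "x\<^sup>2 * \<bar>phi' i x\<bar> \<le> A * (L * 4096)"
    using phi_decay[OF assms, of i] d Ad unfolding e by linarith+
  from *[OF f(1)] *[OF f(2)]
  show "\<bar>phi i x\<bar> \<le> 8192 * A * K * (\<mu> i * wt x)" "\<bar>phi' i x\<bar> \<le> 8192 * A * K * (\<mu> i * wt x)" .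
qed

section \<open>Closeness to the Meyer scaling function\<close>

lemma phi0_product:
  assumes "\<bar>x\<bar> \<le> 2 * pi"
  shows "phi0 x = h (x / 2) * h (x / 4)" "phi0' x = (h' (x / 2) * h (x / 4)) / 2 + (h (x / 2) * h' (x / 4)) / 4"
proof -
  have "phi0 x = h (x / 2) * h (x / 4) \<and> phi0' x = (h' (x / 2) * h (x / 4)) / 2 + (h (x / 2) * h' (x / 4)) / 4"
  proof (cases "\<bar>x / 4\<bar> \<le> w0")
    case True
    then show ?thesis using h_pass[OF True] phi0_inner[OF assms] by simp
  next
    case False
    \<comment> \<open>Once x/4 leaves the pass band, x/2 is in the stop band, as 2 w0 >= pi - w0. So
      h(x/4) differs from 1 only where h(x/2) vanishes, and including it gives \<open>phi0\<close>
      the shape of m(x/2) m(x/4) phi(x/4).\<close>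
    then have "pi - w0 \<le> \<bar>x / 2\<bar>" "\<bar>x / 2\<bar> \<le> pi" using assms w0 by simp_all
    from h_stop[OF this] show ?thesis using phi0_inner[OF assms] by simp
  qed
  then show "phi0 x = h (x / 2) * h (x / 4)" "phi0' x = (h' (x / 2) * h (x / 4)) / 2 + (h (x / 2) * h' (x / 4)) / 4" by auto
qed

text \<open>The third factor phi(x/4) is near 1 because |x/4| <= pi/2 < 2 w0. The constant is 144 =
  3 * 3 * 16: two uses of the product bound and the 16 of \<open>phi_near\<close>.\<close>

lemma phi_close_near:
  assumes x: "\<bar>x\<bar> \<le> 2 * pi"
  shows "\<bar>phi i x - phi0 x\<bar> \<le> 144 * A * \<mu> i" "\<bar>phi' i x - phi0' x\<bar> \<le> 144 * A * \<mu> i"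
proof -
  define y where "y = x / 4"
  have y: "x / 2 = 2 * y" "x / 4 = y" "x = 2 * (2 * y)" by (auto simp: y_def)
  have "\<bar>y\<bar> < 2 * w0" using x w0 by (auto simp: y_def)
  note n = phi_near(2)[OF this, of i] phi'_near[OF this, of i]
  have m1: "\<mu> i \<le> 1" using \<mu>_small[of i] by simp
  have A0: "0 \<le> A" using A_bounds(1) by simp
  have c: "\<bar>m i z - h z\<bar> \<le> 1 * (\<mu> i * 1)" "\<bar>m' i z - h' z\<bar> \<le> A * (\<mu> i * 1)" for z
    using m_close[of i z] mult_right_mono[OF A_bounds(1) \<mu>_nonneg, of i] by simp_all
  have b: "\<bar>h z\<bar> \<le> 1 * 1" "\<bar>h' z\<bar> \<le> A * 1" for z using h_bound(1)[of z] h'_A[of z] by simp_all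
  note nn = \<mu>_nonneg[of i] m1
  have mm: "\<bar>m i (2 * y) * m i y - h (2 * y) * h y\<bar> \<le> 3 * (\<mu> i * 1)"
    "\<bar>m' i (2 * y) * m i y - h' (2 * y) * h y\<bar> \<le> 3 * A * (\<mu> i * 1)"
    "\<bar>m i (2 * y) * m' i y - h (2 * y) * h' y\<bar> \<le> 3 * A * (\<mu> i * 1)"
    using abs_mult_diff_le[OF c(1)[of "2 * y"] c(1)[of y] b(1)[of "2 * y"] b(1)[of y] nn zero_le_one zero_le_one zero_le_one zero_le_one]
      abs_mult_diff_le[OF c(2)[of "2 * y"] c(1)[of y] b(2)[of "2 * y"] b(1)[of y] nn A0 zero_le_one zero_le_one zero_le_one]
      abs_mult_diff_le[OF c(1)[of "2 * y"] c(2)[of y] b(1)[of "2 * y"] b(2)[of y] nn zero_le_one A0 zero_le_one zero_le_one]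
    by simp_all
  have hh: "\<bar>h (2 * y) * h y\<bar> \<le> 1" "\<bar>h' (2 * y) * h y\<bar> \<le> A" "\<bar>h (2 * y) * h' y\<bar> \<le> A"
    using mult_mono[OF h_bound(1)[of "2 * y"] h_bound(1)[of y]] mult_mono[OF h'_A[of "2 * y"] h_bound(1)[of y]]
      mult_mono[OF h_bound(1)[of "2 * y"] h'_A[of y]] A0 by (auto simp: abs_mult)
  have hh3: "\<bar>h (2 * y) * h y\<bar> \<le> 3 * 1" "\<bar>h' (2 * y) * h y\<bar> \<le> 3 * A * 1" "\<bar>h (2 * y) * h' y\<bar> \<le> 3 * A * 1"
    using hh A0 by linarith+
  have n': "\<bar>phi i y - 1\<bar> \<le> 16 * (\<mu> i * 1)" "\<bar>phi' i y - 0\<bar> \<le> 16 * (\<mu> i * 1)"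
    "\<bar>1::real\<bar> \<le> 16 * 1" "\<bar>0::real\<bar> \<le> 16 * 1"
    using n nn(1) by simp_all
  have nn3: "0 \<le> (3::real)" "0 \<le> 3 * A" "0 \<le> (16::real)" using A0 by simp_all
  have p: "\<bar>(m i (2 * y) * m i y) * phi i y - (h (2 * y) * h y) * 1\<bar> \<le> 144 * \<mu> i"
    "\<bar>(m' i (2 * y) * m i y) * phi i y - (h' (2 * y) * h y) * 1\<bar> \<le> 144 * A * \<mu> i"
    "\<bar>(m i (2 * y) * m' i y) * phi i y - (h (2 * y) * h' y) * 1\<bar> \<le> 144 * A * \<mu> i"
    "\<bar>(m i (2 * y) * m i y) * phi' i y - (h (2 * y) * h y) * 0\<bar> \<le> 144 * \<mu> i"
    using abs_mult_diff_le[OF mm(1) n'(1) hh3(1) n'(3) nn nn3(1,3) zero_le_one zero_le_one]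
      abs_mult_diff_le[OF mm(2) n'(1) hh3(2) n'(3) nn nn3(2,3) zero_le_one zero_le_one]
      abs_mult_diff_le[OF mm(3) n'(1) hh3(3) n'(3) nn nn3(2,3) zero_le_one zero_le_one]
      abs_mult_diff_le[OF mm(1) n'(2) hh3(1) n'(4) nn nn3(1,3) zero_le_one zero_le_one]
    by simp_all
  have AM: "1 * \<mu> i \<le> A * \<mu> i" using mult_right_mono[OF A_bounds(1) \<mu>_nonneg, of i] by simp
  have "phi i x = m i (2 * y) * m i y * phi i y"
    by (subst y(3)) (simp only: phi_double mult.assoc)
  then show "\<bar>phi i x - phi0 x\<bar> \<le> 144 * A * \<mu> i"
    using phi0_product(1)[OF x] p(1) AM unfolding y(1,2) by simp
  have "4 * phi' i x = 2 * (m' i (2 * y) * m i y * phi i y) + m i (2 * y) * m' i y * phi i y + m i (2 * y) * m i y * phi' i y"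
    by (subst y(3), unfold phi'_double phi_double) (simp add: algebra_simps)
  moreover have "4 * phi0' x = 2 * (h' (2 * y) * h y) + h (2 * y) * h' y"
    using phi0_product(2)[OF x] unfolding y(1,2) by simp
  ultimately show "\<bar>phi' i x - phi0' x\<bar> \<le> 144 * A * \<mu> i"
    using p(2,3,4) AM by simp
qed

lemma wt_inner:
  assumes "\<bar>x\<bar> \<le> 2 * pi"
  shows "1 \<le> 65 * wt x"
proof -
  have "\<bar>x\<bar> ^ 2 \<le> 8 ^ 2" using assms pi_less_4 by (intro power_mono) auto
  then show ?thesis using wt_pos[of x] by (simp add: pos_le_divide_eq add_pos_nonneg)
qed

text \<open>Inside [-2 pi, 2 pi] the weight is at least 1/65, so unweighted bounds suffice; outside,
  the limit is 0 and the decay estimate is the difference estimate.\<close>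

lemma phi_c1_close: "c1_close \<mu> wt phi phi0"
proof (rule c1_closeI[OF phi0_deriv, where C = "65 * A" and K = "8192 * A * K" and f' = phi'])
  have A0: "0 \<le> A" using A_bounds(1) by simp
  have b: "\<bar>phi0 x\<bar> \<le> 65 * A * wt x \<and> \<bar>phi0' x\<bar> \<le> 65 * A * wt x" for x
  proof (cases "\<bar>x\<bar> \<le> 2 * pi")
    case True
    have "A * 1 \<le> A * (65 * wt x)" using wt_inner[OF True] A0 by (intro mult_left_mono) auto
    moreover have "\<bar>phi0 x\<bar> \<le> A" "\<bar>phi0' x\<bar> \<le> A"
      using phi0_inner[OF True] h_bound(1)[of "x / 2"] h'_A[of "x / 2"] A_bounds(1) by auto
    ultimately show ?thesis by (simp add: mult_ac)
  next
    case False
    then show ?thesis using phi0_outer[of x] A0 by (auto simp: add_nonneg_nonneg)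
  qed
  then show "\<bar>phi0 x\<bar> \<le> 65 * A * wt x" "\<bar>phi0' x\<bar> \<le> 65 * A * wt x" for x by auto
  have "\<bar>phi i x - phi0 x\<bar> \<le> 8192 * A * K * (\<mu> i * wt x) \<and> \<bar>phi' i x - phi0' x\<bar> \<le> 8192 * A * K * (\<mu> i * wt x)" for i x
  proof (cases "\<bar>x\<bar> \<le> 2 * pi")
    case True
    have "1 \<le> A\<^sup>2" using power_mono[of 1 A 2] A_bounds(1) by simp
    then have "144 * 65 \<le> 8192 * K" by (simp add: K_def)
    then have "144 * 65 * (A * (\<mu> i * wt x)) \<le> 8192 * K * (A * (\<mu> i * wt x))"
      using A0 \<mu>_nonneg[of i] wt_pos[of x] by (intro mult_right_mono) auto
    moreover have "144 * A * \<mu> i * 1 \<le> 144 * A * \<mu> i * (65 * wt x)"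
      using wt_inner[OF True] A0 \<mu>_nonneg[of i] by (intro mult_left_mono) auto
    moreover have "144 * A * \<mu> i * (65 * wt x) = 144 * 65 * (A * (\<mu> i * wt x))"
      "8192 * A * K * (\<mu> i * wt x) = 8192 * K * (A * (\<mu> i * wt x))" by simp_all
    ultimately show ?thesis using phi_close_near[OF True, of i] by linarith
  next
    case False
    then show ?thesis using phi0_outer[of x] phi_decay_wt[of x i] by auto
  qed
  then show "\<forall>\<^sub>F i in sequentially. \<forall>x. (phi i has_real_derivative phi' i x) (at x) \<and>
      \<bar>phi i x - phi0 x\<bar> \<le> 8192 * A * K * (\<mu> i * wt x) \<and> \<bar>phi' i x - phi0' x\<bar> \<le> 8192 * A * K * (\<mu> i * wt x)"
    using phi_deriv by (intro always_eventually) auto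
qed

lemma m_c1_close: "c1_close \<mu> (\<lambda>_. 1) m h"
  by (rule c1_closeI[OF h_deriv, where C = A and K = 1 and f' = m'])
     (use A_bounds(1) h_bound(1) h'_A m_close m_deriv in \<open>auto intro: order_trans\<close>)

end

subsection \<open>Orthonormalisation\<close>

text \<open>The encoding sends k to 2 k or -2 k - 1, hence never beyond 2 |k|. This compares sums
  over the integers with the series of 1 / n^2.\<close>

lemma le_double_int_decode: "real n \<le> 2 * \<bar>real_of_int (int_decode n)\<bar>"
proof -
  have "int_encode k \<le> nat (2 * \<bar>k\<bar>)" for k
    by (auto simp: int_encode_def sum_encode_def)
  from this[of "int_decode n"] show ?thesis by simp
qed

lemma summable_wt_int_decode: "summable (\<lambda>n. wt (real_of_int (int_decode n)))"
proof (rule summable_comparison_test_ev)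
  show "summable (\<lambda>n. 4 * inverse (real n ^ 2))"
    by (intro summable_mult inverse_power_summable) simp
  show "\<forall>\<^sub>F n in sequentially. norm (wt (real_of_int (int_decode n))) \<le> 4 * inverse (real n ^ 2)"
    using eventually_gt_at_top[of 0]
  proof eventually_elim
    case (elim n)
    have "(real n)\<^sup>2 \<le> (2 * \<bar>real_of_int (int_decode n)\<bar>)\<^sup>2"
      using le_double_int_decode by (intro power_mono) auto
    then have "(real n)\<^sup>2 \<le> 4 * (1 + (real_of_int (int_decode n))\<^sup>2)" by (simp add: power_mult_distrib)
    then show ?case using elim wt_pos[of "real_of_int (int_decode n)"]
      by (simp add: divide_simps add_pos_nonneg)
  qed
qed

text \<open>Peetre's inequality with |x| <= 2 pi < 8 gives 2 * 65. Uniformity in x is what the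
  M-test for periodisations requires.\<close>

lemma wt_shift_le:
  assumes "\<bar>x\<bar> \<le> 2 * pi"
  shows "wt (x + 2 * pi * of_int k) \<le> 130 * wt (of_int k)"
proof -
  define a where "a = 2 * pi * real_of_int k"
  have "\<bar>x\<bar> ^ 2 \<le> 8 ^ 2" using assms pi_less_4 by (intro power_mono) auto
  then have x: "1 + x\<^sup>2 \<le> 65" by simp
  have "1 * \<bar>real_of_int k\<bar> \<le> 2 * pi * \<bar>real_of_int k\<bar>" using pi_gt3 by (intro mult_right_mono) auto
  then have "\<bar>real_of_int k\<bar> \<le> \<bar>a\<bar>" by (simp add: a_def abs_mult)
  then have "(real_of_int k)\<^sup>2 \<le> a\<^sup>2" by (simp only: abs_le_square_iff)
  then have "1 + (real_of_int k)\<^sup>2 \<le> 1 + a\<^sup>2" by simp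
  also have "\<dots> \<le> 2 * (1 + (x + a)\<^sup>2) * (1 + (a - (x + a))\<^sup>2)" by (rule peetre_inequality)
  also have "\<dots> \<le> 2 * (1 + (x + a)\<^sup>2) * 65" using x by (intro mult_left_mono) auto
  finally show ?thesis unfolding a_def[symmetric] by (simp add: divide_simps add_pos_nonneg)
qed

definition periodize :: "(real \<Rightarrow> real) \<Rightarrow> real \<Rightarrow> real" where
  "periodize f x = (\<Sum>\<^sub>\<infinity>k::int. f (x + 2 * pi * of_int k))"

lemma bij_int_decode: "bij int_decode"
  by (simp add: bij_def inj_int_decode surj_int_decode)

lemma periodize_periodic: "periodize f (x + 2 * pi) = periodize f x"
proof -
  have b: "bij_betw (\<lambda>k::int. k + 1) UNIV UNIV" by (rule bij_betwI[where g = "\<lambda>k. k - 1"]) auto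
  have "periodize f (x + 2 * pi) = (\<Sum>\<^sub>\<infinity>k::int. f (x + 2 * pi * of_int (k + 1)))"
    by (simp add: periodize_def algebra_simps)
  also have "\<dots> = periodize f x" unfolding periodize_def by (rule infsum_reindex_bij_betw[OF b])
  finally show ?thesis .
qed

text \<open>Enumerating the integers by \<open>int_decode\<close> turns the unordered sum, the form
  in which \<open>Phi_l\<close> is given, into a series that can be differentiated termwise.\<close>

lemma periodize_summable_abs:
  assumes f: "\<And>x. \<bar>f x\<bar> \<le> C * wt x"
  shows "summable (\<lambda>n. norm (f (x + 2 * pi * of_int (int_decode n))))"
    and "(\<lambda>k. f (x + 2 * pi * of_int k)) summable_on UNIV"
    and "periodize f x = (\<Sum>n. f (x + 2 * pi * of_int (int_decode n)))"
proof -
  have C: "0 \<le> C" using order_trans[OF abs_ge_zero f[of 0]] by simp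
  show s: "summable (\<lambda>n. norm (f (x + 2 * pi * of_int (int_decode n))))"
  proof (rule summable_comparison_test_ev)
    show "summable (\<lambda>n. C * (2 * (1 + x\<^sup>2)) * wt (real_of_int (int_decode n)))"
      by (intro summable_mult summable_wt_int_decode)
    show "\<forall>\<^sub>F n in sequentially. norm (norm (f (x + 2 * pi * of_int (int_decode n)))) \<le> C * (2 * (1 + x\<^sup>2)) * wt (real_of_int (int_decode n))"
    proof (intro always_eventually allI)
      fix n
      define k where "k = real_of_int (int_decode n)"
      define a where "a = 2 * pi * k"
      have "1 * \<bar>k\<bar> \<le> 2 * pi * \<bar>k\<bar>" using pi_gt3 by (intro mult_right_mono) auto
      then have "\<bar>k\<bar> \<le> \<bar>a\<bar>" by (simp add: a_def abs_mult)
      then have "k\<^sup>2 \<le> a\<^sup>2" by (simp only: abs_le_square_iff)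
      moreover have "1 + a\<^sup>2 \<le> 2 * (1 + (x + a)\<^sup>2) * (1 + x\<^sup>2)" using peetre_inequality[of a "x + a"] by simp
      ultimately have "1 + k\<^sup>2 \<le> 2 * (1 + x\<^sup>2) * (1 + (x + a)\<^sup>2)" by (simp only: mult_ac)
      then have "wt (x + a) \<le> 2 * (1 + x\<^sup>2) * wt k" by (simp add: divide_simps add_pos_nonneg)
      then have "C * wt (x + a) \<le> C * (2 * (1 + x\<^sup>2) * wt k)" using C by (intro mult_left_mono)
      then show "norm (norm (f (x + 2 * pi * of_int (int_decode n)))) \<le> C * (2 * (1 + x\<^sup>2)) * wt (real_of_int (int_decode n))"
        using f[of "x + a"] by (simp add: a_def k_def mult.assoc)
    qed
  qed
  have hs: "((\<lambda>n. f (x + 2 * pi * of_int (int_decode n))) has_sum (\<Sum>n. f (x + 2 * pi * of_int (int_decode n)))) UNIV"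
    by (rule norm_summable_imp_has_sum[OF s]) (use summable_norm_cancel[OF s] in \<open>simp add: summable_sums\<close>)
  then show "(\<lambda>k. f (x + 2 * pi * of_int k)) summable_on UNIV"
    using summable_on_reindex_bij_betw[OF bij_int_decode, of "\<lambda>k. f (x + 2 * pi * of_int k)"]
    by (auto simp: summable_on_def)
  show "periodize f x = (\<Sum>n. f (x + 2 * pi * of_int (int_decode n)))"
    unfolding periodize_def
    using infsum_reindex_bij_betw[OF bij_int_decode, of "\<lambda>k. f (x + 2 * pi * of_int k)"] infsumI[OF hs] by simp
qed

definition wt_sum :: real where "wt_sum = (\<Sum>n. wt (real_of_int (int_decode n)))"

text \<open>The M-test justifies termwise differentiation on (-2 pi, 2 pi), an open interval around
  a full period; periodicity transports the result from \<open>wrap x\<close> to x.\<close>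

lemma periodize_deriv:
  assumes d: "\<And>x. (f has_real_derivative f' x) (at x)"
    and f: "\<And>x. \<bar>f x\<bar> \<le> C * wt x" "\<And>x. \<bar>f' x\<bar> \<le> C * wt x"
  shows "\<bar>periodize f x\<bar> \<le> C * (130 * wt_sum) \<and>
    (\<exists>D. (periodize f has_real_derivative D) (at x) \<and> \<bar>D\<bar> \<le> C * (130 * wt_sum))"
proof -
  have C: "0 \<le> C" using order_trans[OF abs_ge_zero f(1)[of 0]] by simp
  define S where "S = {- 2 * pi <..< 2 * pi}"
  have S: "0 \<in> S" "convex S" "open S" by (auto simp: S_def)
  define F where "F n x = f (x + 2 * pi * of_int (int_decode n))" for n x
  define F' where "F' n x = f' (x + 2 * pi * of_int (int_decode n))" for n x
  define b where "b n = C * 130 * wt (real_of_int (int_decode n))" for n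
  have sb: "summable b" unfolding b_def by (intro summable_mult summable_wt_int_decode)
  have le: "\<bar>F n x\<bar> \<le> b n" "\<bar>F' n x\<bar> \<le> b n" if "x \<in> S" for n x
  proof -
    have "\<bar>x\<bar> \<le> 2 * pi" using that by (auto simp: S_def abs_le_iff)
    from mult_left_mono[OF wt_shift_le[OF this] C, of "int_decode n"]
    have "C * wt (x + 2 * pi * of_int (int_decode n)) \<le> b n" by (simp add: b_def)
    then show "\<bar>F n x\<bar> \<le> b n" "\<bar>F' n x\<bar> \<le> b n"
      using f[of "x + 2 * pi * of_int (int_decode n)"] unfolding F_def F'_def by linarith+
  qed
  have bs: "(\<Sum>n. b n) = C * (130 * wt_sum)"
    unfolding b_def wt_sum_def using suminf_mult[OF summable_wt_int_decode, of "C * 130"] by simp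
  have Fd: "(F n has_real_derivative F' n x) (at x)" for n x
  proof -
    have "((\<lambda>x. x + 2 * pi * of_int (int_decode n)) has_real_derivative 1) (at x)"
      by (auto intro!: derivative_eq_intros)
    from DERIV_chain2[OF d this] show ?thesis by (simp add: F_def[abs_def] F'_def)
  qed
  have unif: "uniformly_convergent_on S (\<lambda>n x. \<Sum>j<n. F' j x)"
    by (rule Weierstrass_m_test'[OF _ sb]) (use le in auto)
  have eq: "periodize f = (\<lambda>x. \<Sum>n. F n x)"
    unfolding F_def using periodize_summable_abs(3)[OF f(1)] by auto
  have inner: "\<bar>periodize f x\<bar> \<le> C * (130 * wt_sum) \<and>
    (periodize f has_real_derivative (\<Sum>n. F' n x)) (at x) \<and> \<bar>\<Sum>n. F' n x\<bar> \<le> C * (130 * wt_sum)" if x: "x \<in> S" for x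
  proof (intro conjI)
    have "norm (\<Sum>n. F n x) \<le> (\<Sum>n. b n)" by (rule norm_suminf_le[OF _ sb]) (use le[OF x] in auto)
    then show "\<bar>periodize f x\<bar> \<le> C * (130 * wt_sum)" by (simp add: eq bs)
    have "norm (\<Sum>n. F' n x) \<le> (\<Sum>n. b n)" by (rule norm_suminf_le[OF _ sb]) (use le[OF x] in auto)
    then show "\<bar>\<Sum>n. F' n x\<bar> \<le> C * (130 * wt_sum)" by (simp add: bs)
    have "summable (\<lambda>n. F n 0)"
      using summable_norm_cancel[OF periodize_summable_abs(1)[OF f(1), of 0]] by (simp add: F_def)
    from has_field_derivative_series'(2)[OF S(2) has_field_derivative_at_within[OF Fd] unif S(1) this, of x] x S(3)
    show "(periodize f has_real_derivative (\<Sum>n. F' n x)) (at x)" by (simp add: eq interior_open)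
  qed
  define k where "k = \<lfloor>(x + pi) / (2 * pi)\<rfloor>"
  have xk: "x + 2 * pi * of_int (- k) = wrap x" using wrap_eq[of x] by (simp add: k_def)
  have wS: "wrap x \<in> S" using wrap_bounds[of x] pi_gt_zero by (simp add: S_def)
  have per: "periodize f (z + 2 * pi * of_int (- k)) = periodize f z" for z
    by (rule periodic_wrap(1)) (rule periodize_periodic)
  have "((\<lambda>z. z + 2 * pi * of_int (- k)) has_real_derivative 1) (at x)"
    by (auto intro!: derivative_eq_intros)
  from DERIV_chain2[OF _ this, of "periodize f" "\<Sum>n. F' n (wrap x)"] inner[OF wS]
  have "(periodize f has_real_derivative (\<Sum>n. F' n (wrap x))) (at x)"
    unfolding xk per by simp
  then show ?thesis using inner[OF wS] per[of x] unfolding xk by auto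
qed

text \<open>Periodisation is linear, so the rate follows from \<open>periodize_deriv\<close> for the
  difference, whose decay constant is \<open>A * \<mu> i\<close>.\<close>

lemma c1_close_periodize:
  assumes c: "c1_close \<mu> wt f g" and \<mu>: "\<And>i. 0 \<le> \<mu> i"
  shows "c1_close \<mu> (\<lambda>_. 1) (\<lambda>i. periodize (f i)) (periodize g)"
proof -
  obtain A where A: "A \<ge> 0" "\<And>x. (g has_real_derivative deriv g x) (at x)"
    "\<And>x. \<bar>g x\<bar> \<le> A * wt x" "\<And>x. \<bar>deriv g x\<bar> \<le> A * wt x"
    "\<forall>\<^sub>F i in sequentially. \<forall>x. (f i has_real_derivative deriv (f i) x) (at x) \<and>
        \<bar>f i x - g x\<bar> \<le> A * (\<mu> i * wt x) \<and> \<bar>deriv (f i) x - deriv g x\<bar> \<le> A * (\<mu> i * wt x)"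
    using c \<mu> less_imp_le[OF wt_pos] by (rule c1_closeE) blast
  define E where "E = 130 * wt_sum"
  have g: "\<bar>periodize g x\<bar> \<le> A * E" "(periodize g has_real_derivative deriv (periodize g) x) (at x)"
    "\<bar>deriv (periodize g) x\<bar> \<le> A * E" for x
    using periodize_deriv[OF A(2,3,4), of x] DERIV_imp_deriv unfolding E_def by force+
  show ?thesis
  proof (rule c1_closeI[OF g(2), where C = "A * E" and K = "A * E" and f' = "\<lambda>i. deriv (periodize (f i))"])
    show "\<forall>\<^sub>F i in sequentially. \<forall>x. (periodize (f i) has_real_derivative deriv (periodize (f i)) x) (at x) \<and>
        \<bar>periodize (f i) x - periodize g x\<bar> \<le> A * E * (\<mu> i * 1) \<and>
        \<bar>deriv (periodize (f i)) x - deriv (periodize g) x\<bar> \<le> A * E * (\<mu> i * 1)"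
      using A(5)
    proof eventually_elim
      case (elim i)
      define d where "d x = f i x - g x" for x
      have dd: "(d has_real_derivative deriv (f i) x - deriv g x) (at x)" for x
        unfolding d_def using elim A(2) by (intro DERIV_diff) auto
      have db: "\<bar>d x\<bar> \<le> A * \<mu> i * wt x" "\<bar>deriv (f i) x - deriv g x\<bar> \<le> A * \<mu> i * wt x" for x
        using elim unfolding d_def by (simp_all only: mult.assoc)
      note P = periodize_deriv[OF dd db]
      have fe: "periodize (f i) = (\<lambda>x. periodize g x + periodize d x)"
      proof
        fix x
        have "f i = (\<lambda>x. g x + d x)" by (auto simp: d_def)
        then show "periodize (f i) x = periodize g x + periodize d x"
          using infsum_add[OF periodize_summable_abs(2)[OF A(3), of x] periodize_summable_abs(2)[OF db(1), of x]]
          by (simp add: periodize_def)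
      qed
      show ?case
      proof
        fix x
        obtain D where D: "(periodize d has_real_derivative D) (at x)" "\<bar>D\<bar> \<le> A * \<mu> i * E"
          using P[of x] unfolding E_def by auto
        have "(periodize (f i) has_real_derivative deriv (periodize g) x + D) (at x)"
          unfolding fe by (intro DERIV_add g D)
        moreover from DERIV_imp_deriv[OF this] have "deriv (periodize (f i)) x = deriv (periodize g) x + D" .
        moreover have "\<bar>periodize d x\<bar> \<le> A * \<mu> i * E" using P[of x] unfolding E_def by auto
        ultimately show "(periodize (f i) has_real_derivative deriv (periodize (f i)) x) (at x) \<and>
          \<bar>periodize (f i) x - periodize g x\<bar> \<le> A * E * (\<mu> i * 1) \<and>
          \<bar>deriv (periodize (f i)) x - deriv (periodize g) x\<bar> \<le> A * E * (\<mu> i * 1)"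
          using D by (simp add: fe mult_ac)
      qed
    qed
  qed (use g in auto)
qed

context meyer_family
begin

text \<open>Reduce x to y in [0, 2 pi). Only the translates y and y - 2 pi can contribute, and their
  halves differ by pi, so the sum is an instance of \<open>qmf\<close>.\<close>

lemma phi0_orthonormal: "periodize (\<lambda>x. (phi0 x)\<^sup>2) x = 1"
proof -
  define k0 where "k0 = - \<lfloor>x / (2 * pi)\<rfloor>"
  define y where "y = x + 2 * pi * of_int k0"
  have "of_int \<lfloor>x / (2 * pi)\<rfloor> * (2 * pi) \<le> x" "x < (of_int \<lfloor>x / (2 * pi)\<rfloor> + 1) * (2 * pi)"
    by (auto intro: floor_divide_lower floor_divide_upper)
  then have y: "0 \<le> y" "y < 2 * pi" by (auto simp: y_def k0_def algebra_simps)
  have xk: "x + 2 * pi * of_int k = y + 2 * pi * of_int (k - k0)" for k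
    by (simp add: y_def algebra_simps)
  have z: "phi0 (x + 2 * pi * of_int k) = 0" if "k \<notin> {k0, k0 - 1}" for k
  proof -
    define j where "j = k - k0"
    have "j \<ge> 1 \<or> j \<le> -2" using that by (auto simp: j_def)
    then have "2 * pi \<le> \<bar>y + 2 * pi * of_int j\<bar>"
    proof
      assume "j \<ge> 1"
      then have "2 * pi * 1 \<le> 2 * pi * of_int j" by (intro mult_left_mono) auto
      then show ?thesis using y by linarith
    next
      assume "j \<le> -2"
      then have "real_of_int j \<le> real_of_int (-2)" by (simp only: of_int_le_iff)
      then have "2 * pi * of_int j \<le> 2 * pi * (-2)" by (intro mult_left_mono) auto
      then show ?thesis using y by linarith
    qed
    then show ?thesis using phi0_outer unfolding xk j_def by blast
  qed
  have "periodize (\<lambda>x. (phi0 x)\<^sup>2) x = infsum (\<lambda>k. (phi0 (x + 2 * pi * of_int k))\<^sup>2) {k0, k0 - 1}"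
    unfolding periodize_def by (rule infsum_cong_neutral) (use z in auto)
  also have "\<dots> = (phi0 y)\<^sup>2 + (phi0 (y - 2 * pi))\<^sup>2"
    unfolding xk by simp
  also have "phi0 y = h (y / 2 - pi + pi)" using phi0_inner[of y] y by simp
  also have "phi0 (y - 2 * pi) = h (y / 2 - pi)" using phi0_inner[of "y - 2 * pi"] y by (simp add: diff_divide_distrib)
  finally show ?thesis using qmf[of "y / 2 - pi"] by simp
qed

section \<open>The orthonormalised wavelet profile\<close>

definition Phi :: "nat \<Rightarrow> real \<Rightarrow> real" where "Phi i = periodize (\<lambda>x. (phi i x)\<^sup>2)"

lemma Phi_c1_close: "c1_close \<mu> (\<lambda>_. 1) Phi (\<lambda>_. 1)"
proof -
  have w: "0 \<le> wt x" for x using wt_pos[of x] by simp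
  have "c1_close \<mu> (\<lambda>x. wt x * wt x) (\<lambda>i x. phi i x * phi i x) (\<lambda>x. phi0 x * phi0 x)"
    by (rule c1_close_mult[OF phi_c1_close phi_c1_close \<mu>_nonneg \<mu>_lim w w])
  then have "c1_close \<mu> wt (\<lambda>i x. phi i x * phi i x) (\<lambda>x. phi0 x * phi0 x)"
  proof (rule c1_close_weight_mono[OF _ \<mu>_nonneg, where K = 1])
    show "wt x * wt x \<le> 1 * wt x" for x
      using divide_1_plus_square_le[of 1 x] w by (intro mult_right_mono) auto
  qed (use w in auto)
  moreover have "periodize (\<lambda>x. phi0 x * phi0 x) = (\<lambda>_. 1)"
    using phi0_orthonormal by (simp add: power2_eq_square fun_eq_iff)
  ultimately show ?thesis
    using c1_close_periodize[OF _ \<mu>_nonneg, where f = "\<lambda>i x. phi i x * phi i x" and g = "\<lambda>x. phi0 x * phi0 x"]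
    by (simp add: Phi_def[abs_def] power2_eq_square)
qed

definition R :: "nat \<Rightarrow> real \<Rightarrow> real" where
  "R i x = m i (x / 2 + pi) * sqrt (Phi i (x / 2 + pi)) / sqrt (Phi i (2 * (x / 2 + pi))) * (phi i (x / 2) / sqrt (Phi i (x / 2)))"

definition R0 :: "real \<Rightarrow> real" where "R0 x = h (x / 2 + pi) * phi0 (x / 2)"

text \<open>All three normalising roots are close to 1, so that only the mask and the scaling
  function survive in the limit.\<close>

lemma R_c1_close: "c1_close \<mu> wt R R0"
proof -
  have w: "0 \<le> wt x" for x using wt_pos[of x] by simp
  have o: "0 \<le> (1::real)" by simp
  note sq = c1_close_sqrt[OF Phi_c1_close \<mu>_nonneg \<mu>_lim]
  note mul = c1_close_mult[OF _ _ \<mu>_nonneg \<mu>_lim]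
  note aff = c1_close_affine[OF _ \<mu>_nonneg]
  have 1: "c1_close \<mu> (\<lambda>_. 1) (\<lambda>i x. m i (1/2 * x + pi)) (\<lambda>x. h (1/2 * x + pi))"
    by (rule aff[OF m_c1_close o])
  have 2: "c1_close \<mu> (\<lambda>_. 1) (\<lambda>i x. sqrt (Phi i (1/2 * x + pi))) (\<lambda>x. 1)"
    by (rule aff[OF sq(1) o])
  \<comment> \<open>The argument is 2 * (x / 2 + pi) expanded.\<close>
  have 3: "c1_close \<mu> (\<lambda>_. 1) (\<lambda>i x. 1 / sqrt (Phi i (1 * x + 2 * pi))) (\<lambda>x. 1)"
    by (rule aff[OF sq(2) o])
  have 4: "c1_close \<mu> (\<lambda>_. 1) (\<lambda>i x. 1 / sqrt (Phi i (1/2 * x + 0))) (\<lambda>x. 1)"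
    by (rule aff[OF sq(2) o])
  have "c1_close \<mu> (\<lambda>x. wt (1/2 * x + 0)) (\<lambda>i x. phi i (1/2 * x + 0)) (\<lambda>x. phi0 (1/2 * x + 0))"
    by (rule aff[OF phi_c1_close w])
  then have 5: "c1_close \<mu> wt (\<lambda>i x. phi i (1/2 * x + 0)) (\<lambda>x. phi0 (1/2 * x + 0))"
  proof (rule c1_close_weight_mono[OF _ \<mu>_nonneg, where K = 4])
    show "wt (1/2 * x + 0) \<le> 4 * wt x" for x
      by (simp add: divide_simps add_pos_nonneg power_divide)
  qed (use w in auto)
  have "c1_close \<mu> (\<lambda>x. 1 * 1 * 1 * (wt x * 1))
    (\<lambda>i x. m i (1/2 * x + pi) * sqrt (Phi i (1/2 * x + pi)) * (1 / sqrt (Phi i (1 * x + 2 * pi))) * (phi i (1/2 * x + 0) * (1 / sqrt (Phi i (1/2 * x + 0)))))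
    (\<lambda>x. h (1/2 * x + pi) * 1 * 1 * (phi0 (1/2 * x + 0) * 1))"
    by (intro mul 1 2 3 4 5) (use w in auto)
  then show ?thesis unfolding R_def[abs_def] R0_def[abs_def] by (simp add: distrib_left)
qed

text \<open>\<open>R0\<close> is continuous, so a zero integral would make it vanish everywhere. Its
  first factor is 1 at 2 pi and -2 pi, which would force h(pi/2) = h(-pi/2) = 0 and contradict
  \<open>qmf\<close>.\<close>

lemma R0_norm: "(\<integral>x. (R0 x)\<^sup>2 \<partial>lborel) \<noteq> 0"
proof
  assume 0: "(\<integral>x. (R0 x)\<^sup>2 \<partial>lborel) = 0"
  have w: "0 \<le> wt x" for x using wt_pos[of x] by simp
  have cont: "continuous_on UNIV R0"
    using R_c1_close field_differentiable_imp_continuous_at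
    by (auto simp: c1_close_def continuous_on_eq_continuous_at)
  have "integrable lborel (\<lambda>x. (R0 x)\<^sup>2)"
    using c1_close_moment(3)[OF R_c1_close \<mu>_nonneg \<mu>_lim, of "\<lambda>_. 1"] by simp
  from integral_nonneg_eq_0_iff_AE[OF this] 0 have "AE x in lborel. R0 x = 0" by simp
  moreover have op: "open {x. R0 x \<noteq> 0}"
    using cont by (intro open_Collect_neq) auto
  ultimately have "{x. R0 x \<noteq> 0} \<in> null_sets lborel"
    using AE_iff_null[of lborel "\<lambda>x. R0 x = 0"] by simp
  then have "negligible {x. R0 x \<noteq> 0}"
    by (simp add: negligible_iff_null_sets null_sets_completionI)
  with op have "{x. R0 x \<noteq> 0} = {}" using open_not_negligible by blast
  then have z: "R0 x = 0" for x by auto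
  have "h (2 * pi) = 1" "h 0 = 1" using h_pass[of 0] w0_pos h_per[of 0] by auto
  then have "h (pi / 2) = 0" "h (- pi / 2) = 0"
    using z[of "2 * pi"] z[of "- 2 * pi"] phi0_inner[of pi] phi0_inner[of "- pi"] by (auto simp: R0_def)
  then show False using qmf[of "- pi / 2"] by simp
qed

end

subsection \<open>The Meyer mask\<close>

locale meyer_angle =
  fixes \<theta> :: "real \<Rightarrow> real" and w0 :: real
  assumes odd: "\<theta> (- x) = - \<theta> x" and mono: "mono \<theta>" and C2: "C2_fun \<theta>"
    and flat: "x > pi / 3 \<Longrightarrow> \<theta> x = pi / 4" and w0: "pi / 3 \<le> w0" "w0 < pi / 2"
begin

abbreviation "phiM \<equiv> meyer_phi_hat \<theta> w0"
abbreviation "h \<equiv> meyer_mask \<theta> w0"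

lemma w0_pos: "0 < w0" using w0 pi_gt_zero by linarith

text \<open>Compactness bounds the derivative on [-pi/3, pi/3]; outside, \<open>\<theta>\<close> is
  locally constant by \<open>flat\<close> and oddness.\<close>

lemma theta_deriv_bounded: "\<exists>d B. (\<forall>x. (\<theta> has_real_derivative d x) (at x)) \<and> (\<forall>x. \<bar>d x\<bar> \<le> B)"
proof -
  obtain d d2 where d: "\<And>x. (\<theta> has_real_derivative d x) (at x)" "\<And>x. (d has_real_derivative d2 x) (at x)"
    using C2 by (auto simp: C2_fun_def)
  have "continuous_on {- (pi / 3)..pi / 3} d"
    using d(2) DERIV_isCont by (auto intro!: continuous_at_imp_continuous_on)
  then have "bounded (d ` {- (pi / 3)..pi / 3})"
    by (intro compact_imp_bounded compact_continuous_image) auto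
  then obtain B where "\<forall>x\<in>{- (pi / 3)..pi / 3}. \<bar>d x\<bar> \<le> B"
    by (auto simp: bounded_iff)
  then have B: "\<bar>d x\<bar> \<le> B" if "\<bar>x\<bar> \<le> pi / 3" for x
  proof -
    have "x \<in> {- (pi / 3)..pi / 3}" using that by (simp only: atLeastAtMost_iff) linarith
    with \<open>\<forall>x\<in>{- (pi / 3)..pi / 3}. \<bar>d x\<bar> \<le> B\<close> show ?thesis by blast
  qed
  have out: "d x = 0" if "pi / 3 < \<bar>x\<bar>" for x
  proof -
    have op: "open {x::real. pi / 3 < \<bar>x\<bar>}" by (intro open_Collect_less continuous_intros)
    have dd: "((\<lambda>x. sgn x * (pi / 4)) has_real_derivative 0) (at x)"
    proof -
      have "((\<lambda>_. sgn x * (pi / 4)) has_real_derivative 0) (at x)" by simp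
      then show ?thesis
      proof (rule has_field_derivative_transform_within_open)
        show "open {y. 0 < sgn x * y}" by (intro open_Collect_less continuous_intros)
        show "x \<in> {y. 0 < sgn x * y}" using that pi_gt_zero by (auto simp: sgn_if abs_if split: if_splits)
        show "sgn x * (pi / 4) = sgn y * (pi / 4)" if "y \<in> {y. 0 < sgn x * y}" for y
          using that by (auto simp: sgn_if split: if_splits)
      qed
    qed
    have "(\<theta> has_real_derivative 0) (at x)"
    proof (rule has_field_derivative_transform_within_open[OF dd op])
      show "sgn y * (pi / 4) = \<theta> y" if "y \<in> {x. pi / 3 < \<bar>x\<bar>}" for y
      proof (cases "y > 0")
        case True
        then show ?thesis using that flat[of y] by simp
      next
        case False
        then have "y < 0" "pi / 3 < - y" using that pi_gt_zero by (simp_all only: mem_Collect_eq)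
        then have "\<theta> (- y) = pi / 4" using flat by blast
        then show ?thesis using odd[of y] \<open>y < 0\<close> by simp
      qed
    qed (use that in auto)
    then show ?thesis using d(1) DERIV_unique by blast
  qed
  have "\<bar>d x\<bar> \<le> \<bar>B\<bar>" for x
    using B[of x] out[of x] by (cases "\<bar>x\<bar> \<le> pi / 3") auto
  then show ?thesis using d(1) by blast
qed

text \<open>\<open>flat\<close> is a strict condition; continuity adds the endpoint, so that the
  pass and stop bands become closed.\<close>

lemma theta_hi: "pi / 3 \<le> x \<Longrightarrow> \<theta> x = pi / 4"
proof -
  assume x: "pi / 3 \<le> x"
  obtain d where d: "\<And>x. (\<theta> has_real_derivative d x) (at x)" using theta_deriv_bounded by auto
  have "(\<lambda>n. x + inverse (real (Suc n))) \<longlonglongrightarrow> x + 0"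
    by (intro tendsto_intros LIMSEQ_inverse_real_of_nat)
  then have "(\<lambda>n. \<theta> (x + inverse (real (Suc n)))) \<longlonglongrightarrow> \<theta> x"
    using DERIV_isCont[OF d] by (intro isCont_tendsto_compose[of x \<theta>]) auto
  moreover have "\<theta> (x + inverse (real (Suc n))) = pi / 4" for n
  proof (rule flat)
    have "0 < inverse (real (Suc n))" by simp
    with x show "pi / 3 < x + inverse (real (Suc n))" by linarith
  qed
  ultimately have "(\<lambda>n::nat. pi / 4) \<longlonglongrightarrow> \<theta> x" by (simp only:)
  then show ?thesis by (simp only: LIMSEQ_const_iff)
qed

lemma theta_lo: "x \<le> - (pi / 3) \<Longrightarrow> \<theta> x = - (pi / 4)"
  using theta_hi[of "- x"] odd[of x] by simp

lemma theta_bounds: "- (pi / 4) \<le> \<theta> x" "\<theta> x \<le> pi / 4"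
proof -
  have le: "\<theta> x \<le> pi / 4" for x
    using monoD[OF mono, of x "max x (pi / 3)"] theta_hi[of "max x (pi / 3)"] by simp
  show "\<theta> x \<le> pi / 4" by (rule le)
  show "- (pi / 4) \<le> \<theta> x" using le[of "- x"] odd[of x] by simp
qed

definition c :: real where "c = pi / (3 * (pi - 2 * w0))"
text \<open>The transition formula on the whole line. As \<open>\<theta>\<close> saturates at -pi/4
  and pi/4, it takes the values 1 and 0 beyond the transition band without a case
  distinction.\<close>

definition F :: "real \<Rightarrow> real" where "F x = cos (pi / 4 + \<theta> (c * (x - pi)))"

lemma c_pos: "0 < c" and c_eq: "c * (pi - 2 * w0) = pi / 3"
  using w0 by (simp_all add: c_def field_simps)

lemma F_low: "x \<le> 2 * w0 \<Longrightarrow> F x = 1"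
proof -
  assume "x \<le> 2 * w0"
  then have "c * (x - pi) \<le> c * (2 * w0 - pi)" using c_pos by (intro mult_left_mono) auto
  also have "\<dots> = - (pi / 3)" using c_eq by (simp add: algebra_simps)
  finally show ?thesis by (simp add: F_def theta_lo)
qed

lemma F_high: "2 * pi - 2 * w0 \<le> x \<Longrightarrow> F x = 0"
proof -
  assume "2 * pi - 2 * w0 \<le> x"
  then have "c * (pi - 2 * w0) \<le> c * (x - pi)" using c_pos by (intro mult_left_mono) auto
  then have t: "\<theta> (c * (x - pi)) = pi / 4" by (intro theta_hi) (simp add: c_eq)
  have "pi / 4 + pi / 4 = pi / 2" by simp
  then show ?thesis unfolding F_def t by simp
qed

lemma F_bounds: "0 \<le> F x" "F x \<le> 1"
  unfolding F_def using theta_bounds[of "c * (x - pi)"] by (auto intro!: cos_ge_zero)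

lemma phiM_F: "phiM x = F \<bar>x\<bar>"
  using F_low[of "\<bar>x\<bar>"] F_high[of "\<bar>x\<bar>"] by (auto simp: meyer_phi_hat_def F_def c_def)

lemma phiM_bounds: "0 \<le> phiM x" "phiM x \<le> 1"
  by (simp_all add: phiM_F F_bounds)

text \<open>\<open>F\<close> agrees with the function for x > - 2 w0, since both are 1 between - 2
  w0 and 2 w0, and its mirror image agrees for x < 0. These open sets cover the line, which avoids
  differentiating the absolute value at 0.\<close>

lemma phiM_deriv_bounded: "\<exists>B. \<forall>x. \<exists>D. (phiM has_real_derivative D) (at x) \<and> \<bar>D\<bar> \<le> B"
proof -
  obtain d B where d: "\<And>x. (\<theta> has_real_derivative d x) (at x)" "\<And>x. \<bar>d x\<bar> \<le> B"
    using theta_deriv_bounded by auto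
  define F' where "F' x = - sin (pi / 4 + \<theta> (c * (x - pi))) * (d (c * (x - pi)) * c)" for x
  have F': "(F has_real_derivative F' x) (at x)" for x
    unfolding F_def F'_def
    by (auto intro!: derivative_eq_intros DERIV_chain2[OF d(1)])
  have F'b: "\<bar>F' x\<bar> \<le> B * c" for x
  proof -
    have "\<bar>sin (pi / 4 + \<theta> (c * (x - pi)))\<bar> * (\<bar>d (c * (x - pi))\<bar> * c) \<le> 1 * (B * c)"
      using d(2) c_pos by (intro mult_mono mult_right_mono) auto
    then show ?thesis using c_pos by (simp add: F'_def abs_mult)
  qed
  have "\<exists>D. (phiM has_real_derivative D) (at x) \<and> \<bar>D\<bar> \<le> B * c" for x
  proof (cases "x > - 2 * w0")
    case True
    have "(phiM has_real_derivative F' x) (at x)"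
    proof (rule has_field_derivative_transform_within_open[OF F'])
      show "open {- 2 * w0<..}" "x \<in> {- 2 * w0<..}" using True by auto
      show "F y = phiM y" if "y \<in> {- 2 * w0<..}" for y
        using that F_low[of y] F_low[of "- y"] w0_pos by (cases "y \<ge> 0") (auto simp: phiM_F)
    qed
    then show ?thesis using F'b by blast
  next
    case False
    have "((\<lambda>x. F (- x)) has_real_derivative F' (- x) * (- 1)) (at x)"
      by (rule DERIV_chain2[OF F']) (auto intro!: derivative_eq_intros)
    then have "(phiM has_real_derivative F' (- x) * (- 1)) (at x)"
    proof (rule has_field_derivative_transform_within_open)
      show "open {..<0::real}" "x \<in> {..<0}" using False w0_pos by auto
      show "F (- y) = phiM y" if "y \<in> {..<0}" for y using that by (simp add: phiM_F)
    qed
    then show ?thesis using F'b[of "- x"] by auto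
  qed
  then show ?thesis by blast
qed

text \<open>Such a point is a minimum or a maximum. This yields vanishing derivatives on the closed
  pass and stop bands, endpoints included.\<close>

lemma extremum_deriv_zero:
  fixes f :: "real \<Rightarrow> real"
  assumes "(f has_real_derivative D) (at x)" "\<And>x. 0 \<le> f x" "\<And>x. f x \<le> 1" "f x = 0 \<or> f x = 1"
  shows "D = 0"
  using assms(4)
proof
  assume "f x = 0"
  then show ?thesis using assms(2) by (intro DERIV_local_min[OF assms(1), of 1]) auto
next
  assume "f x = 1"
  then show ?thesis using assms(3) by (intro DERIV_local_max[OF assms(1), of 1]) auto
qed

lemma h_wrap: "h x = phiM (2 * wrap x)"
  by (simp add: meyer_mask_def wrap_def)

lemma h_per: "h (x + 2 * pi) = h x"
proof -
  have "x + 2 * pi = wrap x + 2 * pi * of_int (\<lfloor>(x + pi) / (2 * pi)\<rfloor> + 1)"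
    using wrap_eq[of x] by (simp add: algebra_simps)
  from wrap_unique[OF this wrap_bounds] show ?thesis by (simp add: h_wrap)
qed

text \<open>For |x| between pi and pi + w0 both sides vanish. The identity thus holds on an open
  neighbourhood of [-pi, pi] and can be differentiated at the endpoints.\<close>

lemma h_inner:
  assumes "\<bar>x\<bar> < pi + w0"
  shows "h x = phiM (2 * x)"
proof -
  have *: "phiM y = 0" if "2 * pi - 2 * w0 \<le> \<bar>y\<bar>" for y using F_high[OF that] by (simp add: phiM_F)
  consider "- pi \<le> x" "x < pi" | "pi \<le> x" | "x < - pi" by linarith
  then show ?thesis
  proof cases
    case 1
    then have "wrap x = x" by (intro wrap_unique[where k = 0]) auto
    then show ?thesis by (simp add: h_wrap)
  next
    case 2
    then have "wrap x = x - 2 * pi" using assms w0 pi_gt_zero by (intro wrap_unique[where k = 1]) auto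
    then show ?thesis using 2 assms w0_pos by (simp add: h_wrap *)
  next
    case 3
    then have "wrap x = x + 2 * pi" using assms w0 pi_gt_zero by (intro wrap_unique[where k = "-1"]) auto
    then show ?thesis using 3 assms w0_pos by (simp add: h_wrap *)
  qed
qed

lemma h_bounds: "0 \<le> h x" "h x \<le> 1"
  by (simp_all add: h_wrap phiM_bounds)

abbreviation "phiM' \<equiv> deriv phiM"
abbreviation "h' \<equiv> deriv h"

lemma phiM_deriv: "(phiM has_real_derivative phiM' x) (at x)"
  using phiM_deriv_bounded DERIV_imp_deriv by metis

lemma h_inner_deriv:
  assumes "\<bar>x\<bar> < pi + w0"
  shows "(h has_real_derivative 2 * phiM' (2 * x)) (at x)"
proof -
  have "((\<lambda>x. 2 * x) has_real_derivative 2) (at x)" by (auto intro!: derivative_eq_intros)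
  from DERIV_chain2[OF phiM_deriv this]
  have "((\<lambda>x. phiM (2 * x)) has_real_derivative 2 * phiM' (2 * x)) (at x)" by (simp add: mult.commute)
  then show ?thesis
  proof (rule has_field_derivative_transform_within_open)
    show "open {x. \<bar>x\<bar> < pi + w0}" by (intro open_Collect_less continuous_intros)
  qed (use assms h_inner in auto)
qed

lemma h_deriv_wrap: "(h has_real_derivative 2 * phiM' (2 * wrap x)) (at x)"
proof -
  define k where "k = \<lfloor>(x + pi) / (2 * pi)\<rfloor>"
  have xk: "x + 2 * pi * of_int (- k) = wrap x" using wrap_eq[of x] by (simp add: k_def)
  have per: "h (z + 2 * pi * of_int (- k)) = h z" for z by (rule periodic_wrap(1)) (rule h_per)
  have "\<bar>wrap x\<bar> < pi + w0" using abs_wrap_le[of x] w0_pos by linarith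
  from h_inner_deriv[OF this] have *: "(h has_real_derivative 2 * phiM' (2 * wrap x)) (at (x + 2 * pi * of_int (- k)))"
    unfolding xk .
  have "((\<lambda>z. z + 2 * pi * of_int (- k)) has_real_derivative 1) (at x)" by (auto intro!: derivative_eq_intros)
  from DERIV_chain2[OF * this] show ?thesis unfolding per by simp
qed

lemma h_deriv: "(h has_real_derivative h' x) (at x)"
  using h_deriv_wrap DERIV_imp_deriv by metis

lemma h'_per: "h' (x + 2 * pi) = h' x"
proof -
  have "((\<lambda>z. z + 2 * pi) has_real_derivative 1) (at x)" by (auto intro!: derivative_eq_intros)
  from DERIV_chain2[OF h_deriv this] have "(h has_real_derivative h' (x + 2 * pi)) (at x)" unfolding h_per by simp
  then show ?thesis using DERIV_imp_deriv by metis
qed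

lemma h'_bounded: "\<exists>B. \<forall>x. \<bar>h' x\<bar> \<le> B"
proof -
  obtain B where "\<And>x. \<exists>D. (phiM has_real_derivative D) (at x) \<and> \<bar>D\<bar> \<le> B" using phiM_deriv_bounded by auto
  then have "\<bar>phiM' x\<bar> \<le> B" for x using DERIV_imp_deriv by metis
  moreover have "h' x = 2 * phiM' (2 * wrap x)" for x by (rule DERIV_imp_deriv[OF h_deriv_wrap])
  ultimately have "\<bar>h' x\<bar> \<le> 2 * B" for x by (simp add: abs_mult)
  then show ?thesis by blast
qed

lemma h_pass: "\<bar>x\<bar> \<le> w0 \<Longrightarrow> h x = 1 \<and> h' x = 0"
proof -
  assume x: "\<bar>x\<bar> \<le> w0"
  then have "h x = phiM (2 * x)" using pi_gt_zero by (intro h_inner) linarith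
  also have "\<dots> = 1" using x F_low[of "\<bar>2 * x\<bar>"] by (simp add: phiM_F)
  finally show ?thesis using extremum_deriv_zero[OF h_deriv h_bounds] by simp
qed

lemma h_stop: "pi - w0 \<le> \<bar>x\<bar> \<Longrightarrow> \<bar>x\<bar> \<le> pi \<Longrightarrow> h x = 0 \<and> h' x = 0"
proof -
  assume x: "pi - w0 \<le> \<bar>x\<bar>" "\<bar>x\<bar> \<le> pi"
  then have "h x = phiM (2 * x)" using w0_pos by (intro h_inner) linarith
  also have "\<dots> = 0" using x F_high[of "\<bar>2 * x\<bar>"] by (simp add: phiM_F)
  finally show ?thesis using extremum_deriv_zero[OF h_deriv h_bounds] by simp
qed

text \<open>Adding pi replaces |wrap x| by pi - |wrap x|, which reverses the sign of the argument of
  \<open>\<theta>\<close>. Oddness then turns the angle into its complement to pi/2, hence the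
  cosine into a sine.\<close>

lemma qmf: "(h x)\<^sup>2 + (h (x + pi))\<^sup>2 = 1"
proof -
  define r where "r = wrap x"
  obtain k where xk: "x = r + 2 * pi * of_int k" using wrap_eq[of x] unfolding r_def by blast
  have r: "- pi \<le> r" "r < pi" using wrap_bounds by (auto simp: r_def)
  have "\<bar>wrap (x + pi)\<bar> = pi - \<bar>r\<bar>"
  proof (cases "r < 0")
    case True
    then have "wrap (x + pi) = r + pi" using r xk by (intro wrap_unique[where k = k]) auto
    then show ?thesis using True r by simp
  next
    case False
    then have "wrap (x + pi) = r - pi" using r xk by (intro wrap_unique[where k = "k + 1"]) (auto simp: algebra_simps)
    then show ?thesis using False r by simp
  qed
  then have hp: "h (x + pi) = F (2 * pi - 2 * \<bar>r\<bar>)" by (simp add: h_wrap phiM_F abs_mult)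
  have h0: "h x = F (2 * \<bar>r\<bar>)" by (simp add: h_wrap phiM_F abs_mult r_def)
  define t where "t = c * (2 * \<bar>r\<bar> - pi)"
  have "c * (2 * pi - 2 * \<bar>r\<bar> - pi) = - t" by (simp add: t_def algebra_simps)
  then have "h (x + pi) = cos (pi / 2 - (pi / 4 + \<theta> t))" by (simp add: hp F_def odd)
  moreover have "cos (pi / 2 - z) = sin z" for z by (simp add: cos_diff)
  ultimately have "h (x + pi) = sin (pi / 4 + \<theta> t)" by (simp only:)
  moreover have "h x = cos (pi / 4 + \<theta> t)" by (simp add: h0 F_def t_def)
  ultimately show ?thesis by simp
qed

lemma phiM_inner: "\<bar>x\<bar> \<le> 2 * pi \<Longrightarrow> phiM x = h (x / 2) \<and> phiM' x = h' (x / 2) / 2"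
proof -
  assume "\<bar>x\<bar> \<le> 2 * pi"
  then have "\<bar>x / 2\<bar> < pi + w0" using w0_pos by simp
  from h_inner[OF this] DERIV_imp_deriv[OF h_inner_deriv[OF this]] show ?thesis by simp
qed

lemma phiM_outer: "2 * pi \<le> \<bar>x\<bar> \<Longrightarrow> phiM x = 0 \<and> phiM' x = 0"
proof -
  assume "2 * pi \<le> \<bar>x\<bar>"
  then have "phiM x = 0" using F_high[of "\<bar>x\<bar>"] w0_pos by (simp add: phiM_F)
  then show ?thesis using extremum_deriv_zero[OF phiM_deriv phiM_bounds] by simp
qed

end

section \<open>Summation methods and differentiation\<close>

lemma fourier_deriv:
  assumes d: "\<And>x. x \<in> {-pi..pi} \<Longrightarrow> (f has_real_derivative f' x) (at x)" and per: "f pi = f (- pi)"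
  shows "fourier_a f' k = real k * fourier_b f k" "fourier_b f' k = - real k * fourier_a f k"
proof -
  have cont: "continuous_on {-pi..pi} f"
    using DERIV_isCont[OF d] by (auto intro!: continuous_at_imp_continuous_on)
  have "((\<lambda>x. f' x * cos (real k * x)) has_integral (real k * integral {-pi..pi} (\<lambda>x. f x * sin (real k * x)))) {-pi..pi}"
  proof (rule integration_by_parts[OF bounded_bilinear_mult _ cont, where g' = "\<lambda>x. - real k * sin (real k * x)"])
    have "((\<lambda>x. f x * sin (real k * x)) has_integral integral {-pi..pi} (\<lambda>x. f x * sin (real k * x))) {-pi..pi}"
      by (intro integrable_integral integrable_continuous_real continuous_intros cont)
    from has_integral_mult_right[OF this, of "- real k"]
    show "((\<lambda>x. f x * (- real k * sin (real k * x))) has_integral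
        f pi * cos (real k * pi) - f (- pi) * cos (real k * - pi) - real k * integral {- pi..pi} (\<lambda>x. f x * sin (real k * x))) {- pi..pi}"
      \<comment> \<open>The boundary terms cancel because \<open>f\<close> agrees at both ends and
        the cosine is even; in the sine case below they vanish individually.\<close>
      using per by (simp add: mult_ac)
  qed (auto intro!: continuous_intros derivative_eq_intros d simp flip: has_real_derivative_iff_has_vector_derivative)
  then show "fourier_a f' k = real k * fourier_b f k"
    by (simp add: fourier_a_def fourier_b_def integral_unique)
  have "((\<lambda>x. f' x * sin (real k * x)) has_integral (- real k * integral {-pi..pi} (\<lambda>x. f x * cos (real k * x)))) {-pi..pi}"
  proof (rule integration_by_parts[OF bounded_bilinear_mult _ cont, where g' = "\<lambda>x. real k * cos (real k * x)"])
    have "((\<lambda>x. f x * cos (real k * x)) has_integral integral {-pi..pi} (\<lambda>x. f x * cos (real k * x))) {-pi..pi}"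
      by (intro integrable_integral integrable_continuous_real continuous_intros cont)
    from has_integral_mult_right[OF this, of "real k"]
    show "((\<lambda>x. f x * (real k * cos (real k * x))) has_integral
        f pi * sin (real k * pi) - f (- pi) * sin (real k * - pi) - - real k * integral {- pi..pi} (\<lambda>x. f x * cos (real k * x))) {- pi..pi}"
      by (simp add: mult_ac)
  qed (auto intro!: continuous_intros derivative_eq_intros d simp flip: has_real_derivative_iff_has_vector_derivative)
  then show "fourier_b f' k = - real k * fourier_a f k"
    by (simp add: fourier_a_def fourier_b_def integral_unique)
qed

text \<open>The multipliers depend on the mode only, so the method commutes with differentiation;
  the constant mode fits because \<open>fourier_a f' 0 = 0\<close>. This makes \<open>u1_l\<close>
  the derivative of \<open>u_l\<close>, and \<open>gamma_l\<close> the error of that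
  derivative.\<close>

lemma lin_sum_deriv:
  assumes d: "\<And>x. x \<in> {-pi..pi} \<Longrightarrow> (f has_real_derivative f' x) (at x)" and per: "f pi = f (- pi)"
  shows "(lin_sum lam n f has_real_derivative lin_sum lam n f' x) (at x)"
proof -
  have fd: "fourier_a f' k = real k * fourier_b f k" "fourier_b f' k = - real k * fourier_a f k" for k
    using fourier_deriv[OF d per] by auto
  have "((\<lambda>x. lam k * (fourier_a f k * cos (real k * x) + fourier_b f k * sin (real k * x))) has_real_derivative
      lam k * (fourier_a f' k * cos (real k * x) + fourier_b f' k * sin (real k * x))) (at x)" for lam :: "nat \<Rightarrow> real" and k
    unfolding fd
    by (auto intro!: derivative_eq_intros simp: algebra_simps)
  then have "((\<lambda>x. fourier_a f 0 / 2 + (\<Sum>k = 1..n. lam n k * (fourier_a f k * cos (real k * x) + fourier_b f k * sin (real k * x)))) has_real_derivative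
    0 + (\<Sum>k = 1..n. lam n k * (fourier_a f' k * cos (real k * x) + fourier_b f' k * sin (real k * x)))) (at x)"
    by (intro DERIV_add DERIV_const DERIV_sum)
  moreover have "fourier_a f' 0 = 0" by (simp add: fd)
  ultimately show ?thesis by (simp add: lin_sum_def[abs_def])
qed

lemma lin_sum_periodic: "lin_sum lam n f (x + 2 * pi) = lin_sum lam n f x"
proof -
  have "cos (real k * (x + 2 * pi)) = cos (real k * x)" "sin (real k * (x + 2 * pi)) = sin (real k * x)" for k
  proof -
    have e: "real k * (x + 2 * pi) = real k * x + real k * (2 * pi)" by (simp add: algebra_simps)
    show "cos (real k * (x + 2 * pi)) = cos (real k * x)" "sin (real k * (x + 2 * pi)) = sin (real k * x)"
      unfolding e cos_add sin_add using cos_2npi[of k] sin_2npi[of k] by (simp_all add: mult_ac)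
  qed
  then show ?thesis by (simp only: lin_sum_def)
qed

lemma lin_sum_continuous: "continuous_on S (lin_sum lam n f)"
  unfolding lin_sum_def by (intro continuous_intros)

lemma supnormC_upper:
  assumes "\<And>x. \<bar>x\<bar> \<le> pi \<Longrightarrow> \<bar>f x\<bar> \<le> K" "\<bar>x\<bar> \<le> pi"
  shows "\<bar>f x\<bar> \<le> supnormC f"
  unfolding supnormC_def using assms
  by (intro cSUP_upper) (auto intro!: bdd_aboveI2[where M = K] simp: abs_le_iff)

subsection \<open>Approximating masks\<close>

context meyer_angle
begin

abbreviation "q \<equiv> mask_l \<theta> w0"

text \<open>The quotient rule for \<open>mask_l\<close>. At |x| = pi the divisions by zero give 0,
  the correct derivative, since the mask vanishes nearby.\<close>

definition q' :: "nat \<Rightarrow> real \<Rightarrow> real" where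
  "q' l x = h' x / cos (x / 2) ^ (2 * l) + real l * h x * sin (x / 2) / cos (x / 2) ^ (2 * l + 1)"

lemma cos_half_pos: "\<bar>x\<bar> < pi \<Longrightarrow> 0 < cos (x / 2)"
  by (intro cos_gt_zero_pi) auto

lemma cos_half_nonneg: "\<bar>x\<bar> \<le> pi \<Longrightarrow> 0 \<le> cos (x / 2)"
  by (intro cos_ge_zero) auto

lemma cos_half_power_deriv:
  "((\<lambda>x. cos (x / 2) ^ (2 * l)) has_real_derivative - real l * cos (x / 2) ^ (2 * l - 1) * sin (x / 2)) (at x)"
  by (auto intro!: derivative_eq_intros)

lemma mask_deriv:
  assumes x: "\<bar>x\<bar> \<le> pi"
  shows "(q l has_real_derivative q' l x) (at x)"
proof (cases "\<bar>x\<bar> = pi")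
  case True
  \<comment> \<open>At |x| = pi both sides of the point belong to stop bands, so the quotient is 0
    on a neighbourhood.\<close>
  have "((\<lambda>_. 0) has_real_derivative 0) (at x)" by simp
  then have "(q l has_real_derivative 0) (at x)"
  proof (rule has_field_derivative_transform_within_open)
    show "open {y. pi - w0 < \<bar>y\<bar> \<and> \<bar>y\<bar> < pi + w0}"
      by (intro open_Collect_conj open_Collect_less continuous_intros)
    show "0 = q l y" if "y \<in> {y. pi - w0 < \<bar>y\<bar> \<and> \<bar>y\<bar> < pi + w0}" for y
    proof -
      have "h y = phiM (2 * y)" using that by (intro h_inner) auto
      also have "2 * pi - 2 * w0 \<le> \<bar>2 * y\<bar>" using that by (simp add: abs_mult)
      from F_high[OF this] have "phiM (2 * y) = 0" by (simp only: phiM_F)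
      finally show ?thesis by (simp add: mask_l_def)
    qed
  qed (use True w0_pos in auto)
  moreover have "q' l x = 0" using h_stop[of x] True w0_pos by (simp add: q'_def)
  ultimately show ?thesis by simp
next
  case False
  then have "cos (x / 2) > 0" using x by (intro cos_half_pos) auto
  then show ?thesis
  \<comment> \<open>The successor form makes the truncated exponent \<open>2 * l - 1\<close>
    explicit; for l = 0 the quotient is \<open>h\<close> itself.\<close>
  proof (cases l)
    case 0
    then show ?thesis using h_deriv by (simp add: mask_l_def[abs_def] q'_def)
  next
    case (Suc k)
    let ?c = "cos (x / 2)" and ?s = "sin (x / 2)"
    have "((\<lambda>x. h x / cos (x / 2) ^ (2 * l)) has_real_derivative
      (h' x * ?c ^ (2 * l) - h x * (- real l * ?c ^ (2 * l - 1) * ?s)) / (?c ^ (2 * l) * ?c ^ (2 * l))) (at x)"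
      using \<open>?c > 0\<close> by (intro DERIV_divide h_deriv cos_half_power_deriv) auto
    also have "(h' x * ?c ^ (2 * l) - h x * (- real l * ?c ^ (2 * l - 1) * ?s)) / (?c ^ (2 * l) * ?c ^ (2 * l)) = q' l x"
      using \<open>?c > 0\<close> by (simp add: q'_def Suc field_simps)
    finally show ?thesis by (simp add: mask_l_def[abs_def])
  qed
qed

lemma mask_deriv_eq: "\<bar>x\<bar> \<le> pi \<Longrightarrow> deriv (q l) x = q' l x"
  by (rule DERIV_imp_deriv[OF mask_deriv])

lemma mask_zero: "pi - w0 \<le> \<bar>x\<bar> \<Longrightarrow> \<bar>x\<bar> \<le> pi \<Longrightarrow> q l x = 0 \<and> q' l x = 0"
  using h_stop[of x] by (simp add: mask_l_def q'_def)

text \<open>Multiplying back undoes the division even where the cosine is 0, because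
  \<open>h\<close> and \<open>h'\<close> vanish there. Mask errors thus become powers of the cosine
  times errors of the summation method.\<close>

lemma cos_power_mask:
  assumes x: "\<bar>x\<bar> \<le> pi"
  shows "cos (x / 2) ^ (2 * l) * q l x = h x"
    and "- real l * cos (x / 2) ^ (2 * l - 1) * sin (x / 2) * q l x + cos (x / 2) ^ (2 * l) * q' l x = h' x"
proof -
  have "cos (x / 2) ^ (2 * l) * q l x = h x \<and>
    - real l * cos (x / 2) ^ (2 * l - 1) * sin (x / 2) * q l x + cos (x / 2) ^ (2 * l) * q' l x = h' x"
  proof (cases "pi - w0 \<le> \<bar>x\<bar>")
    case True
    then show ?thesis using mask_zero[OF True x] h_stop[OF True x] by simp
  next
    case False
    then have "cos (x / 2) > 0" using w0_pos by (intro cos_half_pos) linarith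
    then show ?thesis by (cases l) (auto simp: mask_l_def q'_def field_simps)
  qed
  then show "cos (x / 2) ^ (2 * l) * q l x = h x"
    and "- real l * cos (x / 2) ^ (2 * l - 1) * sin (x / 2) * q l x + cos (x / 2) ^ (2 * l) * q' l x = h' x" by auto
qed

text \<open>Off the stop band the cosine is at least \<open>s\<close>. The bound may depend on
  \<open>l\<close>: it serves to make the supremum in \<open>gamma_l\<close> finite.\<close>

lemma q'_bounded: "\<exists>K. \<forall>x. \<bar>x\<bar> \<le> pi \<longrightarrow> \<bar>q' l x\<bar> \<le> K"
proof -
  obtain B where B: "\<And>x. \<bar>h' x\<bar> \<le> B" using h'_bounded by auto
  have B0: "0 \<le> B" using order_trans[OF abs_ge_zero B] .
  define s where "s = cos ((pi - w0) / 2)"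
  have s: "0 < s" using w0_pos w0 pi_gt_zero unfolding s_def by (intro cos_half_pos) auto
  have "\<bar>q' l x\<bar> \<le> B / s ^ (2 * l) + real l / s ^ (2 * l + 1)" if x: "\<bar>x\<bar> \<le> pi" for x
  proof (cases "pi - w0 \<le> \<bar>x\<bar>")
    case True
    then show ?thesis using mask_zero[OF True x] s B0 by simp
  next
    case False
    have "cos (x / 2) = cos (\<bar>x\<bar> / 2)" by (simp add: abs_if)
    also have "\<dots> \<ge> s" using False w0_pos unfolding s_def by (intro cos_monotone_0_pi_le) auto
    finally have cs: "s \<le> cos (x / 2)" .
    then have p: "s ^ n \<le> cos (x / 2) ^ n" for n using s by (intro power_mono) auto
    have 1: "\<bar>h' x / cos (x / 2) ^ (2 * l)\<bar> \<le> B / s ^ (2 * l)"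
      using B[of x] B0 p[of "2 * l"] s cs by (auto simp: abs_divide intro!: frac_le)
    have "\<bar>h x\<bar> * \<bar>sin (x / 2)\<bar> \<le> 1 * 1" using h_bounds[of x] by (intro mult_mono) auto
    then have "real l * (\<bar>h x\<bar> * \<bar>sin (x / 2)\<bar>) \<le> real l * 1" by (intro mult_left_mono) auto
    then have "\<bar>real l * h x * sin (x / 2)\<bar> \<le> real l" by (simp add: abs_mult mult.assoc)
    then have 2: "\<bar>real l * h x * sin (x / 2) / cos (x / 2) ^ (2 * l + 1)\<bar> \<le> real l / s ^ (2 * l + 1)"
      using p[of "2 * l + 1"] s cs unfolding abs_divide by (intro frac_le) auto
    show ?thesis unfolding q'_def using 1 2 by linarith
  qed
  then show ?thesis by blast
qed

end

section \<open>Masks built by a summation method\<close>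

locale meyer_summation = meyer_angle +
  fixes lam :: "nat \<Rightarrow> nat \<Rightarrow> real" and nl :: "nat \<Rightarrow> nat"
begin

abbreviation "u \<equiv> u_l \<theta> w0 lam nl"
abbreviation "u1 \<equiv> u1_l \<theta> w0 lam nl"
abbreviation "\<alpha> \<equiv> alpha_l \<theta> w0 lam nl"
abbreviation "\<gamma> \<equiv> gamma_l \<theta> w0 lam nl"
abbreviation "\<nu> \<equiv> mu_l \<theta> w0 lam nl"

lemma u_deriv: "(u l has_real_derivative u1 l x) (at x)"
  unfolding u_l_def u1_l_def
proof (rule lin_sum_deriv)
  show "(q l has_real_derivative deriv (q l) x) (at x)" if "x \<in> {- pi..pi}" for x
  proof -
    have "\<bar>x\<bar> \<le> pi" using that by auto
    then show ?thesis using mask_deriv mask_deriv_eq by simp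
  qed
  show "q l pi = q l (- pi)" using mask_zero[of pi l] mask_zero[of "- pi" l] w0_pos by simp
qed

lemma bounded_on_period:
  assumes "continuous_on {-pi..pi} f"
  shows "\<exists>K. \<forall>x::real. \<bar>x\<bar> \<le> pi \<longrightarrow> \<bar>f x :: real\<bar> \<le> K"
proof -
  have "bounded (f ` {- pi..pi})"
    using assms by (intro compact_imp_bounded compact_continuous_image) auto
  then obtain K where K: "\<forall>x\<in>{- pi..pi}. \<bar>f x\<bar> \<le> K" by (auto simp: bounded_iff)
  have "\<bar>f x\<bar> \<le> K" if "\<bar>x\<bar> \<le> pi" for x
  proof -
    have "x \<in> {- pi..pi}" using that by auto
    then show ?thesis using K by blast
  qed
  then show ?thesis by blast
qed

lemma u_close: "\<bar>x\<bar> \<le> pi \<Longrightarrow> \<bar>u l x - q l x\<bar> \<le> \<alpha> l"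
proof -
  assume x: "\<bar>x\<bar> \<le> pi"
  have "isCont (q l) y" if "y \<in> {- pi..pi}" for y
  proof -
    have "\<bar>y\<bar> \<le> pi" using that by auto
    then show ?thesis by (rule DERIV_isCont[OF mask_deriv])
  qed
  then have "continuous_on {-pi..pi} (\<lambda>x. u l x - q l x)"
    unfolding u_l_def by (intro continuous_intros lin_sum_continuous continuous_at_imp_continuous_on) auto
  from bounded_on_period[OF this] obtain K where "\<And>x. \<bar>x\<bar> \<le> pi \<Longrightarrow> \<bar>u l x - q l x\<bar> \<le> K" by auto
  from supnormC_upper[of "\<lambda>x. u l x - q l x", OF this x] show ?thesis by (simp add: alpha_l_def)
qed

lemma u1_close: "\<bar>x\<bar> \<le> pi \<Longrightarrow> \<bar>u1 l x - q' l x\<bar> \<le> \<gamma> l"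
proof -
  assume x: "\<bar>x\<bar> \<le> pi"
  have "continuous_on {-pi..pi} (u1 l)" unfolding u1_l_def by (rule lin_sum_continuous)
  from bounded_on_period[OF this] obtain K where K: "\<And>x. \<bar>x\<bar> \<le> pi \<Longrightarrow> \<bar>u1 l x\<bar> \<le> K" by auto
  obtain L where L: "\<And>x. \<bar>x\<bar> \<le> pi \<Longrightarrow> \<bar>q' l x\<bar> \<le> L" using q'_bounded by blast
  have "\<bar>u1 l y - deriv (q l) y\<bar> \<le> K + L" if "\<bar>y\<bar> \<le> pi" for y
    using K[OF that] L[OF that] by (simp add: mask_deriv_eq[OF that])
  from supnormC_upper[of "\<lambda>x. u1 l x - deriv (q l) x", OF this x] show ?thesis
    by (simp add: gamma_l_def mask_deriv_eq[OF x])
qed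

lemma alpha_nonneg: "0 \<le> \<alpha> l" and gamma_nonneg: "0 \<le> \<gamma> l"
  using order_trans[OF abs_ge_zero u_close[of 0 l]] order_trans[OF abs_ge_zero u1_close[of 0 l]] by auto

lemma nu_nonneg: "0 \<le> \<nu> l"
  using alpha_nonneg gamma_nonneg by (simp add: mu_l_def)

lemma alpha_le_nu: "1 \<le> l \<Longrightarrow> \<alpha> l \<le> \<nu> l"
  using mult_right_mono[of 1 "real l" "\<alpha> l"] alpha_nonneg[of l] gamma_nonneg[of l] by (simp add: mu_l_def)

abbreviation "m \<equiv> m_l \<theta> w0 lam nl"

definition m' :: "nat \<Rightarrow> real \<Rightarrow> real" where
  "m' l x = (- real l * cos (x / 2) ^ (2 * l - 1) * sin (x / 2) * u l x + cos (x / 2) ^ (2 * l) * u1 l x) / u l 0"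

lemma m_deriv: "(m l has_real_derivative m' l x) (at x)"
proof -
  have "((\<lambda>x. cos (x / 2) ^ (2 * l) * u l x / u l 0) has_real_derivative
    ((- real l * cos (x / 2) ^ (2 * l - 1) * sin (x / 2)) * u l x + u1 l x * cos (x / 2) ^ (2 * l)) / u l 0) (at x)"
    by (intro DERIV_cdivide DERIV_mult cos_half_power_deriv u_deriv)
  then show ?thesis by (simp add: m_l_def[abs_def] m'_def mult.commute)
qed

lemma m_per: "m l (x + 2 * pi) = m l x"
proof -
  have "cos ((x + 2 * pi) / 2) = - cos (x / 2)" using cos_periodic_pi[of "x / 2"] by (simp add: add_divide_distrib)
  then show ?thesis by (simp add: m_l_def u_l_def lin_sum_periodic)
qed

lemma m'_per: "m' l (x + 2 * pi) = m' l x"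
proof -
  have "((\<lambda>z. z + 2 * pi) has_real_derivative 1) (at x)" by (auto intro!: derivative_eq_intros)
  from DERIV_chain2[OF m_deriv this] have "(m l has_real_derivative m' l (x + 2 * pi)) (at x)" unfolding m_per by simp
  then show ?thesis using m_deriv DERIV_unique by blast
qed

lemma u0_close: "\<bar>u l 0 - 1\<bar> \<le> \<alpha> l"
  using u_close[of 0 l] h_pass[of 0] w0_pos by (simp add: mask_l_def)

text \<open>Multiplying by \<open>u l 0\<close> defers the normalisation. Differentiating
  cos(x/2)^(2l) brings down a factor l and lowers the exponent by one, which is the origin of the
  term l alpha in \<open>mu_l\<close>. The power of the cosine is kept because it supplies the zero
  of the masks at pi.\<close>

lemma scaled_close:
  assumes x: "\<bar>x\<bar> \<le> pi" and l: "1 \<le> l" and u0: "u l 0 \<noteq> 0"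
  shows "\<bar>u l 0 * m l x - h x\<bar> \<le> cos (x / 2) ^ (2 * l - 1) * \<nu> l"
    and "\<bar>u l 0 * m' l x - h' x\<bar> \<le> cos (x / 2) ^ (2 * l - 1) * \<nu> l"
proof -
  define c where "c = cos (x / 2)"
  have c: "0 \<le> c" "c \<le> 1" using cos_half_nonneg[OF x] by (auto simp: c_def)
  have pw: "c ^ (2 * l) \<le> c ^ (2 * l - 1)" "0 \<le> c ^ (2 * l - 1)" "0 \<le> c ^ (2 * l)"
    using c l by (auto intro!: power_decreasing)
  note uc = u_close[OF x, of l] and u1c = u1_close[OF x, of l]
  have "u l 0 * m l x - h x = c ^ (2 * l) * (u l x - q l x)"
    using u0 cos_power_mask(1)[OF x, of l] by (simp add: m_l_def c_def right_diff_distrib)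
  then have "\<bar>u l 0 * m l x - h x\<bar> = c ^ (2 * l) * \<bar>u l x - q l x\<bar>" using pw by (simp add: abs_mult)
  also have "\<dots> \<le> c ^ (2 * l - 1) * \<nu> l"
    using uc alpha_le_nu[OF l] pw(1) c by (intro mult_mono) auto
  finally show "\<bar>u l 0 * m l x - h x\<bar> \<le> cos (x / 2) ^ (2 * l - 1) * \<nu> l" by (simp add: c_def)
  have "u l 0 * m' l x = - real l * c ^ (2 * l - 1) * sin (x / 2) * u l x + c ^ (2 * l) * u1 l x"
    using u0 by (simp add: m'_def c_def)
  then have "u l 0 * m' l x - h' x = - (c ^ (2 * l - 1) * (real l * sin (x / 2) * (u l x - q l x))) + c ^ (2 * l) * (u1 l x - q' l x)"
    using cos_power_mask(2)[OF x, of l, folded c_def] by (simp add: algebra_simps)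
  moreover have "\<bar>c ^ (2 * l - 1) * (real l * sin (x / 2) * (u l x - q l x))\<bar> \<le> c ^ (2 * l - 1) * (real l * \<alpha> l)"
  proof -
    have "\<bar>sin (x / 2)\<bar> * \<bar>u l x - q l x\<bar> \<le> 1 * \<alpha> l" using uc by (intro mult_mono) auto
    then have "real l * (\<bar>sin (x / 2)\<bar> * \<bar>u l x - q l x\<bar>) \<le> real l * \<alpha> l" by (intro mult_left_mono) auto
    from mult_left_mono[OF this pw(2)] show ?thesis using c by (simp add: abs_mult mult.assoc)
  qed
  moreover have "\<bar>c ^ (2 * l) * (u1 l x - q' l x)\<bar> \<le> c ^ (2 * l - 1) * \<gamma> l"
    unfolding abs_mult using u1c pw(1) c by (intro mult_mono) auto
  ultimately have "\<bar>u l 0 * m' l x - h' x\<bar> \<le> c ^ (2 * l - 1) * (real l * \<alpha> l) + c ^ (2 * l - 1) * \<gamma> l" by linarith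
  then show "\<bar>u l 0 * m' l x - h' x\<bar> \<le> cos (x / 2) ^ (2 * l - 1) * \<nu> l"
    by (simp add: c_def mu_l_def distrib_left)
qed

text \<open>Smallness of \<open>\<nu> l\<close> gives u l 0 >= 1/2, so undoing the scaling costs a
  factor 2. The constant 4 + 2 B is twice 1 + (1 + B), the scaled error plus the normalisation
  error.\<close>

lemma mask_estimates:
  assumes x: "\<bar>x\<bar> \<le> pi" and l: "3 \<le> l" and small: "\<nu> l \<le> 1 / 2" and B: "\<And>x. \<bar>h' x\<bar> \<le> B"
  shows "\<bar>m l x - h x\<bar> \<le> (4 + 2 * B) * \<nu> l" "\<bar>m' l x - h' x\<bar> \<le> (4 + 2 * B) * \<nu> l"
    and "pi - w0 \<le> \<bar>x\<bar> \<Longrightarrow> \<bar>m l x\<bar> \<le> (4 + 2 * B) * \<nu> l * (pi - \<bar>x\<bar>) ^ 4"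
    and "pi - w0 \<le> \<bar>x\<bar> \<Longrightarrow> \<bar>m' l x\<bar> \<le> (4 + 2 * B) * \<nu> l * (pi - \<bar>x\<bar>) ^ 4"
proof -
  have l1: "1 \<le> l" using l by simp
  have u: "\<bar>u l 0 - 1\<bar> \<le> \<nu> l" using u0_close[of l] alpha_le_nu[OF l1] by linarith
  then have u0: "1 / 2 \<le> u l 0" "u l 0 \<noteq> 0" using small by linarith+
  define c where "c = cos (x / 2)"
  have c: "0 \<le> c" "c \<le> 1" using cos_half_nonneg[OF x] by (auto simp: c_def)
  note nn = nu_nonneg[of l]
  have B0: "0 \<le> B" using order_trans[OF abs_ge_zero B] .
  note sc = scaled_close[OF x l1 u0(2), folded c_def]
  have unscale: "\<bar>z\<bar> \<le> 2 * y" if "\<bar>u l 0 * z\<bar> \<le> y" for y z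
  proof -
    have "1 / 2 * \<bar>z\<bar> \<le> u l 0 * \<bar>z\<bar>" using u0 by (intro mult_right_mono) auto
    then show ?thesis using that u0 by (simp add: abs_mult)
  qed
  have gen: "\<bar>a - b\<bar> \<le> (4 + 2 * B) * \<nu> l"
    if "\<bar>u l 0 * a - b\<bar> \<le> c ^ (2 * l - 1) * \<nu> l" "\<bar>b\<bar> \<le> 1 + B" for a b
  proof -
    have "c ^ (2 * l - 1) * \<nu> l \<le> 1 * \<nu> l" using c nn by (intro mult_right_mono power_le_one) auto
    moreover have "\<bar>u l 0 - 1\<bar> * \<bar>b\<bar> \<le> \<nu> l * (1 + B)" using u that by (intro mult_mono) auto
    then have "\<bar>(u l 0 - 1) * b\<bar> \<le> \<nu> l * (1 + B)" by (simp add: abs_mult)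
    moreover have "u l 0 * (a - b) = (u l 0 * a - b) - (u l 0 - 1) * b" by (simp add: algebra_simps)
    ultimately have "\<bar>u l 0 * (a - b)\<bar> \<le> \<nu> l + \<nu> l * (1 + B)" using that(1) by linarith
    from unscale[OF this] show ?thesis by (simp add: algebra_simps)
  qed
  show "\<bar>m l x - h x\<bar> \<le> (4 + 2 * B) * \<nu> l" using h_bounds[of x] B0 by (intro gen sc) auto
  show "\<bar>m' l x - h' x\<bar> \<le> (4 + 2 * B) * \<nu> l" using B[of x] by (intro gen sc) auto
  \<comment> \<open>cos (x/2) is the sine of (pi - |x|) / 2, hence at most pi - |x|; l >= 3 makes
    the exponent at least 4.\<close>
  have cpi: "c ^ (2 * l - 1) \<le> (pi - \<bar>x\<bar>) ^ 4"
  proof -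
    have "c = cos (\<bar>x\<bar> / 2)" by (simp add: c_def abs_if)
    also have "\<dots> = sin ((pi - \<bar>x\<bar>) / 2)"
      by (subst sin_cos_eq) (simp add: field_simps)
    also have "\<dots> \<le> (pi - \<bar>x\<bar>) / 2" using x by (intro sin_x_le_x) auto
    also have "\<dots> \<le> pi - \<bar>x\<bar>" using x by simp
    finally have "c \<le> pi - \<bar>x\<bar>" .
    then have "c ^ 4 \<le> (pi - \<bar>x\<bar>) ^ 4" using c by (intro power_mono) auto
    moreover have "c ^ (2 * l - 1) \<le> c ^ 4" using c l by (intro power_decreasing) auto
    ultimately show ?thesis by linarith
  qed
  have stop: "\<bar>a\<bar> \<le> (4 + 2 * B) * \<nu> l * (pi - \<bar>x\<bar>) ^ 4" if "\<bar>u l 0 * a - 0\<bar> \<le> c ^ (2 * l - 1) * \<nu> l" for a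
  proof -
    have "c ^ (2 * l - 1) * \<nu> l \<le> (pi - \<bar>x\<bar>) ^ 4 * \<nu> l" using cpi nn by (intro mult_right_mono) auto
    then have "\<bar>u l 0 * a\<bar> \<le> (pi - \<bar>x\<bar>) ^ 4 * \<nu> l" using that by simp
    from unscale[OF this] have "\<bar>a\<bar> \<le> 2 * ((pi - \<bar>x\<bar>) ^ 4 * \<nu> l)" .
    also have "\<dots> \<le> (4 + 2 * B) * ((pi - \<bar>x\<bar>) ^ 4 * \<nu> l)"
      using B0 nn x by (intro mult_right_mono) auto
    finally show ?thesis by (simp add: mult_ac)
  qed
  show "\<bar>m l x\<bar> \<le> (4 + 2 * B) * \<nu> l * (pi - \<bar>x\<bar>) ^ 4" if "pi - w0 \<le> \<bar>x\<bar>"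
    using sc(1) h_stop[OF that x] by (intro stop) simp
  show "\<bar>m' l x\<bar> \<le> (4 + 2 * B) * \<nu> l * (pi - \<bar>x\<bar>) ^ 4" if "pi - w0 \<le> \<bar>x\<bar>"
    using sc(2) h_stop[OF that x] by (intro stop) simp
qed

text \<open>Shifting the index by N lets conditions that hold for large l hold for every index, as
  the locale demands; the factor 4 + 2 B normalises its constants to 1.\<close>

lemma meyer_family_eventually:
  assumes lim: "\<nu> \<longlonglongrightarrow> 0"
  obtains N B where "meyer_family w0 h h' phiM phiM' B (\<lambda>i. m (i + N)) (\<lambda>i. m' (i + N)) (\<lambda>i. (4 + 2 * B) * \<nu> (i + N))"
proof -
  obtain B where B: "\<And>x. \<bar>h' x\<bar> \<le> B" using h'_bounded by auto
  have B0: "0 \<le> B" using order_trans[OF abs_ge_zero B] .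
  have klim: "(\<lambda>l. (4 + 2 * B) * \<nu> l) \<longlonglongrightarrow> 0" using tendsto_mult_left[OF lim, of "4 + 2 * B"] by simp
  have "\<forall>\<^sub>F l in sequentially. (4 + 2 * B) * \<nu> l < 1 / 1024" using klim by (rule order_tendstoD) simp
  then have "\<forall>\<^sub>F l in sequentially. (4 + 2 * B) * \<nu> l < 1 / 1024 \<and> 3 \<le> l"
    using eventually_ge_at_top[of 3] by (rule eventually_conj)
  then obtain N where N: "\<And>l. N \<le> l \<Longrightarrow> (4 + 2 * B) * \<nu> l < 1 / 1024 \<and> 3 \<le> l"
    by (auto simp: eventually_sequentially)
  have big: "3 \<le> i + N" "(4 + 2 * B) * \<nu> (i + N) \<le> 1 / 1024" "\<nu> (i + N) \<le> 1 / 2" for i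
  proof -
    show n: "3 \<le> i + N" "(4 + 2 * B) * \<nu> (i + N) \<le> 1 / 1024" using N[of "i + N"] by auto
    have "1 * \<nu> (i + N) \<le> (4 + 2 * B) * \<nu> (i + N)" using B0 nu_nonneg by (intro mult_right_mono) auto
    then show "\<nu> (i + N) \<le> 1 / 2" using n by linarith
  qed
  note est = mask_estimates[OF _ big(1,3) B]
  have per: "m l (wrap x) = m l x" "m' l (wrap x) = m' l x" "h (wrap x) = h x" "h' (wrap x) = h' x" for l x
    by (rule periodic_wrap(2), rule m_per m'_per h_per h'_per)+
  have fam: "meyer_family w0 h h' phiM phiM' B (\<lambda>i. m (i + N)) (\<lambda>i. m' (i + N)) (\<lambda>i. (4 + 2 * B) * \<nu> (i + N))"
  proof
    show "\<bar>m (i + N) x - h x\<bar> \<le> (4 + 2 * B) * \<nu> (i + N)" for i x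
      using est(1)[OF abs_wrap_le, of i x] by (simp only: per)
    show "\<bar>m' (i + N) x - h' x\<bar> \<le> (4 + 2 * B) * \<nu> (i + N)" for i x
      using est(2)[OF abs_wrap_le, of i x] by (simp only: per)
    show "m (i + N) 0 = 1" for i
    proof -
      have "\<bar>u (i + N) 0 - 1\<bar> \<le> 1 / 2"
        using u0_close[of "i + N"] alpha_le_nu[of "i + N"] big(1)[of i] big(3)[of i] by linarith
      then have "u (i + N) 0 \<noteq> 0" by auto
      then show ?thesis by (simp add: m_l_def)
    qed
    show "(\<lambda>i. (4 + 2 * B) * \<nu> (i + N)) \<longlonglongrightarrow> 0" using klim by (rule LIMSEQ_ignore_initial_segment)
    show "\<bar>h x\<bar> \<le> 1" for x using h_bounds[of x] by simp
    show "\<bar>m (i + N) x\<bar> \<le> (4 + 2 * B) * \<nu> (i + N) * (pi - \<bar>x\<bar>) ^ 4 \<and>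
        \<bar>m' (i + N) x\<bar> \<le> (4 + 2 * B) * \<nu> (i + N) * (pi - \<bar>x\<bar>) ^ 4"
      if "pi - w0 \<le> \<bar>x\<bar>" "\<bar>x\<bar> \<le> pi" for i x
      using est(3,4)[OF that(2,1)] by blast
  qed (rule w0 h_per h_deriv B h_pass h_stop qmf phiM_deriv phiM_inner phiM_outer m_per m'_per m_deriv big | assumption)+
  show thesis by (rule that[OF fam])
qed

lemma psi_phase:
  assumes "meyer_family w0 h h' phiM phiM' B (\<lambda>i. m (i + N)) (\<lambda>i. m' (i + N)) (\<lambda>i. (4 + 2 * B) * \<nu> (i + N))"
  shows "psi_perp_hat_l \<theta> w0 lam nl (i + N) = (\<lambda>\<omega>. exp (- \<i> * of_real (\<omega> / 2)) * of_real (meyer_family.R (\<lambda>i. m (i + N)) i \<omega>))"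
    and "meyer_psi_hat \<theta> w0 = (\<lambda>\<omega>. exp (- \<i> * of_real (\<omega> / 2)) * of_real (meyer_family.R0 h phiM \<omega>))"
proof -
  interpret meyer_family w0 h h' phiM phiM' B "\<lambda>i. m (i + N)" "\<lambda>i. m' (i + N)" "\<lambda>i. (4 + 2 * B) * \<nu> (i + N)" by fact
  have phi: "phi i = phi_hat_l \<theta> w0 lam nl (i + N)" for i
    by (simp add: phi_def phi_hat_l_def fun_eq_iff)
  have Phi: "Phi i = Phi_l \<theta> w0 lam nl (i + N)" for i
    by (simp add: Phi_def periodize_def Phi_l_def phi fun_eq_iff)
  show "psi_perp_hat_l \<theta> w0 lam nl (i + N) = (\<lambda>\<omega>. exp (- \<i> * of_real (\<omega> / 2)) * of_real (R i \<omega>))"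
    by (simp add: psi_perp_hat_l_def m_perp_l_def phi_perp_hat_l_def R_def phi Phi fun_eq_iff)
  show "meyer_psi_hat \<theta> w0 = (\<lambda>\<omega>. exp (- \<i> * of_real (\<omega> / 2)) * of_real (R0 \<omega>))"
    by (simp add: meyer_psi_hat_def R0_def fun_eq_iff)
qed

lemma bigo_offset:
  fixes f g :: "nat \<Rightarrow> real"
  assumes "(\<lambda>i. f (i + N)) \<in> O(\<lambda>i. C * g (i + N))"
  shows "f \<in> O(g)"
proof -
  from assms obtain K where "\<forall>\<^sub>F i in sequentially. norm (f (i + N)) \<le> K * norm (C * g (i + N))"
    by (elim landau_o.bigE)
  then have "\<forall>\<^sub>F l in sequentially. norm (f l) \<le> K * norm (C * g l)"
    by (subst (asm) eventually_sequentially_seg)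
  then have "\<forall>\<^sub>F l in sequentially. norm (f l) \<le> K * \<bar>C\<bar> * norm (g l)"
    by eventually_elim (simp add: abs_mult)
  then show ?thesis by (rule bigoI)
qed

theorem radius2_bigo_nu:
  assumes lim: "\<nu> \<longlonglongrightarrow> 0"
  shows "(\<lambda>l. radius2 (psi_perp_hat_l \<theta> w0 lam nl l) - radius2 (meyer_psi_hat \<theta> w0)) \<in> O(\<nu>)"
    and "(\<lambda>l. radius2 (inv_fourier (psi_perp_hat_l \<theta> w0 lam nl l)) - radius2 (inv_fourier (meyer_psi_hat \<theta> w0))) \<in> O(\<nu>)"
proof -
  obtain N B where fam: "meyer_family w0 h h' phiM phiM' B (\<lambda>i. m (i + N)) (\<lambda>i. m' (i + N)) (\<lambda>i. (4 + 2 * B) * \<nu> (i + N))"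
    using meyer_family_eventually[OF lim] by metis
  interpret meyer_family w0 h h' phiM phiM' B "\<lambda>i. m (i + N)" "\<lambda>i. m' (i + N)" "\<lambda>i. (4 + 2 * B) * \<nu> (i + N)" by fact
  note r = radius2_diff_bigo[OF R_c1_close \<mu>_nonneg \<mu>_lim R0_norm psi_phase(1)[OF fam] psi_phase(2)[OF fam]]
  show "(\<lambda>l. radius2 (psi_perp_hat_l \<theta> w0 lam nl l) - radius2 (meyer_psi_hat \<theta> w0)) \<in> O(\<nu>)"
    by (rule bigo_offset[OF r(1)])
  show "(\<lambda>l. radius2 (inv_fourier (psi_perp_hat_l \<theta> w0 lam nl l)) - radius2 (inv_fourier (meyer_psi_hat \<theta> w0))) \<in> O(\<nu>)"
    by (rule bigo_offset[OF r(2)])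
qed

end

lemma abs_bigo_max:
  fixes f g k :: "nat \<Rightarrow> real"
  assumes "f \<in> O(g)" "\<And>i. 0 \<le> g i"
  shows "(\<lambda>i. \<bar>f i\<bar>) \<in> O(\<lambda>i. max (g i) (k i))"
proof -
  have "g \<in> O(\<lambda>i. max (g i) (k i))"
    using assms(2) by (intro bigoI[where c = 1] always_eventually) (auto simp: max_def)
  with assms(1) have "f \<in> O(\<lambda>i. max (g i) (k i))" by (rule landau_o.big_trans)
  then show ?thesis by simp
qed

theorem theorem7:
  fixes \<theta> :: "real \<Rightarrow> real" and \<omega>\<^sub>0 :: real
    and lam :: "nat \<Rightarrow> nat \<Rightarrow> real" and nl :: "nat \<Rightarrow> nat" and l0 :: nat
  assumes odd: "\<And>x. \<theta> (- x) = - \<theta> x"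
    and mono: "mono \<theta>"
    and C2: "C2_fun \<theta>"
    and flat: "\<And>x. x > pi / 3 \<Longrightarrow> \<theta> x = pi / 4"
    and w0: "pi / 3 \<le> \<omega>\<^sub>0" "\<omega>\<^sub>0 < pi / 2"
    and alpha: "alpha_l \<theta> \<omega>\<^sub>0 lam nl \<in> o(\<lambda>l. 1 / real l)"
    and gamma: "gamma_l \<theta> \<omega>\<^sub>0 lam nl \<in> o(\<lambda>l. 1)"
    and upi: "\<And>l. l \<ge> l0 \<Longrightarrow> u_l \<theta> \<omega>\<^sub>0 lam nl l pi \<noteq> 0"
    and cpos: "c_const \<theta> \<omega>\<^sub>0 lam nl l0 > 0"
  shows
    "(\<lambda>l. \<bar>radius2 (psi_perp_hat_l \<theta> \<omega>\<^sub>0 lam nl l) - radius2 (meyer_psi_hat \<theta> \<omega>\<^sub>0)\<bar>)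
       \<in> O(\<lambda>l. max (mu_l \<theta> \<omega>\<^sub>0 lam nl l)
            (real l * (32 * pi\<^sup>2 * exp (2 * \<omega>\<^sub>0) / 27) powr
               (- real l + 2 * log 2 ((1 + eps_l \<theta> \<omega>\<^sub>0 lam nl l) / c_const \<theta> \<omega>\<^sub>0 lam nl l0))))
     \<and> (\<lambda>l. \<bar>radius2 (inv_fourier (psi_perp_hat_l \<theta> \<omega>\<^sub>0 lam nl l))
              - radius2 (inv_fourier (meyer_psi_hat \<theta> \<omega>\<^sub>0))\<bar>)
       \<in> O(\<lambda>l. max (mu_l \<theta> \<omega>\<^sub>0 lam nl l)
            ((4 * exp (2 * \<omega>\<^sub>0)) powr
               (- real l + 2 * log 2 ((1 + eps_l \<theta> \<omega>\<^sub>0 lam nl l) / c_const \<theta> \<omega>\<^sub>0 lam nl l0))))"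
proof -
  interpret meyer_summation \<theta> \<omega>\<^sub>0 lam nl
    by unfold_locales (use odd mono C2 flat w0 in auto)
  have "(\<lambda>l. alpha_l \<theta> \<omega>\<^sub>0 lam nl l / (1 / real l)) \<longlonglongrightarrow> 0" using alpha by (rule smalloD_tendsto)
  \<comment> \<open>At l = 0 both expressions are 0, the former through division by zero.\<close>
  then have "(\<lambda>l. real l * alpha_l \<theta> \<omega>\<^sub>0 lam nl l) \<longlonglongrightarrow> 0" by (simp add: mult.commute)
  moreover have "gamma_l \<theta> \<omega>\<^sub>0 lam nl \<longlonglongrightarrow> 0" using smalloD_tendsto[OF gamma] by simp
  ultimately have "(\<lambda>l. real l * alpha_l \<theta> \<omega>\<^sub>0 lam nl l + gamma_l \<theta> \<omega>\<^sub>0 lam nl l) \<longlonglongrightarrow> 0 + 0"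
    by (rule tendsto_add)
  then have lim: "mu_l \<theta> \<omega>\<^sub>0 lam nl \<longlonglongrightarrow> 0" by (simp add: mu_l_def[abs_def])
  show ?thesis
    by (intro conjI abs_bigo_max radius2_bigo_nu lim nu_nonneg)
qed

end
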